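(* For every $\kappa\in\overline{\chi}$ there exists a qmm-space $X=(X,\mu,d^* )$ such that $\tau(X)=\kappa$.
   Context: An mm-space is a Polish space $(X,d_X)$ of diameter at most one equipped with a Borel probability measure $\mu_X$ of full support; $\chi$ is the set of mm-spaces up to measure-preserving isometry. $M_\infty$ is the compact metrizable space (entrywise convergence) of infinite real matrices $(d_{i,j})_{i,j\ge 1}$ with $0\le d_{i,j}\le 1$, $d_{i,j}=d_{j,i}$, $d_{i,i}=0$. $\mathcal{P}(M_\infty)$ is the space of Borel probability measures on $M_\infty$ with the weak topology. For $X\in\chi$, $\tau(X)\in\mathcal{P}(M_\infty)$ is the push-forward of $\mu_X^{\otimes\mathbb{N}}$ under $(x_1,x_2,\dots)\mapsto (d_X(x_i,x_j))_{i,j}$. $\overline{\chi}$ denotes the closure of $\tau(\chi)$ in $\mathcal{P}(M_\infty)$. $\mathcal{P}[0,1]$ is the space of Borel probability measures on $[0,1]$ with the weak topology, $\delta_t$ the point mass at $t$. A qmm-space is a triple $(X,\mu,d^* )$ where $X$ is a standard Borel space, $\mu$ a Borel probability measure on $X$ and $d^*:X\times X\to\mathcal{P}[0,1]$ a Borel measurable map with $d^*(x,x)=\delta_0$ and $d^*(x,y)=d^*(y,x)$, such that for $\mu^3$-almost every triple $(a,b,c)$, if $l(a,b),l(b,c),l(a,c)$ are independent random numbers with laws $d^*(a,b),d^*(b,c),d^*(a,c)$, then almost surely these three lengths satisfy the triangle inequalities. For a qmm-space $(X,\mu,d^* )$, $\tau(X)\in\mathcal{P}(M_\infty)$ is the law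 of the random matrix obtained by choosing $x_1,x_2,\dots$ independently with law $\mu$ and then, conditionally on $(x_i)$, choosing the entries $d_{i,j}=d_{j,i}$ for $i<j$ independently with laws $d^*(x_i,x_j)$ (and $d_{i,i}=0$). (Equivalently: push $\mu^{\otimes \mathbb N}$ forward to a measure on the space of $\mathcal P[0,1]$-valued matrices, view each such matrix as a product probability measure on $M_\infty$, and take the barycenter.) *)

theory Defs
  imports "HOL-Probability.Probability"
begin

section \<open>Borel sets and weak topologies\<close>

definition borel_of :: "'a topology \<Rightarrow> 'a measure" where
  "borel_of T = sigma (topspace T) {U. openin T U}"

definition prob_measures :: "'a::topological_space set \<Rightarrow> 'a measure set" where
  "prob_measures S = {\<mu>. prob_space \<mu> \<and> sets \<mu> = sets (restrict_space borel S)}"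

text \<open>The coarsest topology on \<open>prob_measures S\<close> for which integration against every bounded
  continuous real function on the subspace \<open>S\<close> is continuous.\<close>

definition weak_topology :: "'a::topological_space set \<Rightarrow> 'a measure topology" where
  "weak_topology S = topology_generated_by
     {{\<mu> \<in> prob_measures S. (\<integral>x. f x \<partial>\<mu>) \<in> U} | f U.
        continuous_on S f \<and> bounded (f ` S) \<and> open (U :: real set)}"

definition separable :: "'a topology \<Rightarrow> bool" where
  "separable T \<longleftrightarrow> (\<exists>C. countable C \<and> C \<subseteq> topspace T \<and> T closure_of C = topspace T)"

definition standard_borel :: "'a measure \<Rightarrow> bool" where
  "standard_borel M \<longleftrightarrow>
     (\<exists>T. completely_metrizable_space T \<and> separable T \<and>
          space M = topspace T \<and> sets M = sets (borel_of T))"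


section \<open>Distance matrices\<close>

text \<open>Indices start at 0. The topology of the function type is the product topology,
  that is, entrywise convergence.\<close>

definition M_inf :: "(nat \<Rightarrow> nat \<Rightarrow> real) set" where
  "M_inf = {D. (\<forall>i j. 0 \<le> D i j \<and> D i j \<le> 1) \<and> (\<forall>i j. D i j = D j i) \<and> (\<forall>i. D i i = 0)}"


section \<open>mm-spaces\<close>

text \<open>The carrier is \<open>space M\<close>; it is nonempty because \<open>M\<close> is a probability measure.\<close>

definition mm_space :: "'a measure \<Rightarrow> ('a \<Rightarrow> 'a \<Rightarrow> real) \<Rightarrow> bool" where
  "mm_space M d \<longleftrightarrow>
     Metric_space (space M) d \<and>
     Metric_space.mcomplete (space M) d \<and>
     separable (Metric_space.mtopology (space M) d) \<and>
     (\<forall>x\<in>space M. \<forall>y\<in>space M. d x y \<le> 1) \<and>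
     prob_space M \<and>
     sets M = sets (borel_of (Metric_space.mtopology (space M) d)) \<and>
     (\<forall>U. openin (Metric_space.mtopology (space M) d) U \<and> U \<noteq> {} \<longrightarrow> 0 < emeasure M U)"

definition mm_tau :: "'a measure \<Rightarrow> ('a \<Rightarrow> 'a \<Rightarrow> real) \<Rightarrow> (nat \<Rightarrow> nat \<Rightarrow> real) measure" where
  "mm_tau M d =
     distr (PiM UNIV (\<lambda>_::nat. M)) (restrict_space borel M_inf) (\<lambda>x i j. d (x i) (x j))"

text \<open>A separable metric space has at most continuum many points, so subsets of the reals
  suffice as carriers of mm-spaces; \<open>mm_tau_in_tau_chi\<close> below makes this precise.
  The metric of a carrier has nothing to do with the usual metric of the reals.\<close>

definition tau_chi :: "(nat \<Rightarrow> nat \<Rightarrow> real) measure set" where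
  "tau_chi = {mm_tau M d | (M :: real measure) d. mm_space M d}"

definition chi_closure :: "(nat \<Rightarrow> nat \<Rightarrow> real) measure set" where
  "chi_closure = weak_topology M_inf closure_of tau_chi"

subsection \<open>Carriers in the reals suffice\<close>

lemma space_borel_of [simp]: "space (borel_of T) = topspace T"
  by (simp add: borel_of_def space_measure_of_conv)

lemma sets_borel_of: "sets (borel_of T) = sigma_sets (topspace T) {U. openin T U}"
  unfolding borel_of_def by (rule sets_measure_of) (auto dest: openin_subset)

lemma openin_borel_of: "openin T U \<Longrightarrow> U \<in> sets (borel_of T)"
  by (simp add: sets_borel_of sigma_sets.Basic)

lemma continuous_map_measurable_borel_of:
  assumes "continuous_map S T f"
  shows "f \<in> borel_of S \<rightarrow>\<^sub>M borel_of T"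
  unfolding borel_of_def[of T]
proof (rule measurable_sigma_sets[OF sets_measure_of])
  show "f \<in> space (borel_of S) \<rightarrow> topspace T"
    using assms by (auto simp: continuous_map_def)
  show "f -` U \<inter> space (borel_of S) \<in> sets (borel_of S)" if "U \<in> {U. openin T U}" for U
  proof -
    have "openin S {x \<in> topspace S. f x \<in> U}"
      using assms that by (auto simp: continuous_map_def)
    moreover have "f -` U \<inter> space (borel_of S) = {x \<in> topspace S. f x \<in> U}" by auto
    ultimately show ?thesis by (simp add: openin_borel_of)
  qed
qed (auto dest: openin_subset)

lemma mm_space_dist_measurable:
  assumes "mm_space M d"
  shows "(\<lambda>(x, y). d x y) \<in> borel_measurable (M \<Otimes>\<^sub>M M)"
proof -
  interpret Metric_space "space M" d using assms by (simp add: mm_space_def)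
  have sM: "sets M = sets (borel_of mtopology)" using assms by (simp add: mm_space_def)
  obtain C where C: "countable C" "C \<subseteq> space M" "mtopology closure_of C = space M"
    using assms by (auto simp: mm_space_def separable_def)
  have ball: "mball c r \<in> sets M" for c r
    unfolding sM by (rule openin_borel_of) simp
  have eq: "{z \<in> space (M \<Otimes>\<^sub>M M). (case z of (x, y) \<Rightarrow> d x y) < r} =
      (\<Union>c\<in>C. \<Union>q\<in>\<rat>. mball c q \<times> mball c (r - q))" (is "?L = ?R") for r
  proof (intro equalityI subsetI)
    fix z assume "z \<in> ?L"
    then obtain x y where z: "z = (x, y)" and xy: "x \<in> space M" "y \<in> space M" "d x y < r"
      by (auto simp: space_pair_measure)
    define e where "e = (r - d x y) / 3"
    have "e > 0" using xy by (simp add: e_def)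
    have "x \<in> mtopology closure_of C" using C xy by simp
    then obtain c where c: "c \<in> C" "c \<in> mball x e"
      using \<open>e > 0\<close> by (auto simp: metric_closure_of)
    then have cM: "c \<in> space M" "d c x < e" by (auto simp: commute)
    obtain q where q: "q \<in> \<rat>" "d c x < q" "q < e" using Rats_dense_in_real[OF cM(2)] by auto
    have "d c y \<le> d c x + d x y" using triangle cM xy by blast
    then have "d c y < r - q" using q cM xy unfolding e_def by (simp add: field_simps)
    then show "z \<in> ?R" using z c cM q xy by (auto intro!: bexI[of _ c] bexI[of _ q])
  next
    fix z assume "z \<in> ?R"
    then obtain c q x y where z: "z = (x, y)" and h: "x \<in> mball c q" "y \<in> mball c (r - q)"
      by auto
    then have "d x y \<le> d c x + d c y" using triangle[of x c y] by (auto simp: commute)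
    then show "z \<in> ?L" using z h by (auto simp: space_pair_measure)
  qed
  show ?thesis
    unfolding borel_measurable_iff_less eq
    using C(1) by (intro allI sets.countable_UN'' pair_measureI ball) (auto simp: countable_rat)
qed

lemma mm_space_matrix_measurable:
  assumes "mm_space M d"
  shows "(\<lambda>x i j. d (x i) (x j)) \<in> PiM UNIV (\<lambda>_::nat. M) \<rightarrow>\<^sub>M restrict_space borel M_inf"
proof (rule measurable_restrict_space2)
  interpret Metric_space "space M" d using assms by (simp add: mm_space_def)
  show "(\<lambda>x i j. d (x i) (x j)) \<in> space (PiM UNIV (\<lambda>_::nat. M)) \<rightarrow> M_inf"
    using assms by (auto simp: M_inf_def mm_space_def space_PiM PiE_iff commute)
  show "(\<lambda>x i j. d (x i) (x j)) \<in> borel_measurable (PiM UNIV (\<lambda>_::nat. M))"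
  proof (intro measurable_coordinatewise_then_product)
    fix i j :: nat
    have "(\<lambda>x. (x i, x j)) \<in> PiM UNIV (\<lambda>_::nat. M) \<rightarrow>\<^sub>M M \<Otimes>\<^sub>M M" by measurable
    from measurable_compose[OF this mm_space_dist_measurable[OF assms]]
    show "(\<lambda>x. d (x i) (x j)) \<in> borel_measurable (PiM UNIV (\<lambda>_::nat. M))" by simp
  qed
qed

lemma mm_space_transport:
  fixes f :: "'a \<Rightarrow> 'b"
  assumes mm: "mm_space M d" and inj: "inj_on f (space M)"
  obtains N :: "'b measure" and d' where "mm_space N d'" "mm_tau N d' = mm_tau M d"
proof -
  define X where "X = space M"
  define Y where "Y = f ` X"
  define g where "g = inv_into X f"
  define d' where "d' = (\<lambda>x y. d (g x) (g y))"
  have gf: "g (f x) = x" if "x \<in> X" for x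
    using inj that by (simp add: g_def X_def)
  have gY: "g y \<in> X" "f (g y) = y" if "y \<in> Y" for y
    using that gf by (auto simp: Y_def)
  interpret A: Metric_space X d using mm by (simp add: mm_space_def X_def)
  interpret B: Metric_space Y d'
  proof
    show "d' x y = 0 \<longleftrightarrow> x = y" if "x \<in> Y" "y \<in> Y" for x y
      using that gY by (metis A.zero d'_def)
    show "d' x z \<le> d' x y + d' y z" if "x \<in> Y" "y \<in> Y" "z \<in> Y" for x y z
      using that gY by (simp add: d'_def A.triangle)
  qed (auto simp: d'_def A.commute)
  interpret AB: Metric_space12 X d Y d' ..
  interpret BA: Metric_space12 Y d' X d ..
  have hf: "homeomorphic_map A.mtopology B.mtopology f"
    by (rule AB.isometry_imp_homeomorphic_map) (auto simp: Y_def d'_def gf)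
  have gim: "g ` Y = X" by (auto simp: gY Y_def gf image_image)
  have hg: "homeomorphic_map B.mtopology A.mtopology g"
    by (rule BA.isometry_imp_homeomorphic_map) (auto simp: gim d'_def)
  have sM: "sets M = sets (borel_of A.mtopology)" using mm by (simp add: mm_space_def X_def)
  interpret M: prob_space M using mm by (simp add: mm_space_def)
  define N where "N = distr M (borel_of B.mtopology) f"
  have f [measurable]: "f \<in> M \<rightarrow>\<^sub>M borel_of B.mtopology"
    using continuous_map_measurable_borel_of[OF homeomorphic_imp_continuous_map[OF hf]]
    by (simp add: measurable_cong_sets[OF sM refl])
  have spN: "space N = Y" and seN: "sets N = sets (borel_of B.mtopology)"
    by (auto simp: N_def)
  have fN [measurable]: "f \<in> M \<rightarrow>\<^sub>M N"
    using f by (simp add: measurable_cong_sets[OF refl seN])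
  have pN: "prob_space N" unfolding N_def by (rule M.prob_space_distr) (rule f)
  obtain C where C: "countable C" "C \<subseteq> X" "A.mtopology closure_of C = X"
    using mm A.topspace_mtopology unfolding mm_space_def separable_def X_def[symmetric] by auto
  have "B.mtopology closure_of (f ` C) = f ` (A.mtopology closure_of C)"
    by (rule homeomorphic_map_closure_of[OF hf]) (use C in simp)
  then have sep: "separable B.mtopology"
    unfolding separable_def B.topspace_mtopology using C by (intro exI[of _ "f ` C"]) (auto simp: Y_def)
  have compl: "B.mcomplete"
    unfolding B.mcomplete_def
  proof (intro allI impI)
    fix s assume s: "B.MCauchy s"
    then have "A.MCauchy (\<lambda>n. g (s n))"
      unfolding A.MCauchy_def B.MCauchy_def using gY by (auto simp: d'_def image_subset_iff)
    then obtain x where "limitin A.mtopology (\<lambda>n. g (s n)) x sequentially"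
      using mm unfolding mm_space_def X_def[symmetric] A.mcomplete_def by blast
    then have "limitin B.mtopology (f \<circ> (\<lambda>n. g (s n))) (f x) sequentially"
      by (rule continuous_map_limit[OF homeomorphic_imp_continuous_map[OF hf]])
    moreover have "f \<circ> (\<lambda>n. g (s n)) = s"
      using s gY by (auto simp: B.MCauchy_def image_subset_iff fun_eq_iff)
    ultimately show "\<exists>y. limitin B.mtopology s y sequentially" by auto
  qed
  have supp: "0 < emeasure N U" if U: "openin B.mtopology U" "U \<noteq> {}" for U
  proof -
    have "openin A.mtopology {x \<in> topspace A.mtopology. f x \<in> U}"
      using homeomorphic_imp_continuous_map[OF hf] U by (auto simp: continuous_map_def)
    moreover have "{x \<in> topspace A.mtopology. f x \<in> U} = f -` U \<inter> space M"
      unfolding A.topspace_mtopology by (auto simp: X_def)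
    moreover have "f -` U \<inter> space M \<noteq> {}"
      using U(2) openin_subset[OF U(1)] unfolding B.topspace_mtopology by (auto simp: Y_def X_def)
    ultimately have "0 < emeasure M (f -` U \<inter> space M)"
      using mm unfolding mm_space_def X_def[symmetric] by metis
    then show ?thesis using U(1) unfolding N_def by (subst emeasure_distr) (auto intro: openin_borel_of)
  qed
  have mmN: "mm_space N d'"
    unfolding mm_space_def spN
    using B.Metric_space_axioms compl sep pN seN supp gY mm
    by (auto simp: d'_def mm_space_def X_def)
  have PN: "distr (PiM UNIV (\<lambda>_::nat. M)) (PiM UNIV (\<lambda>_::nat. N)) (\<lambda>x i. f (x i)) = PiM UNIV (\<lambda>_::nat. N)"
  proof (rule measure_eqI_PiM_infinite)
    have fm [measurable]: "(\<lambda>x i. f (x i)) \<in> PiM UNIV (\<lambda>_::nat. M) \<rightarrow>\<^sub>M PiM UNIV (\<lambda>_::nat. N)"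
      by (rule measurable_PiM_single') (auto simp: space_PiM PiE_iff spN Y_def X_def)
    interpret P: prob_space "PiM UNIV (\<lambda>_::nat. M)" by (intro prob_space_PiM M.prob_space_axioms)
    show "finite_measure (distr (PiM UNIV (\<lambda>_::nat. M)) (PiM UNIV (\<lambda>_::nat. N)) (\<lambda>x i. f (x i)))"
      using P.prob_space_distr[OF fm] by (rule prob_space.finite_measure)
    fix J :: "nat set" and F assume J: "finite J" "J \<subseteq> UNIV" and F: "\<And>i. i \<in> J \<Longrightarrow> F i \<in> sets N"
    let ?E = "prod_emb UNIV (\<lambda>_. N) J (Pi\<^sub>E J F)"
    have E: "?E \<in> sets (PiM UNIV (\<lambda>_::nat. N))" using J F by (intro sets_PiM_I) auto
    have "emeasure (distr (PiM UNIV (\<lambda>_::nat. M)) (PiM UNIV (\<lambda>_::nat. N)) (\<lambda>x i. f (x i))) ?E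
      = emeasure (PiM UNIV (\<lambda>_::nat. M)) ((\<lambda>x i. f (x i)) -` ?E \<inter> space (PiM UNIV (\<lambda>_::nat. M)))"
      by (rule emeasure_distr[OF fm E])
    also have "(\<lambda>x i. f (x i)) -` ?E \<inter> space (PiM UNIV (\<lambda>_::nat. M))
      = prod_emb UNIV (\<lambda>_. M) J (Pi\<^sub>E J (\<lambda>i. f -` F i \<inter> space M))"
      using measurable_space[OF fN] by (auto simp: prod_emb_def space_PiM PiE_iff)
    also have "emeasure (PiM UNIV (\<lambda>_::nat. M)) \<dots> = (\<Prod>i\<in>J. emeasure M (f -` F i \<inter> space M))"
      using J F by (intro emeasure_PiM_emb M.prob_space_axioms measurable_sets[OF fN]) auto
    also have "\<dots> = (\<Prod>i\<in>J. emeasure N (F i))"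
      using F seN f unfolding N_def by (intro prod.cong refl) (subst emeasure_distr, auto)
    also have "\<dots> = emeasure (PiM UNIV (\<lambda>_::nat. N)) ?E"
      using J F by (intro emeasure_PiM_emb[symmetric] pN) auto
    finally show "emeasure (distr (PiM UNIV (\<lambda>_::nat. M)) (PiM UNIV (\<lambda>_::nat. N)) (\<lambda>x i. f (x i))) ?E
      = emeasure (PiM UNIV (\<lambda>_::nat. N)) ?E" .
  qed auto
  have "mm_tau N d' = distr (PiM UNIV (\<lambda>_::nat. M)) (restrict_space borel M_inf)
      ((\<lambda>x i j. d' (x i) (x j)) \<circ> (\<lambda>x i. f (x i)))"
    unfolding mm_tau_def
    by (subst PN[symmetric], rule distr_distr[OF mm_space_matrix_measurable[OF mmN]])
      (auto intro!: measurable_PiM_single' simp: space_PiM PiE_iff spN Y_def X_def)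
  also have "\<dots> = mm_tau M d"
    unfolding mm_tau_def
    by (intro distr_cong refl) (auto simp: d'_def fun_eq_iff space_PiM PiE_iff gf X_def)
  finally show thesis using that mmN by blast
qed

lemma mm_space_lepoll_reals:
  assumes "mm_space M d"
  shows "\<exists>f :: 'a \<Rightarrow> real. inj_on f (space (M :: 'a measure))"
proof -
  interpret Metric_space "space M" d using assms by (simp add: mm_space_def)
  obtain C where C: "countable C" "C \<subseteq> space M" "mtopology closure_of C = space M"
    using assms by (auto simp: mm_space_def separable_def)
  define F where "F x = to_nat_on (C \<times> (\<rat> :: real set)) ` {(c, q). c \<in> C \<and> q \<in> \<rat> \<and> d c x < q}" for x
  have cC: "countable (C \<times> (\<rat> :: real set))" using C by (simp add: countable_rat)
  have "inj_on F (space M)"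
  proof (rule inj_onI, rule ccontr)
    fix x y assume x: "x \<in> space M" and y: "y \<in> space M" and eq: "F x = F y" and ne: "x \<noteq> y"
    have sub: "{(c, q). c \<in> C \<and> q \<in> \<rat> \<and> d c x < q} = {(c, q). c \<in> C \<and> q \<in> \<rat> \<and> d c y < q}"
      using eq unfolding F_def
      by (subst (asm) inj_on_image_eq_iff[OF inj_on_to_nat_on[OF cC]]) auto
    have pos: "d x y > 0" using x y ne by simp
    have "x \<in> mtopology closure_of C" using C(3) x by simp
    moreover have "d x y / 2 > 0" using pos by simp
    ultimately obtain c where c: "c \<in> C" "c \<in> mball x (d x y / 2)"
      unfolding metric_closure_of by blast
    then have "d c x < d x y / 2" by (simp add: commute)
    then obtain q where q: "q \<in> \<rat>" "d c x < q" "q < d x y / 2" using Rats_dense_in_real by blast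
    have "d c y < q" using sub c q by (auto simp: set_eq_iff)
    moreover have "d x y \<le> d x c + d c y" using triangle c C x y by blast
    ultimately show False using q by (simp add: commute)
  qed
  moreover obtain h :: "nat set \<Rightarrow> real" where "inj h"
    using nat_sets_eqpoll_reals by (auto simp: eqpoll_def bij_betw_def)
  ultimately have "inj_on (\<lambda>x. h (F x)) (space M)" by (auto simp: inj_on_def)
  then show ?thesis by blast
qed

lemma mm_tau_in_tau_chi:
  fixes M :: "'a measure"
  assumes "mm_space M d"
  shows "mm_tau M d \<in> tau_chi"
proof -
  obtain f :: "'a \<Rightarrow> real" where "inj_on f (space M)"
    using mm_space_lepoll_reals[OF assms] by blast
  from mm_space_transport[OF assms this] show ?thesis
    unfolding tau_chi_def by (metis (mono_tags, lifting) mem_Collect_eq)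
qed


section \<open>qmm-spaces\<close>

definition qmm_space :: "'a measure \<Rightarrow> ('a \<Rightarrow> 'a \<Rightarrow> real measure) \<Rightarrow> bool" where
  "qmm_space M d \<longleftrightarrow>
     standard_borel M \<and>
     prob_space M \<and>
     (\<lambda>(x, y). d x y) \<in> M \<Otimes>\<^sub>M M \<rightarrow>\<^sub>M borel_of (weak_topology {0..1}) \<and>
     (\<forall>x\<in>space M. d x x = return (restrict_space borel {0..1}) 0) \<and>
     (\<forall>x\<in>space M. \<forall>y\<in>space M. d x y = d y x) \<and>
     (AE (a, b, c) in M \<Otimes>\<^sub>M M \<Otimes>\<^sub>M M.
        AE (l_ab, l_bc, l_ac) in d a b \<Otimes>\<^sub>M d b c \<Otimes>\<^sub>M d a c.
          l_ab \<le> l_bc + l_ac \<and> l_bc \<le> l_ab + l_ac \<and> l_ac \<le> l_ab + l_bc)"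

text \<open>The law of the random matrix given the sampled points \<open>x\<close>: the entries above the diagonal
  are independent, and the matrix is completed symmetrically.\<close>

definition matrix_of_upper :: "(nat \<times> nat \<Rightarrow> real) \<Rightarrow> nat \<Rightarrow> nat \<Rightarrow> real" where
  "matrix_of_upper l = (\<lambda>i j. if i < j then l (i, j) else if j < i then l (j, i) else 0)"

definition qmm_kernel ::
    "('a \<Rightarrow> 'a \<Rightarrow> real measure) \<Rightarrow> (nat \<Rightarrow> 'a) \<Rightarrow> (nat \<Rightarrow> nat \<Rightarrow> real) measure" where
  "qmm_kernel d x =
     distr (PiM {(i, j). i < j} (\<lambda>(i, j). d (x i) (x j)))
       (restrict_space borel M_inf) matrix_of_upper"

definition qmm_tau ::
    "'a measure \<Rightarrow> ('a \<Rightarrow> 'a \<Rightarrow> real measure) \<Rightarrow> (nat \<Rightarrow> nat \<Rightarrow> real) measure" where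
  "qmm_tau M d = PiM UNIV (\<lambda>_::nat. M) \<bind> qmm_kernel d"

end

theory Submission
  imports Defs
begin

text \<open>
  Integrals of bounded continuous functions are weakly continuous, so \<open>\<kappa>\<close> inherits three properties
  from the measures \<open>\<tau>(X)\<close>: it is invariant under relabelling indices by an injection, the blocks of
  entries over disjoint index sets are independent, and the triangle inequality holds almost surely.
  Such an array is represented in the manner of Aldous and Hoover.  Take the even indices as sampled
  points and keep the odd ones as a shell: an infinite auxiliary sample that records, in its own
  entries and in the row of distances from a point to it, all that matters about the point.  If a
  bounded \<open>f\<close> is invariant under a relabelling that moves all remaining indices into the shell, then
  conditioning \<open>f\<close> on everything and conditioning it on the shell data give the same \<open>L\<^sup>2\<close>-norm, hence the
  same result.  It follows that, given the shell, the rows are independent and identically distributed,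
  and that, given shell and rows, the distances between points are independent with a law depending
  only on the two rows.  Since the shell is independent of the distances between points, conditioning
  on a typical value of the shell does not change their law; fixing such a value leaves a qmm-space.
  Its points are taken uniformly from the unit interval, the rows being produced by quantile
  functions: without atoms, setting the distance to zero on the diagonal is harmless.
\<close>

section \<open>Conditional expectations of invariant functions\<close>

text \<open>An injection that sends all remaining indices into the shell needs room there, so it
  cannot fix the whole shell. For a single distance this does no harm: one relabelling keeps it and
  moves everything else. A row involves infinitely many shell indices, and no single relabelling
  keeps it; it is reached as a limit of finite pieces, each kept by its own relabelling. Conditional
  quantile functions produce one real variable, whereas the shell and the rows are families of
  reals. They are coded by single reals, with a code that loses no information and whose truncations
  increase to it, so that the limit over finite pieces stays available. For each single event, the
  law obtained by fixing the shell is right only for almost every value of the shell. All laws are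
  therefore compared on boxes with rational bounds: there are countably many of them, and one value
  of the shell is good for all at once.\<close>

lemma (in prob_space) integrable_of_bound:
  fixes f :: "'a \<Rightarrow> real"
  assumes "f \<in> borel_measurable M" "\<And>x. x \<in> space M \<Longrightarrow> \<bar>f x\<bar> \<le> B"
  shows "integrable M f"
  by (rule integrable_const_bound[where B = B]) (use assms in auto)

lemma (in prob_space) sigma_finite_subalgebraI:
  assumes "subalgebra M F"
  shows "sigma_finite_subalgebra M F"
  using assms by (intro finite_measure_subalgebra_is_sigma_finite)
    (simp add: finite_measure_subalgebra_def finite_measure_subalgebra_axioms_def finite_measure_axioms)

text \<open>With \<open>u = E[f | F']\<close> the function \<open>u \<circ> T\<close> is \<open>F\<close>-measurable, and \<open>f - u \<circ> T\<close> has the same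
  \<open>L\<^sup>2\<close>-norm as \<open>f - u\<close>; since \<open>u\<close> is the orthogonal projection of \<open>f\<close>, it equals \<open>u \<circ> T\<close>.\<close>

lemma (in prob_space) real_cond_exp_invariant:
  fixes f :: "'a \<Rightarrow> real"
  assumes F': "subalgebra M F'" and F: "subalgebra F' F"
    and T: "T \<in> M \<rightarrow>\<^sub>M M" "distr M M T = M" "T \<in> F \<rightarrow>\<^sub>M F'"
    and f: "f \<in> borel_measurable M" "\<And>x. x \<in> space M \<Longrightarrow> \<bar>f x\<bar> \<le> B"
    and inv: "\<And>x. x \<in> space M \<Longrightarrow> f (T x) = f x"
  shows "AE x in M. real_cond_exp M F' f x = real_cond_exp M F f x"
proof -
  have FM: "subalgebra M F" using F F' by (auto simp: subalgebra_def)
  interpret F': sigma_finite_subalgebra M F' by (rule sigma_finite_subalgebraI[OF F'])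
  interpret F: sigma_finite_subalgebra M F by (rule sigma_finite_subalgebraI[OF FM])
  note [measurable] = f(1) T(1)
  have intf: "integrable M f" by (rule integrable_of_bound[OF f])
  define r where "r = real_cond_exp M F' f"
  have rF': "r \<in> borel_measurable F'" by (simp add: r_def)
  \<comment> \<open>The conditional expectation is bounded by \<open>B\<close> only almost
    everywhere. Truncation gives a version bounded everywhere, so that \<open>u \<circ> T\<close> is
    bounded as well and all products below are integrable.\<close>
  define u where "u x = max (- B) (min B (r x))" for x
  define v where "v x = u (T x)" for x
  have uF': "u \<in> borel_measurable F'"
    unfolding u_def by (intro borel_measurable_max borel_measurable_min borel_measurable_const rF')
  have vF: "v \<in> borel_measurable F"
    unfolding v_def by (rule measurable_compose[OF T(3) uF'])
  have uM [measurable]: "u \<in> borel_measurable M" by (rule measurable_from_subalg[OF F' uF'])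
  have vM [measurable]: "v \<in> borel_measurable M" by (rule measurable_from_subalg[OF FM vF])
  have vF': "v \<in> borel_measurable F'" by (rule measurable_from_subalg[OF F vF])
  obtain z where z: "z \<in> space M" using not_empty by auto
  have "0 \<le> B" using f(2)[OF z] by linarith
  then have ub: "\<bar>u x\<bar> \<le> B" for x by (auto simp: u_def)
  then have vb: "\<bar>v x\<bar> \<le> B" for x by (simp add: v_def)
  have "AE x in M. r x \<ge> - B" unfolding r_def
    by (intro F'.real_cond_exp_ge_c intf AE_I2) (metis abs_le_D2 f(2) minus_le_iff)
  moreover have "AE x in M. r x \<le> B" unfolding r_def
    by (intro F'.real_cond_exp_le_c intf AE_I2) (metis abs_le_D1 f(2))
  ultimately have ur: "AE x in M. u x = r x" by eventually_elim (auto simp: u_def)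
  have bb: "\<bar>a * b\<bar> \<le> C * D" if "\<bar>a\<bar> \<le> C" "\<bar>b\<bar> \<le> D" for a b C D :: real
    unfolding abs_mult using that by (intro mult_mono) auto
  have uvb: "\<bar>u x - v x\<bar> \<le> B + B" for x using ub[of x] vb[of x] by linarith
  have fub: "\<bar>f x - u x\<bar> \<le> B + B" if "x \<in> space M" for x using ub[of x] f(2)[OF that] by linarith
  have i1: "integrable M (\<lambda>x. (u x - v x) * f x)"
    by (rule integrable_of_bound[where B = "(B + B) * B"], measurable)
      (intro bb f uvb)
  have i2: "integrable M (\<lambda>x. (u x - v x) * u x)"
    by (rule integrable_of_bound[where B = "(B + B) * B"], measurable)
      (intro bb ub uvb)
  have i3: "integrable M (\<lambda>x. (u x - v x)\<^sup>2)"
    unfolding power2_eq_square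
    by (rule integrable_of_bound[where B = "(B + B) * (B + B)"], measurable)
      (intro bb uvb)
  have i4: "integrable M (\<lambda>x. (f x - u x)\<^sup>2)"
    unfolding power2_eq_square
    by (rule integrable_of_bound[where B = "(B + B) * (B + B)"], measurable)
      (intro bb fub)
  have orth: "(\<integral>x. (u x - v x) * f x \<partial>M) = (\<integral>x. (u x - v x) * u x \<partial>M)"
  proof -
    have "(\<integral>x. (u x - v x) * f x \<partial>M) = (\<integral>x. (u x - v x) * r x \<partial>M)"
      unfolding r_def by (intro F'.real_cond_exp_intg(2)[symmetric] i1 borel_measurable_diff uF' vF' f(1))
    also have "\<dots> = (\<integral>x. (u x - v x) * u x \<partial>M)"
    proof (rule integral_cong_AE)
      show "AE x in M. (u x - v x) * r x = (u x - v x) * u x" using ur by eventually_elim simp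
    qed (simp_all add: r_def)
    finally show ?thesis .
  qed
  have "(\<integral>x. (f x - u x)\<^sup>2 \<partial>M) = (\<integral>x. (f x - u x)\<^sup>2 \<partial>distr M M T)" by (simp add: T(2))
  also have "\<dots> = (\<integral>x. (f (T x) - u (T x))\<^sup>2 \<partial>M)" by (rule integral_distr) auto
  also have "\<dots> = (\<integral>x. (f x - v x)\<^sup>2 \<partial>M)"
    by (rule Bochner_Integration.integral_cong) (auto simp: inv v_def)
  \<comment> \<open>Pythagoras for \<open>f - v = (f - u) + (u - v)\<close>: since
    \<open>u - v\<close> is \<open>F'\<close>-measurable, the mixed term vanishes by
    \<open>orth\<close>, and \<open>u - v\<close> is left with norm zero.\<close>
  also have "\<dots> = (\<integral>x. (f x - u x)\<^sup>2 + 2 * ((u x - v x) * f x - (u x - v x) * u x) + (u x - v x)\<^sup>2 \<partial>M)"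
    by (rule Bochner_Integration.integral_cong) (auto simp: power2_eq_square algebra_simps)
  also have "\<dots> = (\<integral>x. (f x - u x)\<^sup>2 \<partial>M) + (\<integral>x. (u x - v x)\<^sup>2 \<partial>M)"
    using orth i1 i2 i3 i4 by simp
  finally have "(\<integral>x. (u x - v x)\<^sup>2 \<partial>M) = 0" by simp
  then have "AE x in M. (u x - v x)\<^sup>2 = 0"
    by (subst integral_nonneg_eq_0_iff_AE[symmetric, OF i3]) auto
  then have uv: "AE x in M. u x = v x" by eventually_elim simp
  have rv: "AE x in M. r x = v x" using ur uv by eventually_elim simp
  have intv: "integrable M v" by (rule integrable_of_bound[OF vM vb])
  \<comment> \<open>Being \<open>F\<close>-measurable and almost surely equal to
    \<open>E[f | F']\<close>, the function \<open>v\<close> has the same integrals as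
    \<open>f\<close> over the sets of the smaller \<open>F\<close>.\<close>
  have "AE x in M. real_cond_exp M F f x = v x"
  proof (rule F.real_cond_exp_charact[OF _ intf intv vF])
    fix A assume A: "A \<in> sets F"
    then have A': "A \<in> sets F'" using F by (auto simp: subalgebra_def)
    then have AM [measurable]: "A \<in> sets M" using F' by (auto simp: subalgebra_def)
    have "(\<integral>x\<in>A. f x \<partial>M) = (\<integral>x\<in>A. r x \<partial>M)"
      unfolding r_def by (rule F'.real_cond_exp_intA[OF intf A'])
    also have "\<dots> = (\<integral>x\<in>A. v x \<partial>M)"
      unfolding set_lebesgue_integral_def
    proof (rule integral_cong_AE)
      show "AE x in M. indicat_real A x *\<^sub>R r x = indicat_real A x *\<^sub>R v x"
        using rv by eventually_elim simp
    qed (simp_all add: r_def)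
    finally show "(\<integral>x\<in>A. f x \<partial>M) = (\<integral>x\<in>A. v x \<partial>M)" .
  qed
  with rv show ?thesis unfolding r_def by eventually_elim simp
qed

text \<open>The weight \<open>G\<close> is \<open>F'\<close>-measurable, so \<open>f\<close> may
  first be replaced by \<open>E[f | F']\<close>; by invariance this is already
  \<open>E[f | F]\<close>.\<close>

lemma (in prob_space) integral_invariant_cond_exp:
  fixes f G :: "'a \<Rightarrow> real"
  assumes F': "subalgebra M F'" and F: "subalgebra F' F"
    and T: "T \<in> M \<rightarrow>\<^sub>M M" "distr M M T = M" "T \<in> F \<rightarrow>\<^sub>M F'"
    and f: "f \<in> borel_measurable M" "\<And>x. x \<in> space M \<Longrightarrow> \<bar>f x\<bar> \<le> B"
    and inv: "\<And>x. x \<in> space M \<Longrightarrow> f (T x) = f x"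
    and G: "G \<in> borel_measurable F'" "\<And>x. x \<in> space M \<Longrightarrow> \<bar>G x\<bar> \<le> C"
  shows "(\<integral>x. f x * G x \<partial>M) = (\<integral>x. real_cond_exp M F f x * G x \<partial>M)"
proof -
  have FM: "subalgebra M F" using F F' by (auto simp: subalgebra_def)
  interpret F': sigma_finite_subalgebra M F' by (rule sigma_finite_subalgebraI[OF F'])
  interpret F: sigma_finite_subalgebra M F by (rule sigma_finite_subalgebraI[OF FM])
  note [measurable] = f(1) measurable_from_subalg[OF F' G(1)]
  obtain z where z: "z \<in> space M" using not_empty by auto
  have BC: "0 \<le> B" "0 \<le> C" using f(2)[OF z] G(2)[OF z] by linarith+
  have "integrable M (\<lambda>x. G x * f x)"
    by (rule integrable_of_bound[where B = "C * B"], measurable)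
      (unfold abs_mult, intro mult_mono f G, auto simp: BC)
  then have "(\<integral>x. G x * f x \<partial>M) = (\<integral>x. G x * real_cond_exp M F' f x \<partial>M)"
    by (intro F'.real_cond_exp_intg(2)[symmetric] G(1) f(1))
  also have "\<dots> = (\<integral>x. G x * real_cond_exp M F f x \<partial>M)"
  proof (rule integral_cong_AE)
    show "AE x in M. G x * real_cond_exp M F' f x = G x * real_cond_exp M F f x"
    proof -
      have "AE x in M. real_cond_exp M F' f x = real_cond_exp M F f x"
        by (rule real_cond_exp_invariant[OF F' F T f inv])
      then show ?thesis by eventually_elim simp
    qed
  qed simp_all
  finally show ?thesis by (simp add: mult.commute)
qed

text \<open>Serves a function \<open>f\<^sub>0\<close> that is not invariant itself but a pointwise
  limit of invariant functions, each with its own \<open>T k\<close>. Assumption \<open>fw\<close>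
  makes \<open>w\<close> a version of \<open>E[f\<^sub>0 | F]\<close>. The conditional expectation
  is moved from \<open>f k\<close> to the weight, \<open>g = E[G | F]\<close>, because then the
  limit in \<open>k\<close> is plain dominated convergence.\<close>

lemma (in prob_space) integral_invariant_eq:
  fixes f :: "nat \<Rightarrow> 'a \<Rightarrow> real" and f\<^sub>0 G w :: "'a \<Rightarrow> real"
  assumes F': "subalgebra M F'" and F: "subalgebra F' F"
    and T: "\<And>k. T k \<in> M \<rightarrow>\<^sub>M M" "\<And>k. distr M M (T k) = M" "\<And>k. T k \<in> F \<rightarrow>\<^sub>M F'"
    and f: "\<And>k. f k \<in> borel_measurable M" "\<And>k x. x \<in> space M \<Longrightarrow> \<bar>f k x\<bar> \<le> B"
    and inv: "\<And>k x. x \<in> space M \<Longrightarrow> f k (T k x) = f k x"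
    and lim: "\<And>x. x \<in> space M \<Longrightarrow> (\<lambda>k. f k x) \<longlonglongrightarrow> f\<^sub>0 x"
    and w: "w \<in> borel_measurable F" "\<And>x. x \<in> space M \<Longrightarrow> \<bar>w x\<bar> \<le> D"
    and fw: "\<And>A. A \<in> sets F \<Longrightarrow> (\<integral>x. f\<^sub>0 x * indicator A x \<partial>M) = (\<integral>x. w x * indicator A x \<partial>M)"
    and G: "G \<in> borel_measurable F'" "\<And>x. x \<in> space M \<Longrightarrow> \<bar>G x\<bar> \<le> C"
  shows "(\<integral>x. f\<^sub>0 x * G x \<partial>M) = (\<integral>x. w x * G x \<partial>M)"
proof -
  have FM: "subalgebra M F" using F F' by (auto simp: subalgebra_def)
  interpret F: sigma_finite_subalgebra M F by (rule sigma_finite_subalgebraI[OF FM])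
  have [measurable]: "f\<^sub>0 \<in> borel_measurable M" by (rule borel_measurable_LIMSEQ_real[OF lim f(1)])
  note [measurable] = f(1) measurable_from_subalg[OF F' G(1)] measurable_from_subalg[OF FM w(1)]
  obtain z where z: "z \<in> space M" using not_empty by auto
  have B: "0 \<le> B" using f(2)[OF z, of 0] by linarith
  have f0b: "\<bar>f\<^sub>0 x\<bar> \<le> B" if "x \<in> space M" for x
    by (rule tendsto_upperbound[OF tendsto_rabs[OF lim[OF that]]])
      (simp_all add: f(2)[OF that])
  have intG: "integrable M G" by (rule integrable_of_bound[OF _ G(2)]) measurable
  have intf0: "integrable M f\<^sub>0" by (rule integrable_of_bound[OF _ f0b]) measurable
  have intw: "integrable M w" by (rule integrable_of_bound[OF _ w(2)]) measurable
  define g where "g = real_cond_exp M F G"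
  have [measurable]: "g \<in> borel_measurable F" "g \<in> borel_measurable M"
    by (auto simp: g_def)
  have intg: "integrable M g" unfolding g_def by (rule F.real_cond_exp_int[OF intG])
  have iprod: "integrable M (\<lambda>x. h x * k x)"
    if "h \<in> borel_measurable M" "\<And>x. x \<in> space M \<Longrightarrow> \<bar>h x\<bar> \<le> E" "integrable M k" for h k :: "'a \<Rightarrow> real" and E
  proof (rule Bochner_Integration.integrable_bound[OF integrable_mult_right[OF that(3), of E]])
    have "\<bar>h x * k x\<bar> \<le> \<bar>E * k x\<bar>" if "x \<in> space M" for x
      unfolding abs_mult
      by (rule mult_right_mono[OF order_trans[OF \<open>\<And>x. x \<in> space M \<Longrightarrow> \<bar>h x\<bar> \<le> E\<close>[OF that] abs_ge_self] abs_ge_zero])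
    then show "AE x in M. norm (h x * k x) \<le> norm (E * k x)" by (intro AE_I2) (simp only: real_norm_def)
  qed (intro borel_measurable_times that(1) borel_measurable_integrable[OF that(3)])
  \<comment> \<open>The projection \<open>r\<close> of \<open>f k\<close> serves only in between:
    against the \<open>F\<close>-measurable \<open>r\<close> the weight \<open>G\<close> can be
    averaged to \<open>g\<close>, and against the \<open>F\<close>-measurable \<open>g\<close> the
    function \<open>r\<close> can be turned back into \<open>f k\<close>.\<close>
  have eq: "(\<integral>x. f k x * G x \<partial>M) = (\<integral>x. f k x * g x \<partial>M)" for k
  proof -
    have intf: "integrable M (f k)" by (rule integrable_of_bound[OF f])
    define r where "r = real_cond_exp M F (f k)"
    have [measurable]: "r \<in> borel_measurable F" "r \<in> borel_measurable M" by (auto simp: r_def)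
    have "integrable M (\<lambda>x. G x * r x)"
      unfolding r_def by (rule iprod[OF _ G(2) F.real_cond_exp_int(1)[OF intf]]) simp_all
    then have i: "integrable M (\<lambda>x. r x * G x)" by (simp add: mult.commute)
    have "integrable M (\<lambda>x. f k x * g x)" by (rule iprod[OF f intg])
    then have j: "integrable M (\<lambda>x. g x * f k x)" by (simp add: mult.commute)
    have "(\<integral>x. f k x * G x \<partial>M) = (\<integral>x. r x * G x \<partial>M)"
      unfolding r_def
      by (rule integral_invariant_cond_exp[OF F' F T(1)[of k] T(2)[of k] T(3)[of k] f(1)[of k]
            f(2)[of _ k] inv[of _ k] G])
    also have "\<dots> = (\<integral>x. r x * g x \<partial>M)"
      unfolding g_def by (intro F.real_cond_exp_intg(2)[symmetric] i) (simp_all add: r_def)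
    also have "\<dots> = (\<integral>x. g x * r x \<partial>M)" by (simp add: mult.commute)
    also have "\<dots> = (\<integral>x. g x * f k x \<partial>M)"
      unfolding r_def by (intro F.real_cond_exp_intg(2) j) simp_all
    finally show ?thesis by (simp add: mult.commute)
  qed
  have l1: "(\<lambda>k. \<integral>x. f k x * G x \<partial>M) \<longlonglongrightarrow> (\<integral>x. f\<^sub>0 x * G x \<partial>M)"
    by (rule integral_dominated_convergence[where w = "\<lambda>x. B * \<bar>G x\<bar>"])
      (simp_all add: intG abs_mult tendsto_mult_right lim f(2) mult_right_mono)
  have l2: "(\<lambda>k. \<integral>x. f k x * g x \<partial>M) \<longlonglongrightarrow> (\<integral>x. f\<^sub>0 x * g x \<partial>M)"
    by (rule integral_dominated_convergence[where w = "\<lambda>x. B * \<bar>g x\<bar>"])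
      (simp_all add: intg abs_mult tendsto_mult_right lim f(2) mult_right_mono)
  have "(\<integral>x. f\<^sub>0 x * G x \<partial>M) = (\<integral>x. f\<^sub>0 x * g x \<partial>M)"
    using LIMSEQ_unique[OF l1 l2[folded eq]] .
  also have "\<dots> = (\<integral>x. g x * f\<^sub>0 x \<partial>M)" by (simp add: mult.commute)
  also have "\<dots> = (\<integral>x. g x * real_cond_exp M F f\<^sub>0 x \<partial>M)"
    by (intro F.real_cond_exp_intg(2)[symmetric])
      (simp_all add: mult.commute[of "g _"] iprod[OF _ f0b intg])
  also have "\<dots> = (\<integral>x. g x * w x \<partial>M)"
  proof (rule integral_cong_AE)
    have "AE x in M. real_cond_exp M F f\<^sub>0 x = w x"
      by (rule F.real_cond_exp_charact[OF _ intf0 intw w(1)])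
        (simp add: set_lebesgue_integral_def mult.commute[of "indicator _ _"] fw)
    then show "AE x in M. g x * real_cond_exp M F f\<^sub>0 x = g x * w x" by eventually_elim simp
  qed measurable
  also have "\<dots> = (\<integral>x. w x * g x \<partial>M)" by (simp add: mult.commute)
  also have "\<dots> = (\<integral>x. w x * G x \<partial>M)"
    unfolding g_def by (intro F.real_cond_exp_intg(2) iprod[OF _ w(2) intG] w(1)) simp_all
  finally show ?thesis .
qed

section \<open>Conditional laws driven by uniform noise\<close>

definition unif :: "real measure" where
  "unif = uniform_measure lborel {0..1}"

lemma sets_unif [simp, measurable_cong]: "sets unif = sets borel"
  by (simp add: unif_def)

lemma space_unif [simp]: "space unif = UNIV"
  by (simp add: unif_def)

lemma prob_space_unif: "prob_space unif"
  unfolding unif_def by (rule prob_space_uniform_measure) auto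

text \<open>\<open>ennreal u\<close> is 0 for negative \<open>u\<close>, so the event also contains
  the negative half-line, which the uniform law does not charge.\<close>

lemma unif_atMost: "g \<le> 1 \<Longrightarrow> emeasure unif {u. ennreal u \<le> g} = g"
proof -
  assume g: "g \<le> 1"
  then obtain r where r: "g = ennreal r" "0 \<le> r" "r \<le> 1"
    by (cases g) (auto simp: top_unique)
  then have "{0..1} \<inter> {u. ennreal u \<le> g} = {0..r}" by auto
  then show ?thesis using r unfolding unif_def by (subst emeasure_uniform_measure) (auto simp: divide_ennreal_def)
qed

lemma borel_measurable_unif_kernel:
  assumes \<phi>: "(\<lambda>(s, u). \<phi> s u) \<in> borel_measurable (S \<Otimes>\<^sub>M borel)" and B: "B \<in> sets borel"
  shows "(\<lambda>s. measure unif {u. \<phi> s u \<in> B}) \<in> borel_measurable S"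
proof -
  interpret U: prob_space unif by (rule prob_space_unif)
  note [measurable] = \<phi> B
  have "{z \<in> space (S \<Otimes>\<^sub>M borel). (\<lambda>(s, u). \<phi> s u) z \<in> B} \<in> sets (S \<Otimes>\<^sub>M unif)"
    (is "?Q \<in> _") by measurable
  then have "(\<lambda>s. enn2real (emeasure unif (Pair s -` ?Q))) \<in> borel_measurable S"
    by (intro borel_measurable_enn2real U.measurable_emeasure_Pair)
  moreover have "enn2real (emeasure unif (Pair s -` ?Q)) = measure unif {u. \<phi> s u \<in> B}" if "s \<in> space S" for s
  proof -
    have "Pair s -` ?Q = {u. \<phi> s u \<in> B}" using that by (auto simp: space_pair_measure)
    then show ?thesis by (simp add: measure_def)
  qed
  ultimately show ?thesis by (subst (asm) measurable_cong) auto
qed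

text \<open>The densities \<open>max f g\<close> and \<open>g\<close> define the same measure: cut a
  set along \<open>g < f\<close> and use the assumption on that piece. Uniqueness of densities,
  which needs the finite integral, then gives \<open>g = max f g\<close> almost everywhere.\<close>

lemma (in finite_measure) AE_le_of_nn_set_integral_le:
  assumes [measurable]: "f \<in> borel_measurable M" "g \<in> borel_measurable M"
    and le: "\<And>A. A \<in> sets M \<Longrightarrow> (\<integral>\<^sup>+x\<in>A. f x \<partial>M) \<le> (\<integral>\<^sup>+x\<in>A. g x \<partial>M)"
    and fin: "(\<integral>\<^sup>+x. g x \<partial>M) \<noteq> \<infinity>"
  shows "AE x in M. f x \<le> g x"
proof -
  have "density M (\<lambda>x. max (f x) (g x)) = density M g"
  proof (rule measure_eqI)
    fix A assume "A \<in> sets (density M (\<lambda>x. max (f x) (g x)))"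
    then have [measurable]: "A \<in> sets M" by simp
    let ?B = "{x \<in> space M. g x < f x}"
    have "(\<integral>\<^sup>+x\<in>A. max (f x) (g x) \<partial>M) =
        (\<integral>\<^sup>+x. f x * indicator (A \<inter> ?B) x + g x * indicator (A - ?B) x \<partial>M)"
      by (intro nn_integral_cong) (auto simp: indicator_def max_def)
    also have "\<dots> = (\<integral>\<^sup>+x\<in>A \<inter> ?B. f x \<partial>M) + (\<integral>\<^sup>+x\<in>A - ?B. g x \<partial>M)"
      by (rule nn_integral_add) measurable
    also have "\<dots> \<le> (\<integral>\<^sup>+x\<in>A \<inter> ?B. g x \<partial>M) + (\<integral>\<^sup>+x\<in>A - ?B. g x \<partial>M)"
      by (intro add_right_mono le) measurable
    also have "\<dots> = (\<integral>\<^sup>+x. g x * indicator (A \<inter> ?B) x + g x * indicator (A - ?B) x \<partial>M)"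
      by (rule nn_integral_add[symmetric]) measurable
    also have "\<dots> = (\<integral>\<^sup>+x\<in>A. g x \<partial>M)"
      by (intro nn_integral_cong) (auto simp: indicator_def)
    finally have "(\<integral>\<^sup>+x\<in>A. max (f x) (g x) \<partial>M) \<le> (\<integral>\<^sup>+x\<in>A. g x \<partial>M)" .
    moreover have "(\<integral>\<^sup>+x\<in>A. g x \<partial>M) \<le> (\<integral>\<^sup>+x\<in>A. max (f x) (g x) \<partial>M)"
      by (intro nn_integral_mono mult_right_mono) auto
    ultimately show "emeasure (density M (\<lambda>x. max (f x) (g x))) A = emeasure (density M g) A"
      by (simp add: emeasure_density)
  qed simp
  then have "AE x in M. g x = max (f x) (g x)"
    using finite_density_unique[OF assms(2) _ _ _ fin, of "\<lambda>x. max (f x) (g x)"] by simp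
  then show ?thesis by eventually_elim (metis max.cobounded1)
qed

text \<open>\<open>G q\<close> is the Radon-Nikodym density of the law of \<open>X\<close> on the
  event \<open>Y < q\<close> with respect to the law of \<open>X\<close>, that is, the conditional
  probability of \<open>Y < q\<close> given \<open>X\<close>. With the strict inequality,
  \<open>Y < t\<close> is the increasing union of the events \<open>Y < q\<close> with
  \<open>q < t\<close>.\<close>

lemma (in prob_space) cond_cdf:
  fixes X :: "'a \<Rightarrow> 's" and Y :: "'a \<Rightarrow> real"
  assumes [measurable]: "X \<in> M \<rightarrow>\<^sub>M S" "Y \<in> borel_measurable M"
  obtains G :: "real \<Rightarrow> 's \<Rightarrow> ennreal" where "\<And>q. G q \<in> borel_measurable S"
    and "\<And>q A. A \<in> sets S \<Longrightarrow>
      (\<integral>\<^sup>+s\<in>A. G q s \<partial>distr M S X) = emeasure M {x \<in> space M. X x \<in> A \<and> Y x < q}"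
    and "\<And>q q'. q \<le> q' \<Longrightarrow> AE s in distr M S X. G q s \<le> G q' s"
    and "\<And>q. AE s in distr M S X. G q s \<le> 1"
proof -
  define N where "N q = distr (density M (indicator {x. Y x < q})) S X" for q
  interpret D: prob_space "distr M S X" by (rule prob_space_distr) simp
  define G where "G q = RN_deriv (distr M S X) (N q)" for q
  have Gm [measurable]: "G q \<in> borel_measurable S" for q
    using borel_measurable_RN_deriv[of "distr M S X" "N q"] by (simp add: G_def)
  have NE: "emeasure (N q) A = emeasure M {x \<in> space M. X x \<in> A \<and> Y x < q}"
    if [measurable]: "A \<in> sets S" for q A
  proof -
    have *: "Measurable.pred M (\<lambda>x. Y x < q)" by measurable
    have "emeasure (N q) A = (\<integral>\<^sup>+x. indicator {x. Y x < q} x * indicator (X -` A \<inter> space M) x \<partial>M)"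
      unfolding N_def
      by (subst emeasure_distr, simp, simp, subst emeasure_density) (use * in auto)
    also have "\<dots> = (\<integral>\<^sup>+x. indicator {x \<in> space M. X x \<in> A \<and> Y x < q} x \<partial>M)"
      by (intro nn_integral_cong) (auto simp: indicator_def)
    also have "\<dots> = emeasure M {x \<in> space M. X x \<in> A \<and> Y x < q}" by (rule nn_integral_indicator) measurable
    finally show ?thesis .
  qed
  have G: "(\<integral>\<^sup>+s\<in>A. G q s \<partial>distr M S X) = emeasure M {x \<in> space M. X x \<in> A \<and> Y x < q}"
    if A [measurable]: "A \<in> sets S" for q A
  proof -
    have ac: "absolutely_continuous (distr M S X) (N q)"
    proof (unfold absolutely_continuous_def, rule subsetI)
      fix B assume "B \<in> null_sets (distr M S X)"
      then have [measurable]: "B \<in> sets S" and 0: "emeasure M (X -` B \<inter> space M) = 0"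
        by (auto simp: null_sets_def emeasure_distr)
      have "emeasure (N q) B \<le> emeasure M (X -` B \<inter> space M)"
        unfolding NE[OF \<open>B \<in> sets S\<close>] by (intro emeasure_mono) auto
      then show "B \<in> null_sets (N q)" using 0 by (auto simp: null_sets_def N_def)
    qed
    have "(\<integral>\<^sup>+s\<in>A. G q s \<partial>distr M S X) = emeasure (density (distr M S X) (G q)) A"
      by (subst emeasure_density) auto
    also have "density (distr M S X) (G q) = N q"
      unfolding G_def by (rule D.density_RN_deriv[OF ac]) (simp add: N_def)
    finally show ?thesis using NE[OF A] by simp
  qed
  show thesis
  proof (rule that[OF Gm])
    show "(\<integral>\<^sup>+s\<in>A. G q s \<partial>distr M S X) = emeasure M {x \<in> space M. X x \<in> A \<and> Y x < q}"
      if "A \<in> sets S" for q A using G[OF that] .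
    have fin: "(\<integral>\<^sup>+s. G q s \<partial>distr M S X) \<noteq> \<infinity>" for q
    proof -
      have "(\<integral>\<^sup>+s. G q s \<partial>distr M S X) = (\<integral>\<^sup>+s\<in>space S. G q s \<partial>distr M S X)"
        by (intro nn_integral_cong) auto
      then show ?thesis unfolding G[OF sets.top] by simp
    qed
    show "AE s in distr M S X. G q s \<le> G q' s" if "q \<le> q'" for q q'
    proof (rule D.AE_le_of_nn_set_integral_le)
      show "(\<integral>\<^sup>+s\<in>A. G q s \<partial>distr M S X) \<le> (\<integral>\<^sup>+s\<in>A. G q' s \<partial>distr M S X)"
        if A: "A \<in> sets (distr M S X)" for A
      proof -
        have [measurable]: "A \<in> sets S" using A by simp
        show ?thesis
          unfolding G[OF \<open>A \<in> sets S\<close>] by (intro emeasure_mono) (use \<open>q \<le> q'\<close> in auto)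
      qed
    qed (use fin in auto)
    show "AE s in distr M S X. G q s \<le> 1" for q
    proof (rule D.AE_le_of_nn_set_integral_le)
      show "(\<integral>\<^sup>+s\<in>A. G q s \<partial>distr M S X) \<le> (\<integral>\<^sup>+s\<in>A. 1 \<partial>distr M S X)"
        if A: "A \<in> sets (distr M S X)" for A
      proof -
        have [measurable]: "A \<in> sets S" using A by simp
        have "(\<integral>\<^sup>+s\<in>A. 1 \<partial>distr M S X) = emeasure M (X -` A \<inter> space M)"
          by (simp add: emeasure_distr)
        then show ?thesis unfolding G[OF \<open>A \<in> sets S\<close>] by (auto intro!: emeasure_mono)
      qed
    qed (auto simp: D.emeasure_space_1)
  qed
qed

text \<open>The noise is fed into the conditional quantile function.\<close>

lemma (in prob_space) noise_outsourcing:
  fixes X :: "'a \<Rightarrow> 's" and Y :: "'a \<Rightarrow> real"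
  assumes X [measurable]: "X \<in> M \<rightarrow>\<^sub>M S" and Y [measurable]: "Y \<in> borel_measurable M"
    and Y01: "\<And>x. x \<in> space M \<Longrightarrow> 0 \<le> Y x \<and> Y x \<le> 1"
  obtains \<phi> :: "'s \<Rightarrow> real \<Rightarrow> real" where "(\<lambda>(s, u). \<phi> s u) \<in> borel_measurable (S \<Otimes>\<^sub>M borel)"
    and "\<And>s u. 0 \<le> \<phi> s u \<and> \<phi> s u \<le> 1"
    and "\<And>A B. A \<in> sets S \<Longrightarrow> B \<in> sets borel \<Longrightarrow> (\<integral>x. indicator B (Y x) * indicator A (X x) \<partial>M) =
      (\<integral>x. measure unif {u. \<phi> (X x) u \<in> B} * indicator A (X x) \<partial>M)"
proof -
  obtain G :: "real \<Rightarrow> 's \<Rightarrow> ennreal" where [measurable]: "\<And>q. G q \<in> borel_measurable S"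
    and G: "\<And>q A. A \<in> sets S \<Longrightarrow>
      (\<integral>\<^sup>+s\<in>A. G q s \<partial>distr M S X) = emeasure M {x \<in> space M. X x \<in> A \<and> Y x < q}"
    and G_mono: "\<And>q q'. q \<le> q' \<Longrightarrow> AE s in distr M S X. G q s \<le> G q' s"
    and G_le: "\<And>q. AE s in distr M S X. G q s \<le> 1"
    using cond_cdf[OF X Y] by blast
  interpret D: prob_space "distr M S X" by (rule prob_space_distr) simp
  interpret U: prob_space unif by (rule prob_space_unif)
  interpret DU: pair_prob_space "distr M S X" unif ..
  \<comment> \<open>Conditional quantile function. Only rational thresholds enter, because
    \<open>G\<close> is monotone in \<open>q\<close> merely up to null sets that depend on the
    thresholds; the additional element 1 makes the set nonempty and keeps the values at most
    1.\<close>
  define \<phi> where "\<phi> s u = Inf (insert 1 {q \<in> \<rat>. 0 \<le> q \<and> ennreal u \<le> G q s})" for s u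
  have bdd: "bdd_below (insert 1 {q \<in> \<rat>. 0 \<le> q \<and> ennreal u \<le> G q s})" for s u
    by (rule bdd_belowI[of _ 0]) auto
  have \<phi>01: "0 \<le> \<phi> s u \<and> \<phi> s u \<le> 1" for s u
    unfolding \<phi>_def by (rule conjI, rule cInf_greatest) (auto intro: cInf_lower[OF _ bdd])
  have \<phi>_less: "\<phi> s u < t \<longleftrightarrow> 1 < t \<or> (\<exists>q\<in>\<rat>. 0 \<le> q \<and> q < t \<and> ennreal u \<le> G q s)" for s u t
    unfolding \<phi>_def by (subst cInf_less_iff[OF _ bdd]) auto
  have \<phi>m: "(\<lambda>(s, u). \<phi> s u) \<in> borel_measurable (S \<Otimes>\<^sub>M borel)"
    unfolding borel_measurable_iff_less
  proof
    fix t
    have "{w \<in> space (S \<Otimes>\<^sub>M borel). (case w of (s, u) \<Rightarrow> \<phi> s u) < t} =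
      (if 1 < t then space (S \<Otimes>\<^sub>M borel) else
       (\<Union>q\<in>\<rat> \<inter> {0..<t}. {w \<in> space (S \<Otimes>\<^sub>M borel). ennreal (snd w) \<le> G q (fst w)}))"
      by (auto simp: \<phi>_less Bex_def)
    also have "\<dots> \<in> sets (S \<Otimes>\<^sub>M borel)"
      by (auto intro!: sets.countable_UN'' countable_subset[OF _ countable_rat])
    finally show "{w \<in> space (S \<Otimes>\<^sub>M borel). (case w of (s, u) \<Rightarrow> \<phi> s u) < t} \<in> sets (S \<Otimes>\<^sub>M borel)" .
  qed
  note [measurable] = \<phi>m
  let ?L = "distr (distr M S X \<Otimes>\<^sub>M unif) (S \<Otimes>\<^sub>M borel) (\<lambda>(s, u). (s, \<phi> s u))"
  let ?R = "distr M (S \<Otimes>\<^sub>M borel) (\<lambda>x. (X x, Y x))"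
  have fm [measurable]: "(\<lambda>(s, u). (s, \<phi> s u)) \<in> distr M S X \<Otimes>\<^sub>M unif \<rightarrow>\<^sub>M S \<Otimes>\<^sub>M borel"
    by measurable
  have gm [measurable]: "(\<lambda>x. (X x, Y x)) \<in> M \<rightarrow>\<^sub>M S \<Otimes>\<^sub>M borel"
    by measurable
  have Lrect: "emeasure ?L (A \<times> B) = (\<integral>\<^sup>+s\<in>A. emeasure unif {u. \<phi> s u \<in> B} \<partial>distr M S X)"
    if [measurable]: "A \<in> sets S" "B \<in> sets borel" for A B
  proof -
    have "emeasure ?L (A \<times> B) = emeasure (distr M S X \<Otimes>\<^sub>M unif)
        ((\<lambda>(s, u). (s, \<phi> s u)) -` (A \<times> B) \<inter> space (distr M S X \<Otimes>\<^sub>M unif))"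
      by (rule emeasure_distr) measurable
    also have "\<dots> = (\<integral>\<^sup>+s. emeasure unif (Pair s -` ((\<lambda>(s, u). (s, \<phi> s u)) -` (A \<times> B) \<inter> space (distr M S X \<Otimes>\<^sub>M unif))) \<partial>distr M S X)"
      by (rule U.emeasure_pair_measure_alt) (rule measurable_sets[OF fm], measurable)
    also have "\<dots> = (\<integral>\<^sup>+s\<in>A. emeasure unif {u. \<phi> s u \<in> B} \<partial>distr M S X)"
    proof (rule nn_integral_cong)
      fix s assume s: "s \<in> space (distr M S X)"
      have eq: "Pair s -` ((\<lambda>(s, u). (s, \<phi> s u)) -` (A \<times> B) \<inter> space (distr M S X \<Otimes>\<^sub>M unif)) =
         (if s \<in> A then {u. \<phi> s u \<in> B} else {})"
        using s by (auto simp: space_pair_measure)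
      show "emeasure unif (Pair s -` ((\<lambda>(s, u). (s, \<phi> s u)) -` (A \<times> B) \<inter> space (distr M S X \<Otimes>\<^sub>M unif)))
         = emeasure unif {u. \<phi> s u \<in> B} * indicator A s"
        unfolding eq by (cases "s \<in> A") simp_all
    qed
    finally show ?thesis .
  qed
  have Rrect: "emeasure ?R (A \<times> B) = emeasure M {x \<in> space M. X x \<in> A \<and> Y x \<in> B}"
    if [measurable]: "A \<in> sets S" "B \<in> sets borel" for A B
    by (subst emeasure_distr) (auto intro!: arg_cong2[where f = emeasure])
  \<comment> \<open>Open half-lines fit the strict inequality in \<open>G\<close>. Both variables
    lie in the unit interval, so only \<open>0 < t\<close> and \<open>t \<le> 1\<close> need an
    argument.\<close>
  have less: "emeasure ?L (A \<times> {..<t}) = emeasure ?R (A \<times> {..<t})" if A [measurable]: "A \<in> sets S" for A t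
  proof -
    have Bt: "{..<t} \<in> sets borel" by simp
    consider "t \<le> 0" | "1 < t" | "0 < t" "t \<le> 1" by linarith
    then show ?thesis
    proof cases
      case 1
      then have e1: "{u. \<phi> s u \<in> {..<t}} = {}" for s
        using \<phi>01[of s] by (auto simp: not_less intro: order_trans)
      have e2: "{x \<in> space M. X x \<in> A \<and> Y x \<in> {..<t}} = {}" using 1 Y01 by force
      show ?thesis unfolding Lrect[OF A Bt] Rrect[OF A Bt] e1 e2 by simp
    next
      case 2
      then have e1: "{u. \<phi> s u \<in> {..<t}} = UNIV" for s using \<phi>01[of s] by (auto intro: le_less_trans)
      have e2: "{x \<in> space M. X x \<in> A \<and> Y x \<in> {..<t}} = X -` A \<inter> space M" using 2 Y01 by force
      show ?thesis
        unfolding Lrect[OF A Bt] Rrect[OF A Bt] e1 e2 using U.emeasure_space_1 by (simp add: emeasure_distr)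
    next
      case 3
      \<comment> \<open>The finite sets \<open>Q n\<close> grow and exhaust the rationals in
        \<open>[0, t)\<close>; 0 is added to have a maximum from the start. Their maxima
        \<open>q n\<close> increase and are cofinal among these rationals, which turns a union over
        all thresholds below \<open>t\<close> into one monotone sequence.\<close>
      define Q where "Q n = insert 0 ({0..<t} \<inter> (\<lambda>i. real_of_rat (from_nat i)) ` {..n})" for n :: nat
      define q where "q n = Max (Q n)" for n
      have finQ: "finite (Q n)" for n by (simp add: Q_def)
      have qQ: "q n \<in> Q n" for n unfolding q_def by (rule Max_in[OF finQ]) (simp add: Q_def)
      have qb: "q n \<in> \<rat>" "0 \<le> q n" "q n < t" for n
        using qQ[of n] 3 by (auto simp: Q_def)
      have qmono: "q n \<le> q (Suc n)" for n
        unfolding q_def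
      proof (rule Max_mono[OF _ _ finQ])
        have "(\<lambda>i. real_of_rat (from_nat i)) ` {..n} \<subseteq> (\<lambda>i. real_of_rat (from_nat i)) ` {..Suc n}"
          by (rule image_mono) auto
        then show "Q n \<subseteq> Q (Suc n)" unfolding Q_def by blast
      qed (simp add: Q_def)
      have qcof: "\<exists>n. p \<le> q n" if p: "p \<in> \<rat>" "0 \<le> p" "p < t" for p
      proof -
        obtain r where r: "p = real_of_rat r" using p(1) by (auto elim: Rats_cases)
        have "p \<in> Q (to_nat r)" using p r by (auto simp: Q_def intro!: image_eqI[of _ _ "to_nat r"])
        then have "p \<le> q (to_nat r)" unfolding q_def by (rule Max_ge[OF finQ])
        then show ?thesis ..
      qed
      have good: "AE s in distr M S X. (\<forall>p\<in>\<rat>. \<forall>p'\<in>\<rat>. p \<le> p' \<longrightarrow> G p s \<le> G p' s) \<and> (\<forall>p\<in>\<rat>. G p s \<le> 1)"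
        using G_mono G_le by (auto intro!: AE_conjI AE_ball_countable' countable_rat)
      have "emeasure ?L (A \<times> {..<t}) = (\<integral>\<^sup>+s\<in>A. emeasure unif {u. \<phi> s u \<in> {..<t}} \<partial>distr M S X)"
        by (rule Lrect) measurable
      also have "\<dots> = (\<integral>\<^sup>+s. (SUP n. G (q n) s * indicator A s) \<partial>distr M S X)"
      proof (rule nn_integral_cong_AE)
        show "AE s in distr M S X. emeasure unif {u. \<phi> s u \<in> {..<t}} * indicator A s =
            (SUP n. G (q n) s * indicator A s)"
          using good
        proof eventually_elim
          case (elim s)
          have "{u. \<phi> s u \<in> {..<t}} = (\<Union>n. {u. ennreal u \<le> G (q n) s})"
          proof (intro equalityI subsetI)
            fix u assume "u \<in> {u. \<phi> s u \<in> {..<t}}"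
            then obtain p where p: "p \<in> \<rat>" "0 \<le> p" "p < t" "ennreal u \<le> G p s"
              using 3 by (auto simp: \<phi>_less)
            then obtain n where "p \<le> q n" using qcof by blast
            with p elim qb(1)[of n] have "ennreal u \<le> G (q n) s" by (blast intro: order_trans)
            then show "u \<in> (\<Union>n. {u. ennreal u \<le> G (q n) s})" by blast
          next
            fix u assume "u \<in> (\<Union>n. {u. ennreal u \<le> G (q n) s})"
            then show "u \<in> {u. \<phi> s u \<in> {..<t}}" using qb by (auto simp: \<phi>_less)
          qed
          also have "emeasure unif \<dots> = (SUP n. emeasure unif {u. ennreal u \<le> G (q n) s})"
          proof (rule SUP_emeasure_incseq[symmetric])
            show "range (\<lambda>n. {u. ennreal u \<le> G (q n) s}) \<subseteq> sets unif"
            proof -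
              have "{u \<in> space borel. ennreal u \<le> c} \<in> sets borel" for c by measurable
              then show ?thesis by auto
            qed
            show "incseq (\<lambda>n. {u. ennreal u \<le> G (q n) s})"
            proof (rule incseq_SucI)
              fix n
              have "G (q n) s \<le> G (q (Suc n)) s" using elim qb(1) qmono by blast
              then show "{u. ennreal u \<le> G (q n) s} \<subseteq> {u. ennreal u \<le> G (q (Suc n)) s}"
                by (auto intro: order_trans)
            qed
          qed
          also have "\<dots> = (SUP n. G (q n) s)"
            using elim qb by (intro SUP_cong refl unif_atMost) auto
          finally show ?case by (simp add: SUP_mult_right_ennreal)
        qed
      qed
      also have "\<dots> = (SUP n. \<integral>\<^sup>+s. G (q n) s * indicator A s \<partial>distr M S X)"
      proof (rule nn_integral_monotone_convergence_SUP_AE)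
        show "AE s in distr M S X. G (q n) s * indicator A s \<le> G (q (Suc n)) s * indicator A s" for n
          using G_mono[OF qmono[of n]] by eventually_elim (rule mult_right_mono, auto)
      qed measurable
      also have "\<dots> = (SUP n. emeasure M {x \<in> space M. X x \<in> A \<and> Y x < q n})"
        by (simp add: G)
      also have "\<dots> = emeasure M (\<Union>n. {x \<in> space M. X x \<in> A \<and> Y x < q n})"
        by (rule SUP_emeasure_incseq) (auto intro!: incseq_SucI less_le_trans[OF _ qmono])
      also have "(\<Union>n. {x \<in> space M. X x \<in> A \<and> Y x < q n}) = {x \<in> space M. X x \<in> A \<and> Y x \<in> {..<t}}"
      proof (intro equalityI subsetI)
        fix x assume x: "x \<in> {x \<in> space M. X x \<in> A \<and> Y x \<in> {..<t}}"
        then obtain p where p: "p \<in> \<rat>" "Y x < p" "p < t" using Rats_dense_in_real by blast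
        with x Y01[of x] qcof[of p] obtain n where "p \<le> q n" by auto
        with p x show "x \<in> (\<Union>n. {x \<in> space M. X x \<in> A \<and> Y x < q n})" by (auto intro: less_le_trans)
      qed (use qb in \<open>auto intro: less_trans\<close>)
      also have "emeasure M \<dots> = emeasure ?R (A \<times> {..<t})" by (rule Rrect[symmetric]) measurable
      finally show ?thesis .
    qed
  qed
  interpret L: prob_space ?L by (rule DU.prob_space_distr) measurable
  interpret R: prob_space ?R by (rule prob_space_distr) measurable
  have rect: "emeasure ?L (A \<times> B) = emeasure ?R (A \<times> B)" if [measurable]: "A \<in> sets S" "B \<in> sets borel" for A B
  proof -
    \<comment> \<open>For fixed \<open>A\<close>, restrict the law to \<open>A \<times> UNIV\<close>
      and project to the line. The result is determined by half-lines, so \<open>less\<close>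
      extends to every Borel set \<open>B\<close>.\<close>
    let ?D = "\<lambda>N. distr (density N (indicator (A \<times> UNIV))) borel snd"
    have D: "emeasure (?D N) C = emeasure N (A \<times> C)"
      if N: "sets N = sets (S \<Otimes>\<^sub>M borel)" and C: "C \<in> sets borel" for N :: "('s \<times> real) measure" and C
    proof -
      note [measurable_cong] = N
      note [measurable] = C
      have sp: "space N = space S \<times> UNIV" using sets_eq_imp_space_eq[OF N] by (simp add: space_pair_measure)
      have As: "A \<subseteq> space S" using sets.sets_into_space[OF \<open>A \<in> sets S\<close>] .
      have "emeasure (?D N) C = (\<integral>\<^sup>+x. indicator (A \<times> UNIV) x * indicator (snd -` C \<inter> space N) x \<partial>N)"
        by (subst emeasure_distr, simp, simp, subst emeasure_density) auto
      also have "\<dots> = (\<integral>\<^sup>+x. indicator (A \<times> C) x \<partial>N)"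
        using As by (intro nn_integral_cong) (auto simp: indicator_def sp)
      also have "\<dots> = emeasure N (A \<times> C)" by (rule nn_integral_indicator) measurable
      finally show ?thesis .
    qed
    have "?D ?L = ?D ?R"
    proof (rule measure_eqI_generator_eq[where E = "range lessThan" and \<Omega> = UNIV and A = "\<lambda>n. {..<real n}"])
      show "Int_stable (range (lessThan :: real \<Rightarrow> _))"
      proof -
        have "{..<a} \<inter> {..<b} = {..<min a b}" for a b :: real by auto
        then show ?thesis by (auto simp: Int_stable_def)
      qed
      show "emeasure (?D ?L) X = emeasure (?D ?R) X" if "X \<in> range lessThan" for X
        using that by (auto simp: D less)
      show "(\<Union>i. {..<real i}) = UNIV" using reals_Archimedean2 by auto
      show "emeasure (?D ?L) {..<real i} \<noteq> \<infinity>" for i by (simp add: D L.emeasure_eq_measure)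
    qed (auto simp: borel_Iio)
    then have "emeasure (?D ?L) B = emeasure (?D ?R) B" by simp
    then show ?thesis by (simp add: D)
  qed
  show thesis
  proof (rule that[OF \<phi>m \<phi>01])
    fix A B assume A [measurable]: "A \<in> sets S" and B: "B \<in> sets (borel :: real measure)"
    note [measurable] = borel_measurable_unif_kernel[OF \<phi>m B]
    have "ennreal (measure M {x \<in> space M. X x \<in> A \<and> Y x \<in> B}) =
        (\<integral>\<^sup>+s\<in>A. emeasure unif {u. \<phi> s u \<in> B} \<partial>distr M S X)"
      using rect[OF A B] Lrect[OF A B] Rrect[OF A B] by (simp add: emeasure_eq_measure)
    also have "\<dots> = (\<integral>\<^sup>+x. emeasure unif {u. \<phi> (X x) u \<in> B} * indicator A (X x) \<partial>M)"
      by (rule nn_integral_distr) (simp_all add: U.emeasure_eq_measure)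
    also have "\<dots> = (\<integral>\<^sup>+x. ennreal (measure unif {u. \<phi> (X x) u \<in> B} * indicator A (X x)) \<partial>M)"
      by (intro nn_integral_cong) (simp add: U.emeasure_eq_measure indicator_def)
    also have "\<dots> = ennreal (\<integral>x. measure unif {u. \<phi> (X x) u \<in> B} * indicator A (X x) \<partial>M)"
    proof (rule nn_integral_eq_integral)
      show "integrable M (\<lambda>x. measure unif {u. \<phi> (X x) u \<in> B} * indicator A (X x))"
        by (rule integrable_of_bound[where B = 1], measurable) (simp add: indicator_def)
    qed (simp add: indicator_def)
    finally have "measure M {x \<in> space M. X x \<in> A \<and> Y x \<in> B} =
        (\<integral>x. measure unif {u. \<phi> (X x) u \<in> B} * indicator A (X x) \<partial>M)"
      by (subst (asm) ennreal_inj) (auto intro!: integral_nonneg_AE simp: indicator_def)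
    moreover have "(\<integral>x. indicator B (Y x) * indicator A (X x) \<partial>M) =
        (\<integral>x. indicat_real {x \<in> space M. X x \<in> A \<and> Y x \<in> B} x \<partial>M)"
      by (rule Bochner_Integration.integral_cong) (auto simp: indicator_def)
    ultimately show "(\<integral>x. indicator B (Y x) * indicator A (X x) \<partial>M) =
        (\<integral>x. measure unif {u. \<phi> (X x) u \<in> B} * indicator A (X x) \<partial>M)"
      by (simp add: Int_def conj_commute conj_left_commute)
  qed
qed

section \<open>The weak topology\<close>

lemma topspace_weak_topology [simp]: "topspace (weak_topology S) = prob_measures S"
proof -
  have "prob_measures S \<in> {{\<mu> \<in> prob_measures S. (\<integral>x. f x \<partial>\<mu>) \<in> U} | f U.
        continuous_on S f \<and> bounded (f ` S) \<and> open (U :: real set)}"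
    by (intro CollectI exI[of _ "\<lambda>_. 0"] exI[of _ UNIV]) (auto simp: image_constant_conv)
  then show ?thesis unfolding weak_topology_def by auto
qed

lemma continuous_map_weak_integral:
  fixes f :: "'a::topological_space \<Rightarrow> real"
  assumes "continuous_on S f" "bounded (f ` S)"
  shows "continuous_map (weak_topology S) euclideanreal (\<lambda>\<mu>. \<integral>x. f x \<partial>\<mu>)"
  unfolding continuous_map_def
proof (intro conjI allI impI)
  fix U :: "real set" assume "openin euclideanreal U"
  then show "openin (weak_topology S) {\<mu> \<in> topspace (weak_topology S). (\<integral>x. f x \<partial>\<mu>) \<in> U}"
    unfolding topspace_weak_topology unfolding weak_topology_def
    using assms by (intro topology_generated_by_Basis CollectI exI[of _ f] exI[of _ U]) auto
qed auto

text \<open>The zero set of a continuous function is closed. Invariance, independence and the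
  triangle inequality reach \<open>\<kappa>\<close> in this way, each as the vanishing of a weakly
  continuous functional.\<close>

lemma closure_of_continuous_eq_0:
  fixes F :: "'a \<Rightarrow> real"
  assumes x: "x \<in> T closure_of A" and F: "continuous_map T euclideanreal F"
    and A: "\<And>a. a \<in> A \<Longrightarrow> a \<in> topspace T" "\<And>a. a \<in> A \<Longrightarrow> F a = 0"
  shows "F x = 0"
proof -
  have "closedin T {a \<in> topspace T. F a \<in> {0}}"
    by (rule closedin_continuous_map_preimage[OF F]) auto
  then have "T closure_of A \<subseteq> {a \<in> topspace T. F a \<in> {0}}"
    using A by (intro closure_of_minimal) auto
  then show ?thesis using x by auto
qed

lemma prob_measures_integrable:
  fixes g :: "real \<Rightarrow> real"
  assumes \<mu>: "\<mu> \<in> prob_measures {0..1}" and g: "continuous_on {0..1} g"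
  shows "integrable \<mu> g"
proof -
  interpret prob_space \<mu> using \<mu> by (simp add: prob_measures_def)
  have s: "sets \<mu> = sets (restrict_space borel {0..1})" using \<mu> by (simp add: prob_measures_def)
  have sp: "space \<mu> = {0..1}" using sets_eq_imp_space_eq[OF s] by (simp add: space_restrict_space)
  have "bounded (g ` {0..1})"
    by (intro compact_imp_bounded compact_continuous_image g) simp
  then obtain B where "\<forall>x\<in>{0..1}. \<bar>g x\<bar> \<le> B" by (auto simp: bounded_iff)
  moreover have "g \<in> borel_measurable \<mu>"
    using borel_measurable_continuous_on_restrict[OF g] by (simp add: measurable_cong_sets[OF s refl])
  ultimately show ?thesis by (intro integrable_of_bound[of g B]) (auto simp: sp)
qed

text \<open>Half of \<open>e\<close> pays for the Weierstrass approximation, half for making the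
  coefficients rational: Bernstein polynomials are nonnegative with sum 1, so the change of the sum
  is at most the largest change of a coefficient. Coefficients form a list so that the approximants
  are indexed by a countable type.\<close>

lemma bernstein_rational_dense:
  fixes f :: "real \<Rightarrow> real"
  assumes f: "continuous_on {0..1} f" and e: "0 < e"
  obtains n and l :: "rat list" where
    "\<And>x. x \<in> {0..1} \<Longrightarrow> \<bar>f x - (\<Sum>k\<le>n. of_rat (l ! k) * Bernstein n k x)\<bar> < e"
proof -
  have "0 < e / 2" using e by simp
  then obtain n where n: "\<And>x. x \<in> {0..1} \<Longrightarrow> \<bar>f x - (\<Sum>k\<le>n. f (k / n) * Bernstein n k x)\<bar> < e / 2"
    using Bernstein_Weierstrass[OF f] by (metis order_refl)
  have "\<exists>q. \<bar>f (k / n) - of_rat q\<bar> < e / 2" for k :: nat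
  proof -
    obtain q where "f (k / n) - e / 2 < of_rat q" "of_rat q < f (k / n) + e / 2"
      using of_rat_dense[of "f (k / n) - e / 2" "f (k / n) + e / 2"] e by auto
    then have "\<bar>f (k / n) - of_rat q\<bar> < e / 2" by linarith
    then show ?thesis ..
  qed
  then obtain q where q: "\<And>k. \<bar>f (real k / n) - of_rat (q k)\<bar> < e / 2" by metis
  define l where "l = map q [0..<Suc n]"
  have l: "l ! k = q k" if "k \<le> n" for k using that by (simp add: l_def nth_append del: upt_Suc)
  show thesis
  proof (rule that[of l n])
    fix x :: real assume x: "x \<in> {0..1}"
    have "\<bar>(\<Sum>k\<le>n. f (k / n) * Bernstein n k x) - (\<Sum>k\<le>n. of_rat (l ! k) * Bernstein n k x)\<bar>
        = \<bar>\<Sum>k\<le>n. (f (k / n) - of_rat (q k)) * Bernstein n k x\<bar>"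
      unfolding sum_subtractf[symmetric] left_diff_distrib[symmetric]
      by (intro arg_cong[where f = abs] sum.cong) (simp_all add: l)
    also have "\<dots> \<le> (\<Sum>k\<le>n. \<bar>(f (k / n) - of_rat (q k)) * Bernstein n k x\<bar>)" by (rule sum_abs)
    also have "\<dots> \<le> (\<Sum>k\<le>n. e / 2 * Bernstein n k x)"
    proof (rule sum_mono)
      fix k
      have B: "0 \<le> Bernstein n k x" using x by (intro Bernstein_nonneg) auto
      show "\<bar>(f (k / n) - of_rat (q k)) * Bernstein n k x\<bar> \<le> e / 2 * Bernstein n k x"
        unfolding abs_mult abs_of_nonneg[OF B] by (rule mult_right_mono[OF less_imp_le[OF q] B])
    qed
    also have "\<dots> = e / 2" by (simp only: sum_distrib_left[symmetric] sum_Bernstein mult_1_right)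
    finally show "\<bar>f x - (\<Sum>k\<le>n. of_rat (l ! k) * Bernstein n k x)\<bar> < e"
      using n[OF x] by linarith
  qed
qed

text \<open>By the Bernstein polynomials with rational coefficients, the weak topology has a countable
  base consisting of sets whose preimages are measurable.\<close>

lemma measurable_weak_topology:
  assumes f: "\<And>x. x \<in> space M \<Longrightarrow> f x \<in> prob_measures {0..1::real}"
    and m: "\<And>g :: real \<Rightarrow> real. continuous_on {0..1} g \<Longrightarrow> (\<lambda>x. \<integral>t. g t \<partial>f x) \<in> borel_measurable M"
  shows "f \<in> M \<rightarrow>\<^sub>M borel_of (weak_topology {0..1})"
proof -
  define p :: "nat \<Rightarrow> rat list \<Rightarrow> real \<Rightarrow> real" where "p n l x = (\<Sum>k\<le>n. of_rat (l ! k) * Bernstein n k x)" for n l x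
  have pc: "continuous_on {0..1} (p n l)" for n l
    unfolding p_def Bernstein_def by (intro continuous_intros)
  \<comment> \<open>Countably many sets, and their preimages are measurable by assumption
    \<open>m\<close>, since Bernstein polynomials are continuous.\<close>
  define V where "V n l a b = {\<mu> \<in> prob_measures {0..1}. of_rat a < (\<integral>t. p n l t \<partial>\<mu>) \<and> (\<integral>t. p n l t \<partial>\<mu>) < real_of_rat b}" for n l a b
  define \<B> where "\<B> = (\<lambda>(n, l, a, b). V n l a b) ` UNIV"
  define \<D> where "\<D> = (\<lambda>F. prob_measures {0..1} \<inter> \<Inter>F) ` {F. F \<subseteq> \<B> \<and> finite F}"
  have "countable \<B>" unfolding \<B>_def by simp
  then have "countable {F. finite F \<and> F \<subseteq> \<B>}" by (rule countable_Collect_finite_subset)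
  then have countD: "countable \<D>"
    unfolding \<D>_def by (intro countable_image) (simp add: conj_commute)
  have Vm: "f -` B \<inter> space M \<in> sets M" if "B \<in> \<B>" for B
  proof -
    have "\<exists>z. B = (\<lambda>(n, l, a, b). V n l a b) z" using that unfolding \<B>_def by (rule imageE) (rule exI)
    then obtain n l a b where B: "B = V n l a b" by (auto split: prod.splits)
    note [measurable] = m[OF pc[of n l]]
    have "f -` B \<inter> space M = {x \<in> space M. of_rat a < (\<integral>t. p n l t \<partial>f x) \<and> (\<integral>t. p n l t \<partial>f x) < real_of_rat b}"
      using f by (auto simp: B V_def)
    also have "\<dots> \<in> sets M" by measurable
    finally show ?thesis .
  qed
  have Dm: "f -` D \<inter> space M \<in> sets M" if D: "D \<in> \<D>" for D
  proof -
    obtain F where F: "F \<subseteq> \<B>" "finite F" "D = prob_measures {0..1} \<inter> \<Inter>F" using D by (auto simp: \<D>_def)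
    have "f -` D \<inter> space M = space M \<inter> (\<Inter>B\<in>F. f -` B \<inter> space M)" using F(3) f by auto
    also have "\<dots> \<in> sets M"
    proof (cases "F = {}")
      case False
      then show ?thesis
        by (rule sets.Int[OF sets.top sets.finite_INT[OF F(2)]]) (use F(1) Vm in blast)
    qed simp
    finally show ?thesis .
  qed
  \<comment> \<open>Induction over the generation of open sets shows that \<open>\<D>\<close>, the
    finite intersections of the sets \<open>V\<close>, is a base. As \<open>\<D>\<close> is
    countable, an open set is a countable union of members of \<open>\<D>\<close>.\<close>
  have base: "W \<subseteq> prob_measures {0..1} \<and> (\<forall>\<mu>\<in>W. \<exists>D\<in>\<D>. \<mu> \<in> D \<and> D \<subseteq> W)"
    if "generate_topology_on {{\<mu> \<in> prob_measures {0..1}. (\<integral>x. f x \<partial>\<mu>) \<in> U} | f U.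
        continuous_on {0..1::real} f \<and> bounded (f ` {0..1}) \<and> open (U :: real set)} W" for W
    using that
  proof induction
    case (Int a b)
    show ?case
    proof (intro conjI ballI)
      fix \<mu> assume \<mu>: "\<mu> \<in> a \<inter> b"
      obtain D where "D \<in> \<D>" and D: "\<mu> \<in> D" "D \<subseteq> a" using Int.IH \<mu> by blast
      then obtain F where F: "F \<subseteq> \<B>" "finite F" "D = prob_measures {0..1} \<inter> \<Inter>F" by (auto simp: \<D>_def)
      obtain D' where "D' \<in> \<D>" and D': "\<mu> \<in> D'" "D' \<subseteq> b" using Int.IH \<mu> by blast
      then obtain F' where F': "F' \<subseteq> \<B>" "finite F'" "D' = prob_measures {0..1} \<inter> \<Inter>F'" by (auto simp: \<D>_def)
      have "D \<inter> D' = prob_measures {0..1} \<inter> \<Inter>(F \<union> F')" using F(3) F'(3) by auto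
      then have "D \<inter> D' \<in> \<D>"
        using F(1,2) F'(1,2) unfolding \<D>_def by (intro image_eqI[of _ _ "F \<union> F'"]) auto
      moreover have "\<mu> \<in> D \<inter> D' \<and> D \<inter> D' \<subseteq> a \<inter> b" using D D' by blast
      ultimately show "\<exists>D\<in>\<D>. \<mu> \<in> D \<and> D \<subseteq> a \<inter> b" by (rule bexI[rotated])
    next
      show "a \<inter> b \<subseteq> prob_measures {0..1}" using conjunct1[OF Int.IH(1)] by (rule le_infI1)
    qed
  next
    case (UN K)
    show ?case
    proof (intro conjI ballI)
      show "\<Union>K \<subseteq> prob_measures {0..1}" using UN.IH by (intro Union_least) simp
      fix \<mu> assume "\<mu> \<in> \<Union>K"
      then obtain k where k: "k \<in> K" "\<mu> \<in> k" by blast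
      then obtain D where "D \<in> \<D>" "\<mu> \<in> D" "D \<subseteq> k" using UN.IH[OF k(1)] by blast
      then show "\<exists>D\<in>\<D>. \<mu> \<in> D \<and> D \<subseteq> \<Union>K" using k(1) by (intro bexI[of _ D]) auto
    qed
  next
    case (Basis s)
    then obtain g :: "real \<Rightarrow> real" and U :: "real set" where s: "s = {\<mu> \<in> prob_measures {0..1}. (\<integral>x. g x \<partial>\<mu>) \<in> U}"
      and g: "continuous_on {0..1} g" and U: "open U"
      by blast
    show ?case
    proof (intro conjI ballI)
      fix \<mu> assume "\<mu> \<in> s"
      then have \<mu>: "\<mu> \<in> prob_measures {0..1}" "(\<integral>x. g x \<partial>\<mu>) \<in> U" by (auto simp: s)
      obtain e where e: "e > 0" "ball (\<integral>x. g x \<partial>\<mu>) e \<subseteq> U" using U \<mu>(2) openE by blast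
      \<comment> \<open>Two approximation errors of at most \<open>e / 4\<close> each, and a
        difference below \<open>e / 4\<close> between the integrals of \<open>p n l\<close> within
        \<open>V n l a b\<close>, add up to less than \<open>e\<close>.\<close>
      have e4: "0 < e / 4" using e by simp
      have "\<exists>n l. \<forall>x\<in>{0..1}. \<bar>g x - p n l x\<bar> < e / 4"
        using bernstein_rational_dense[OF g e4] unfolding p_def by metis
      then obtain n l where nl: "\<And>x. x \<in> {0..1} \<Longrightarrow> \<bar>g x - p n l x\<bar> < e / 4" by blast
      have close: "\<bar>(\<integral>x. g x \<partial>\<nu>) - (\<integral>x. p n l x \<partial>\<nu>)\<bar> \<le> e / 4" if \<nu>: "\<nu> \<in> prob_measures {0..1}" for \<nu>
      proof -
        interpret prob_space \<nu> using \<nu> by (simp add: prob_measures_def)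
        have sp: "space \<nu> = {0..1}"
          using \<nu> sets_eq_imp_space_eq[of \<nu> "restrict_space borel {0..1}"]
          by (simp add: prob_measures_def space_restrict_space)
        note i = prob_measures_integrable[OF \<nu> g] prob_measures_integrable[OF \<nu> pc]
        have "\<bar>(\<integral>x. g x \<partial>\<nu>) - (\<integral>x. p n l x \<partial>\<nu>)\<bar> = \<bar>\<integral>x. g x - p n l x \<partial>\<nu>\<bar>" using i by simp
        also have "\<dots> \<le> (\<integral>x. \<bar>g x - p n l x\<bar> \<partial>\<nu>)" by (rule integral_abs_bound)
        also have "\<dots> \<le> (\<integral>x. e / 4 \<partial>\<nu>)"
          using i nl by (intro integral_mono integrable_abs Bochner_Integration.integrable_diff) (auto simp: sp less_imp_le)
        finally show ?thesis by (simp add: prob_space)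
      qed
      let ?c = "\<integral>x. p n l x \<partial>\<mu>"
      obtain a where a: "?c - e / 4 < of_rat a" "of_rat a < ?c" using of_rat_dense[of "?c - e / 4" ?c] e by auto
      obtain b where b: "?c < of_rat b" "of_rat b < ?c + e / 4" using of_rat_dense[of ?c "?c + e / 4"] e by auto
      have "V n l a b \<in> \<B>" unfolding \<B>_def by (rule image_eqI[of _ _ "(n, l, a, b)"]) auto
      moreover have "V n l a b = prob_measures {0..1} \<inter> \<Inter>{V n l a b}" by (auto simp: V_def)
      ultimately have "V n l a b \<in> \<D>" unfolding \<D>_def by (intro image_eqI[of _ _ "{V n l a b}"]) auto
      moreover have "\<mu> \<in> V n l a b" using a b \<mu> by (auto simp: V_def)
      moreover have "V n l a b \<subseteq> s"
      proof
        fix \<nu> assume "\<nu> \<in> V n l a b"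
        then have \<nu>: "\<nu> \<in> prob_measures {0..1}" "of_rat a < (\<integral>t. p n l t \<partial>\<nu>)" "(\<integral>t. p n l t \<partial>\<nu>) < of_rat b"
          by (auto simp: V_def)
        have "\<bar>(\<integral>x. g x \<partial>\<mu>) - (\<integral>x. g x \<partial>\<nu>)\<bar> < e"
          using close[OF \<nu>(1)] close[OF \<mu>(1)] \<nu>(2,3) a b by linarith
        then have "(\<integral>x. g x \<partial>\<nu>) \<in> ball (\<integral>x. g x \<partial>\<mu>) e" by (simp add: dist_real_def)
        then show "\<nu> \<in> s" using \<nu>(1) e(2) by (auto simp: s)
      qed
      ultimately show "\<exists>D\<in>\<D>. \<mu> \<in> D \<and> D \<subseteq> s" by (intro bexI[of _ "V n l a b"]) auto
    qed (simp add: s)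
  qed simp
  show ?thesis
    unfolding borel_of_def
  proof (rule measurable_measure_of)
    fix W assume "W \<in> {U. openin (weak_topology {0..1::real}) U}"
    then have "generate_topology_on {{\<mu> \<in> prob_measures {0..1}. (\<integral>x. f x \<partial>\<mu>) \<in> U} | f U.
        continuous_on {0..1::real} f \<and> bounded (f ` {0..1}) \<and> open (U :: real set)} W"
      by (simp add: weak_topology_def openin_topology_generated_by_iff)
    from conjunct2[OF base[OF this]] have "f -` W \<inter> space M = (\<Union>D\<in>{D \<in> \<D>. D \<subseteq> W}. f -` D \<inter> space M)"
      by blast
    also have "\<dots> \<in> sets M"
      using Dm by (intro sets.countable_UN'' countable_subset[OF _ countD]) auto
    finally show "f -` W \<inter> space M \<in> sets M" .
  qed (use f openin_subset[of "weak_topology {0..1::real}"] in \<open>auto\<close>)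
qed

section \<open>Entries of distance matrices\<close>

abbreviation M_inf_borel :: "(nat \<Rightarrow> nat \<Rightarrow> real) measure" where
  "M_inf_borel \<equiv> restrict_space borel M_inf"

lemma space_M_inf_borel: "space M_inf_borel = M_inf"
  by (simp add: space_restrict_space)

lemma continuous_on_entry: "continuous_on A (\<lambda>D :: nat \<Rightarrow> nat \<Rightarrow> real. D i j)"
proof -
  have "continuous_on UNIV ((\<lambda>x :: nat \<Rightarrow> real. x j) \<circ> (\<lambda>D :: nat \<Rightarrow> nat \<Rightarrow> real. D i))"
    by (rule continuous_on_compose) (auto intro: continuous_on_subset[OF continuous_on_product_coordinates])
  then show ?thesis by (auto simp: o_def intro: continuous_on_subset)
qed

lemma entry_measurable_M_inf_borel: "(\<lambda>D. D i j) \<in> borel_measurable M_inf_borel"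
  by (intro measurable_restrict_space1 borel_measurable_continuous_onI continuous_on_entry)

lemma measurable_M_inf_borelI:
  assumes "\<And>x. x \<in> space N \<Longrightarrow> f x \<in> M_inf" "\<And>i j. (\<lambda>x. f x i j) \<in> borel_measurable N"
  shows "f \<in> N \<rightarrow>\<^sub>M M_inf_borel"
  using assms by (intro measurable_restrict_space2 measurable_coordinatewise_then_product) auto

section \<open>Boxes and the sigma-algebras generated by sets of entries\<close>

definition mbox :: "(nat \<times> nat) set \<Rightarrow> (nat \<times> nat \<Rightarrow> real) \<Rightarrow> (nat \<Rightarrow> nat \<Rightarrow> real) set" where
  "mbox J r = {D \<in> M_inf. \<forall>(i, j)\<in>J. D i j \<le> r (i, j)}"

text \<open>Rational bounds still generate the sigma-algebra and leave only countably many boxes, so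
  that almost sure statements about all of them can be combined.\<close>

definition boxes :: "(nat \<times> nat) set \<Rightarrow> (nat \<Rightarrow> nat \<Rightarrow> real) set set" where
  "boxes P = {mbox J (\<lambda>p. of_rat (r p)) | J r. finite J \<and> J \<subseteq> P}"

text \<open>The sigma-algebra generated by the entries in \<open>P\<close>. All of these live on the
  same space \<open>M_inf\<close>, so that they form sub-sigma-algebras on which one can
  condition.\<close>

definition ent :: "(nat \<times> nat) set \<Rightarrow> (nat \<Rightarrow> nat \<Rightarrow> real) measure" where
  "ent P = sigma M_inf (boxes P)"

lemma boxes_Pow: "boxes P \<subseteq> Pow M_inf"
  by (auto simp: boxes_def mbox_def)

lemma space_ent [simp]: "space (ent P) = M_inf"
  by (simp add: ent_def boxes_Pow)

lemma sets_ent: "sets (ent P) = sigma_sets M_inf (boxes P)"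
  by (simp add: ent_def boxes_Pow)

lemma M_inf_in_boxes: "M_inf \<in> boxes P"
  unfolding boxes_def by (intro CollectI exI[of _ "{}"] exI[of _ "\<lambda>_. 0"]) (auto simp: mbox_def)

lemma Int_stable_boxes: "Int_stable (boxes P)"
proof (rule Int_stableI)
  fix a b assume "a \<in> boxes P" "b \<in> boxes P"
  then obtain J r K s where a: "a = mbox J (\<lambda>p. of_rat (r p))" "finite J" "J \<subseteq> P"
    and b: "b = mbox K (\<lambda>p. of_rat (s p))" "finite K" "K \<subseteq> P"
    by (auto simp: boxes_def)
  define t where "t p = (if p \<in> J then if p \<in> K then min (r p) (s p) else r p else s p)" for p
  have rt: "of_rat (min x y) = min (of_rat x) (of_rat y :: real)" for x y
    by (simp add: min_def of_rat_less_eq)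
  have "a \<inter> b = mbox (J \<union> K) (\<lambda>p. of_rat (t p))"
    by (auto simp: a b mbox_def t_def rt split: if_splits)
  then show "a \<inter> b \<in> boxes P" using a b unfolding boxes_def by blast
qed

lemma entry_measurable:
  assumes "(i, j) \<in> P"
  shows "(\<lambda>D. D i j) \<in> borel_measurable (ent P)"
  unfolding borel_measurable_iff_le
proof
  fix a :: real
  have "{D \<in> space (ent P). D i j \<le> a} = (\<Inter>q\<in>{q. a < of_rat q}. mbox {(i, j)} (\<lambda>_. of_rat q))"
  proof (intro equalityI subsetI)
    fix D assume D: "D \<in> (\<Inter>q\<in>{q. a < of_rat q}. mbox {(i, j)} (\<lambda>_. of_rat q))"
    have "D i j \<le> a"
    proof (rule ccontr)
      assume "\<not> D i j \<le> a"
      then obtain q where "a < of_rat q" "of_rat q < D i j" using of_rat_dense[of a "D i j"] by auto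
      then show False using D by (auto simp: mbox_def)
    qed
    moreover obtain q where "a < of_rat q" using of_rat_dense[of a "a + 1"] by auto
    ultimately show "D \<in> {D \<in> space (ent P). D i j \<le> a}" using D by (auto simp: mbox_def)
  qed (auto simp: mbox_def intro: order_trans)
  also have "\<dots> \<in> sets (ent P)"
  proof (rule sets.countable_INT')
    have "mbox {(i, j)} (\<lambda>_. of_rat q) \<in> boxes P" for q
      using assms unfolding boxes_def by (intro CollectI exI[of _ "{(i, j)}"] exI[of _ "\<lambda>_. q"]) auto
    then show "(\<lambda>q. mbox {(i, j)} (\<lambda>_. of_rat q)) ` {q. a < of_rat q} \<subseteq> sets (ent P)"
      by (auto simp: sets_ent intro: sigma_sets.Basic)
    obtain q where "a < of_rat q" using of_rat_dense[of a "a + 1"] by auto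
    then show "{q. a < real_of_rat q} \<noteq> {}" by auto
  qed simp
  finally show "{D \<in> space (ent P). D i j \<le> a} \<in> sets (ent P)" .
qed

lemma mbox_measurable:
  assumes "finite J" "\<And>p. p \<in> J \<Longrightarrow> (\<lambda>D. D (fst p) (snd p)) \<in> borel_measurable N" "space N = M_inf"
  shows "mbox J r \<in> sets N"
proof -
  have "mbox J r = space N \<inter> (\<Inter>p\<in>J. {D \<in> space N. D (fst p) (snd p) \<le> r p})"
    by (fastforce simp: mbox_def assms(3))
  also have "\<dots> \<in> sets N"
  proof -
    have "{D \<in> space N. D (fst p) (snd p) \<le> r p} \<in> sets N" if "p \<in> J" for p
    proof -
      note [measurable] = assms(2)[OF that]
      show ?thesis by measurable
    qed
    then show ?thesis using assms(1) by (cases "J = {}") (auto intro!: sets.Int sets.finite_INT)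
  qed
  finally show ?thesis .
qed

lemma measurable_entI:
  assumes f: "\<And>x. x \<in> space N \<Longrightarrow> f x \<in> M_inf"
    and m: "\<And>i j. (i, j) \<in> P \<Longrightarrow> (\<lambda>x. f x i j) \<in> borel_measurable N"
  shows "f \<in> N \<rightarrow>\<^sub>M ent P"
  unfolding ent_def
proof (rule measurable_measure_of[OF boxes_Pow])
  fix B assume "B \<in> boxes P"
  then obtain J r where B: "B = mbox J (\<lambda>p. of_rat (r p))" and J: "finite J" "J \<subseteq> P" by (auto simp: boxes_def)
  have "f -` B \<inter> space N = space N \<inter> (\<Inter>p\<in>J. {x \<in> space N. f x (fst p) (snd p) \<le> of_rat (r p)})"
    using f by (fastforce simp: B mbox_def)
  also have "\<dots> \<in> sets N"
  proof -
    have "{x \<in> space N. f x (fst p) (snd p) \<le> of_rat (r p)} \<in> sets N" if "p \<in> J" for p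
    proof -
      have [measurable]: "(\<lambda>x. f x (fst p) (snd p)) \<in> borel_measurable N"
        using that J by (intro m) auto
      show ?thesis by measurable
    qed
    then show ?thesis using J by (cases "J = {}") (auto intro!: sets.Int sets.finite_INT)
  qed
  finally show "f -` B \<inter> space N \<in> sets N" .
qed (use f in auto)

lemma ent_mono:
  assumes "P \<subseteq> Q"
  shows "sets (ent P) \<subseteq> sets (ent Q)"
proof -
  have "boxes P \<subseteq> boxes Q" using assms by (auto simp: boxes_def)
  then show ?thesis unfolding sets_ent by (rule sigma_sets_mono')
qed

text \<open>Symmetry and the zero diagonal recover the remaining entries, and the entries together
  generate the Borel sets of the product topology.\<close>

lemma sets_ent_upper: "sets (ent {(i, j). i < j}) = sets M_inf_borel"
proof -
  have e: "(\<lambda>D. D i j) \<in> borel_measurable (ent {(i, j). i < j})" for i j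
  proof -
    consider "i < j" | "i = j" | "j < i" by linarith
    then show ?thesis
    proof cases
      case 2
      then have "D i j = 0" if "D \<in> space (ent {(i, j). i < j})" for D using that by (auto simp: M_inf_def)
      then have "(\<lambda>D. D i j) \<in> borel_measurable (ent {(i, j). i < j}) \<longleftrightarrow>
          (\<lambda>D. 0 :: real) \<in> borel_measurable (ent {(i, j). i < j})" by (intro measurable_cong)
      then show ?thesis by simp
    next
      case 3
      then have "D i j = D j i" if "D \<in> space (ent {(i, j). i < j})" for D using that by (auto simp: M_inf_def)
      then have "(\<lambda>D. D i j) \<in> borel_measurable (ent {(i, j). i < j}) \<longleftrightarrow>
          (\<lambda>D. D j i) \<in> borel_measurable (ent {(i, j). i < j})" by (intro measurable_cong)
      then show ?thesis using 3 by (simp add: entry_measurable)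
    qed (auto intro: entry_measurable)
  qed
  have "(\<lambda>D. D) \<in> ent {(i, j). i < j} \<rightarrow>\<^sub>M M_inf_borel"
    by (rule measurable_M_inf_borelI[OF _ e]) simp
  from measurable_sets[OF this] have "sets M_inf_borel \<subseteq> sets (ent {(i, j). i < j})"
    using sets.sets_into_space[of _ M_inf_borel] by (auto simp: space_M_inf_borel Int_absorb2)
  moreover have "(\<lambda>D. D) \<in> M_inf_borel \<rightarrow>\<^sub>M ent {(i, j). i < j}"
    by (rule measurable_entI) (auto simp: space_M_inf_borel intro: entry_measurable_M_inf_borel)
  from measurable_sets[OF this] have "sets (ent {(i, j). i < j}) \<subseteq> sets M_inf_borel"
    using sets.sets_into_space[of _ "ent {(i, j). i < j}"] by (auto simp: space_M_inf_borel Int_absorb2)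
  ultimately show ?thesis by blast
qed

lemma ent_subset_M_inf_borel: "sets (ent P) \<subseteq> sets M_inf_borel"
proof -
  have "(\<lambda>D. D) \<in> M_inf_borel \<rightarrow>\<^sub>M ent P"
    by (rule measurable_entI) (auto simp: space_M_inf_borel intro: entry_measurable_M_inf_borel)
  from measurable_sets[OF this] show ?thesis
    using sets.sets_into_space[of _ "ent P"] by (auto simp: space_M_inf_borel Int_absorb2)
qed

lemma measure_eqI_boxes:
  assumes "finite_measure N" "sets N = sets (ent P)" "sets N' = sets (ent P)"
    and "\<And>J r. finite J \<Longrightarrow> J \<subseteq> P \<Longrightarrow> emeasure N (mbox J (\<lambda>p. of_rat (r p))) = emeasure N' (mbox J (\<lambda>p. of_rat (r p)))"
  shows "N = N'"
proof (rule measure_eqI_generator_eq[OF Int_stable_boxes boxes_Pow])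
  show "range (\<lambda>_ :: nat. M_inf) \<subseteq> boxes P" using M_inf_in_boxes by auto
  show "emeasure N M_inf \<noteq> \<infinity>" using finite_measure.emeasure_finite[OF assms(1)] by auto
  show "emeasure N X = emeasure N' X" if "X \<in> boxes P" for X using that assms(4) by (auto simp: boxes_def)
qed (use assms in \<open>auto simp: sets_ent\<close>)

text \<open>A continuous substitute for the indicator of \<open>mbox J r\<close>, since the weak
  topology only controls continuous test functions. For \<open>k > 0\<close> each factor is 1 up to
  the bound and falls linearly to 0 within a distance \<open>1 / k\<close> beyond it.\<close>

definition cutoff :: "nat \<Rightarrow> (nat \<times> nat) set \<Rightarrow> (nat \<times> nat \<Rightarrow> real) \<Rightarrow> (nat \<Rightarrow> nat \<Rightarrow> real) \<Rightarrow> real" where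
  "cutoff k J r D = (\<Prod>p\<in>J. max 0 (min 1 (1 - real k * (D (fst p) (snd p) - r p))))"

lemma continuous_on_cutoff: "continuous_on A (cutoff k J r)"
  unfolding cutoff_def by (intro continuous_intros continuous_on_entry)

lemma cutoff_bounds: "0 \<le> cutoff k J r D" "cutoff k J r D \<le> 1"
  unfolding cutoff_def by (auto intro!: prod_nonneg prod_le_1)

lemma cutoff_LIMSEQ:
  assumes "finite J" "D \<in> M_inf"
  shows "(\<lambda>k. cutoff k J r D) \<longlonglongrightarrow> indicator (mbox J r) D"
proof -
  have one: "(\<lambda>k. max 0 (min 1 (1 - real k * (t - s)))) \<longlonglongrightarrow> (if t \<le> s then 1 else 0)" for t s :: real
  proof (cases "t \<le> s")
    case True
    then have "max 0 (min 1 (1 - real k * (t - s))) = 1" for k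
      by (simp add: mult_nonneg_nonpos min_def)
    then show ?thesis using True by simp
  next
    case False
    obtain N :: nat where N: "1 < real N * (t - s)"
      using ex_less_of_nat_mult[of "t - s" 1] False by auto
    have "eventually (\<lambda>k. max 0 (min 1 (1 - real k * (t - s))) = 0) sequentially"
      using eventually_ge_at_top[of N]
    proof eventually_elim
      case (elim k)
      have "real N * (t - s) \<le> real k * (t - s)" using elim False by (intro mult_right_mono) auto
      then show ?case using N by auto
    qed
    then show ?thesis using False by (simp add: tendsto_eventually)
  qed
  have "(\<lambda>k. cutoff k J r D) \<longlonglongrightarrow> (\<Prod>p\<in>J. if D (fst p) (snd p) \<le> r p then 1 else 0)"
    unfolding cutoff_def by (intro tendsto_prod one)
  also have "(\<Prod>p\<in>J. if D (fst p) (snd p) \<le> r p then 1 else 0) = (indicator (mbox J r) D :: real)"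
  proof (cases "D \<in> mbox J r")
    case True
    then show ?thesis by (auto simp: mbox_def intro!: prod.neutral)
  next
    case False
    then obtain i j where "(i, j) \<in> J" "\<not> D i j \<le> r (i, j)" using assms(2) by (auto simp: mbox_def)
    then have "\<exists>p\<in>J. \<not> D (fst p) (snd p) \<le> r p" by (intro bexI[of _ "(i, j)"]) auto
    then show ?thesis using False assms(1) by (auto simp: prod_zero_iff)
  qed
  finally show ?thesis .
qed

lemma cutoff_measurable:
  assumes "sets \<mu> = sets M_inf_borel"
  shows "cutoff k J r \<in> borel_measurable \<mu>"
  unfolding measurable_cong_sets[OF assms refl]
  by (rule borel_measurable_continuous_on_restrict[OF continuous_on_cutoff])

lemma integral_cutoff_LIMSEQ:
  assumes "prob_space \<mu>" "sets \<mu> = sets M_inf_borel" "finite J"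
  shows "(\<lambda>k. \<integral>D. cutoff k J r D \<partial>\<mu>) \<longlonglongrightarrow> measure \<mu> (mbox J r)"
proof -
  interpret prob_space \<mu> by fact
  have sp: "space \<mu> = M_inf" using sets_eq_imp_space_eq[OF assms(2)] by (simp add: space_M_inf_borel)
  have b: "mbox J r \<in> sets \<mu>"
    using entry_measurable_M_inf_borel
    by (intro mbox_measurable assms(3)) (simp_all add: sp measurable_cong_sets[OF assms(2) refl])
  have "(\<lambda>k. \<integral>D. cutoff k J r D \<partial>\<mu>) \<longlonglongrightarrow> (\<integral>D. indicator (mbox J r) D \<partial>\<mu>)"
  proof (rule integral_dominated_convergence[where w = "\<lambda>_. 1"])
    show "AE D in \<mu>. (\<lambda>k. cutoff k J r D) \<longlonglongrightarrow> indicator (mbox J r) D"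
      using assms(3) by (intro AE_I2 cutoff_LIMSEQ) (auto simp: sp)
  qed (use b in \<open>auto simp: cutoff_bounds intro: cutoff_measurable[OF assms(2)]\<close>)
  moreover have "mbox J r \<inter> M_inf = mbox J r" by (auto simp: mbox_def)
  ultimately show ?thesis using b by (simp add: sp)
qed

section \<open>Relabelling, dissociation and triangle inequality\<close>

definition relabel :: "(nat \<Rightarrow> nat) \<Rightarrow> (nat \<Rightarrow> nat \<Rightarrow> real) \<Rightarrow> nat \<Rightarrow> nat \<Rightarrow> real" where
  "relabel \<sigma> D i j = D (\<sigma> i) (\<sigma> j)"

lemma relabel_M_inf: "D \<in> M_inf \<Longrightarrow> relabel \<sigma> D \<in> M_inf"
  by (auto simp: M_inf_def relabel_def)

lemma relabel_measurable: "relabel \<sigma> \<in> M_inf_borel \<rightarrow>\<^sub>M M_inf_borel"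
proof (rule measurable_M_inf_borelI)
  show "(\<lambda>x. relabel \<sigma> x i j) \<in> borel_measurable M_inf_borel" for i j
    unfolding relabel_def by (rule entry_measurable_M_inf_borel)
qed (simp add: space_M_inf_borel relabel_M_inf)

lemma relabel_measurable_ent:
  assumes "\<And>i j. (i, j) \<in> P' \<Longrightarrow> (\<sigma> i, \<sigma> j) \<in> P"
  shows "relabel \<sigma> \<in> ent P \<rightarrow>\<^sub>M ent P'"
proof (rule measurable_entI)
  show "(\<lambda>x. relabel \<sigma> x i j) \<in> borel_measurable (ent P)" if "(i, j) \<in> P'" for i j
    unfolding relabel_def by (rule entry_measurable[OF assms[OF that]])
qed (simp add: relabel_M_inf)

lemma continuous_on_cutoff_relabel: "continuous_on A (\<lambda>D. cutoff k J r (relabel \<sigma> D))"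
  unfolding cutoff_def relabel_def by (intro continuous_intros continuous_on_entry)

lemma bounded_unit_interval_image:
  fixes f :: "'a \<Rightarrow> real"
  assumes "\<And>x. x \<in> A \<Longrightarrow> 0 \<le> f x \<and> f x \<le> 1"
  shows "bounded (f ` A)"
  using assms by (intro boundedI[of _ 1]) auto

lemma mm_tau_prob_measures: "mm_space M d \<Longrightarrow> mm_tau M d \<in> prob_measures M_inf"
  unfolding prob_measures_def mm_tau_def
  by (auto intro!: prob_space.prob_space_distr prob_space_PiM mm_space_matrix_measurable simp: mm_space_def)

lemma integral_mm_tau:
  fixes f :: "_ \<Rightarrow> real"
  assumes "mm_space M d" "f \<in> borel_measurable M_inf_borel"
  shows "(\<integral>D. f D \<partial>mm_tau M d) = (\<integral>x. f (\<lambda>i j. d (x i) (x j)) \<partial>PiM UNIV (\<lambda>_::nat. M))"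
  unfolding mm_tau_def by (rule integral_distr[OF mm_space_matrix_measurable[OF assms(1)] assms(2)])

lemma integral_mm_tau_relabel:
  fixes f :: "_ \<Rightarrow> real"
  assumes mm: "mm_space M d" and f: "f \<in> borel_measurable M_inf_borel" and \<sigma>: "inj \<sigma>"
  shows "(\<integral>D. f (relabel \<sigma> D) \<partial>mm_tau M d) = (\<integral>D. f D \<partial>mm_tau M d)"
proof -
  let ?P = "PiM UNIV (\<lambda>_::nat. M)"
  have pM: "prob_space M" using mm by (simp add: mm_space_def)
  have \<sigma>P: "distr ?P ?P (\<lambda>x i. x (\<sigma> i)) = ?P"
    using distr_PiM_reindex[of UNIV "\<lambda>_. M" \<sigma> UNIV] pM \<sigma> by (simp add: restrict_UNIV)
  have m: "(\<lambda>x i. x (\<sigma> i)) \<in> ?P \<rightarrow>\<^sub>M ?P"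
    by (rule measurable_PiM_single') (auto simp: space_PiM)
  have g: "(\<lambda>x. f (\<lambda>i j. d (x i) (x j))) \<in> borel_measurable ?P"
    by (rule measurable_compose[OF mm_space_matrix_measurable[OF mm] f])
  have "(\<integral>D. f (relabel \<sigma> D) \<partial>mm_tau M d) = (\<integral>x. f (\<lambda>i j. d (x (\<sigma> i)) (x (\<sigma> j))) \<partial>?P)"
    by (subst integral_mm_tau[OF mm measurable_compose[OF relabel_measurable f]]) (simp add: relabel_def[abs_def])
  also have "\<dots> = (\<integral>x. f (\<lambda>i j. d (x i) (x j)) \<partial>distr ?P ?P (\<lambda>x i. x (\<sigma> i)))"
    by (rule integral_distr[OF m g, symmetric])
  also have "\<dots> = (\<integral>D. f D \<partial>mm_tau M d)"
    unfolding \<sigma>P by (rule integral_mm_tau[OF mm f, symmetric])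
  finally show ?thesis .
qed

text \<open>The two factors are functions of disjoint blocks of the independent sample
  points.\<close>

lemma integral_mm_tau_disjoint:
  assumes mm: "mm_space M d" and AB: "A \<inter> B = {}" and J: "J \<subseteq> A \<times> A" "K \<subseteq> B \<times> B"
  shows "(\<integral>D. cutoff k J r D * cutoff k K s D \<partial>mm_tau M d) =
    (\<integral>D. cutoff k J r D \<partial>mm_tau M d) * (\<integral>D. cutoff k K s D \<partial>mm_tau M d)"
proof -
  let ?P = "PiM UNIV (\<lambda>_::nat. M)"
  have pM: "prob_space M" using mm by (simp add: mm_space_def)
  interpret P: prob_space ?P by (rule prob_space_PiM) (rule pM)
  have ind: "P.indep_vars (\<lambda>_. M) (\<lambda>i x. x i) UNIV"
    by (subst P.indep_vars_iff_distr_eq_PiM') (simp_all add: distr_PiM_component[OF pM] distr_id2 restrict_UNIV)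
  have m: "(\<lambda>y. cutoff k J r (\<lambda>i j. d (y i) (y j))) \<in> borel_measurable (PiM A (\<lambda>_. M))" if "J \<subseteq> A \<times> A" for A J r
    unfolding cutoff_def
  proof (intro borel_measurable_prod borel_measurable_max borel_measurable_min borel_measurable_diff
      borel_measurable_times borel_measurable_const)
    fix p assume "p \<in> J"
    then have "fst p \<in> A" "snd p \<in> A" using that by auto
    then have "(\<lambda>y. (y (fst p), y (snd p))) \<in> PiM A (\<lambda>_. M) \<rightarrow>\<^sub>M M \<Otimes>\<^sub>M M" by measurable
    from measurable_compose[OF this mm_space_dist_measurable[OF mm]]
    show "(\<lambda>y. d (y (fst p)) (y (snd p))) \<in> borel_measurable (PiM A (\<lambda>_. M))" by simp
  qed
  have res: "cutoff k J r (\<lambda>i j. d (restrict x A i) (restrict x A j)) = cutoff k J r (\<lambda>i j. d (x i) (x j))"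
    if "J \<subseteq> A \<times> A" for A J r x
    unfolding cutoff_def using that by (intro prod.cong) auto
  have bnd: "integrable ?P (\<lambda>x. cutoff k J r (\<lambda>i j. d (x i) (x j)))" for J r
    by (rule P.integrable_of_bound[where B = 1]) (use m[of J UNIV r] in \<open>auto simp: cutoff_bounds\<close>)
  have "P.indep_var (PiM A (\<lambda>_. M)) (\<lambda>x. restrict (\<lambda>i. x i) A) (PiM B (\<lambda>_. M)) (\<lambda>x. restrict (\<lambda>i. x i) B)"
    by (rule P.indep_var_restrict[OF ind AB]) auto
  from P.indep_var_compose[OF this m[OF J(1)] m[OF J(2)]]
  have "P.indep_var borel (\<lambda>x. cutoff k J r (\<lambda>i j. d (x i) (x j))) borel (\<lambda>x. cutoff k K s (\<lambda>i j. d (x i) (x j)))"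
    by (simp only: comp_def res[OF J(1)] res[OF J(2)])
  from P.indep_var_lebesgue_integral[OF this bnd bnd]
  have "(\<integral>x. cutoff k J r (\<lambda>i j. d (x i) (x j)) * cutoff k K s (\<lambda>i j. d (x i) (x j)) \<partial>?P) =
    (\<integral>x. cutoff k J r (\<lambda>i j. d (x i) (x j)) \<partial>?P) * (\<integral>x. cutoff k K s (\<lambda>i j. d (x i) (x j)) \<partial>?P)" .
  then show ?thesis
    by (subst (1 2 3) integral_mm_tau[OF mm]) (auto intro!: borel_measurable_times cutoff_measurable)
qed

lemma tau_chiE:
  assumes "\<mu> \<in> tau_chi"
  obtains M :: "real measure" and d where "mm_space M d" "\<mu> = mm_tau M d"
  using assms unfolding tau_chi_def by blast

lemma tau_chi_topspace: "\<mu> \<in> tau_chi \<Longrightarrow> \<mu> \<in> topspace (weak_topology M_inf)"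
  by (auto elim!: tau_chiE simp: mm_tau_prob_measures)

lemma chi_closure_prob:
  assumes "\<kappa> \<in> chi_closure"
  shows "prob_space \<kappa>" "sets \<kappa> = sets M_inf_borel" "space \<kappa> = M_inf"
proof -
  have "\<kappa> \<in> prob_measures M_inf"
    using assms closure_of_subset_topspace[of "weak_topology M_inf" tau_chi] by (auto simp: chi_closure_def)
  then show "prob_space \<kappa>" and s: "sets \<kappa> = sets M_inf_borel" by (auto simp: prob_measures_def)
  show "space \<kappa> = M_inf" using sets_eq_imp_space_eq[OF s] by (simp add: space_M_inf_borel)
qed

text \<open>A relabelled cut-off is again continuous and bounded, so the difference of the two sides
  is weakly continuous; it vanishes on \<open>tau_chi\<close>.\<close>

lemma chi_closure_integral_relabel:
  assumes "\<kappa> \<in> chi_closure" "inj \<sigma>"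
  shows "(\<integral>D. cutoff k J r (relabel \<sigma> D) \<partial>\<kappa>) = (\<integral>D. cutoff k J r D \<partial>\<kappa>)"
proof -
  have "(\<integral>D. cutoff k J r (relabel \<sigma> D) \<partial>\<kappa>) - (\<integral>D. cutoff k J r D \<partial>\<kappa>) = 0"
  proof (rule closure_of_continuous_eq_0[OF assms(1)[unfolded chi_closure_def]])
    show "continuous_map (weak_topology M_inf) euclideanreal
        (\<lambda>\<kappa>. (\<integral>D. cutoff k J r (relabel \<sigma> D) \<partial>\<kappa>) - (\<integral>D. cutoff k J r D \<partial>\<kappa>))"
      by (intro continuous_map_diff continuous_map_weak_integral continuous_on_cutoff
          continuous_on_cutoff_relabel bounded_unit_interval_image) (simp_all add: cutoff_bounds)
    show "(\<integral>D. cutoff k J r (relabel \<sigma> D) \<partial>\<mu>) - (\<integral>D. cutoff k J r D \<partial>\<mu>) = 0" if "\<mu> \<in> tau_chi" for \<mu>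
      using that by (auto elim!: tau_chiE simp: integral_mm_tau_relabel[OF _ _ assms(2)] cutoff_measurable)
  qed (rule tau_chi_topspace)
  then show ?thesis by simp
qed

text \<open>As \<open>k\<close> grows, the integrals of cut-offs tend to the probabilities of boxes,
  and boxes determine the measure.\<close>

lemma chi_closure_distr_relabel:
  assumes \<kappa>: "\<kappa> \<in> chi_closure" and \<sigma>: "inj \<sigma>"
  shows "distr \<kappa> \<kappa> (relabel \<sigma>) = \<kappa>"
proof (rule measure_eqI_boxes)
  interpret prob_space \<kappa> by (rule chi_closure_prob[OF \<kappa>])
  have s: "sets \<kappa> = sets M_inf_borel" by (rule chi_closure_prob[OF \<kappa>])
  have m: "relabel \<sigma> \<in> \<kappa> \<rightarrow>\<^sub>M \<kappa>" using relabel_measurable by (simp add: measurable_cong_sets[OF s s])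
  interpret R: prob_space "distr \<kappa> \<kappa> (relabel \<sigma>)" by (rule prob_space_distr[OF m])
  show "finite_measure (distr \<kappa> \<kappa> (relabel \<sigma>))" by (rule R.finite_measure_axioms)
  show "sets (distr \<kappa> \<kappa> (relabel \<sigma>)) = sets (ent {(i, j). i < j})" by (simp add: s sets_ent_upper)
  show "sets \<kappa> = sets (ent {(i, j). i < j})" by (simp add: s sets_ent_upper)
  show "emeasure (distr \<kappa> \<kappa> (relabel \<sigma>)) (mbox J (\<lambda>p. of_rat (r p))) = emeasure \<kappa> (mbox J (\<lambda>p. of_rat (r p)))"
    if J: "finite J" for J r
  proof -
    have "(\<lambda>k. \<integral>D. cutoff k J (\<lambda>p. of_rat (r p)) D \<partial>distr \<kappa> \<kappa> (relabel \<sigma>))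
        \<longlonglongrightarrow> measure (distr \<kappa> \<kappa> (relabel \<sigma>)) (mbox J (\<lambda>p. of_rat (r p)))"
      by (rule integral_cutoff_LIMSEQ[OF R.prob_space_axioms _ J]) (simp add: s)
    moreover have "(\<integral>D. cutoff k J (\<lambda>p. of_rat (r p)) D \<partial>distr \<kappa> \<kappa> (relabel \<sigma>)) =
        (\<integral>D. cutoff k J (\<lambda>p. of_rat (r p)) D \<partial>\<kappa>)" for k
      by (subst integral_distr[OF m cutoff_measurable[OF s]]) (rule chi_closure_integral_relabel[OF \<kappa> \<sigma>])
    moreover have "(\<lambda>k. \<integral>D. cutoff k J (\<lambda>p. of_rat (r p)) D \<partial>\<kappa>) \<longlonglongrightarrow> measure \<kappa> (mbox J (\<lambda>p. of_rat (r p)))"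
      by (rule integral_cutoff_LIMSEQ[OF prob_space_axioms s J])
    ultimately have "measure (distr \<kappa> \<kappa> (relabel \<sigma>)) (mbox J (\<lambda>p. of_rat (r p))) = measure \<kappa> (mbox J (\<lambda>p. of_rat (r p)))"
      by (simp add: LIMSEQ_unique)
    then show ?thesis by (simp add: emeasure_eq_measure R.emeasure_eq_measure)
  qed
qed

text \<open>All three integrals are weakly continuous, and so is a product of two of them; hence
  factorization is a closed condition.\<close>

lemma chi_closure_integral_disjoint:
  assumes "\<kappa> \<in> chi_closure" "A \<inter> B = {}" "J \<subseteq> A \<times> A" "K \<subseteq> B \<times> B"
  shows "(\<integral>D. cutoff k J r D * cutoff k K s D \<partial>\<kappa>) = (\<integral>D. cutoff k J r D \<partial>\<kappa>) * (\<integral>D. cutoff k K s D \<partial>\<kappa>)"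
proof -
  have "(\<integral>D. cutoff k J r D * cutoff k K s D \<partial>\<kappa>) - (\<integral>D. cutoff k J r D \<partial>\<kappa>) * (\<integral>D. cutoff k K s D \<partial>\<kappa>) = 0"
  proof (rule closure_of_continuous_eq_0[OF assms(1)[unfolded chi_closure_def]])
    show "continuous_map (weak_topology M_inf) euclideanreal
        (\<lambda>\<kappa>. (\<integral>D. cutoff k J r D * cutoff k K s D \<partial>\<kappa>) - (\<integral>D. cutoff k J r D \<partial>\<kappa>) * (\<integral>D. cutoff k K s D \<partial>\<kappa>))"
      by (intro continuous_map_diff continuous_map_real_mult continuous_map_weak_integral continuous_on_mult
          continuous_on_cutoff bounded_unit_interval_image) (simp_all add: cutoff_bounds mult_le_one)
    show "(\<integral>D. cutoff k J r D * cutoff k K s D \<partial>\<mu>) - (\<integral>D. cutoff k J r D \<partial>\<mu>) * (\<integral>D. cutoff k K s D \<partial>\<mu>) = 0"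
      if "\<mu> \<in> tau_chi" for \<mu>
      using that by (auto elim!: tau_chiE simp: integral_mm_tau_disjoint[OF _ assms(2-4)])
  qed (rule tau_chi_topspace)
  then show ?thesis by simp
qed

text \<open>The limit over cut-offs gives independence of boxes. These are stable under
  intersection, so independence extends to the generated sigma-algebras.\<close>

lemma chi_closure_dissociated:
  assumes \<kappa>: "\<kappa> \<in> chi_closure" and AB: "A \<inter> B = {}"
    and E: "E \<in> sets (ent (A \<times> A))" and F: "F \<in> sets (ent (B \<times> B))"
  shows "measure \<kappa> (E \<inter> F) = measure \<kappa> E * measure \<kappa> F"
proof -
  interpret prob_space \<kappa> by (rule chi_closure_prob[OF \<kappa>])
  have s: "sets \<kappa> = sets M_inf_borel" by (rule chi_closure_prob[OF \<kappa>])
  have sp: "space \<kappa> = M_inf" by (rule chi_closure_prob[OF \<kappa>])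
  have ev: "boxes P \<subseteq> events" for P
    using ent_subset_M_inf_borel[of P] by (auto simp: s sets_ent)
  have "indep_set (boxes (A \<times> A)) (boxes (B \<times> B))"
    unfolding indep_sets2_eq
  proof (intro conjI ballI ev)
    fix a b assume "a \<in> boxes (A \<times> A)" "b \<in> boxes (B \<times> B)"
    then obtain J r K t where a: "a = mbox J (\<lambda>p. of_rat (r p))" "finite J" "J \<subseteq> A \<times> A"
      and b: "b = mbox K (\<lambda>p. of_rat (t p))" "finite K" "K \<subseteq> B \<times> B"
      by (auto simp: boxes_def)
    have ab: "a \<in> events" "b \<in> events" using ev \<open>a \<in> _\<close> \<open>b \<in> _\<close> by auto
    have l1: "(\<lambda>k. \<integral>D. cutoff k J (\<lambda>p. of_rat (r p)) D * cutoff k K (\<lambda>p. of_rat (t p)) D \<partial>\<kappa>)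
      \<longlonglongrightarrow> (\<integral>D. indicator a D * indicator b D \<partial>\<kappa>)"
    proof (rule integral_dominated_convergence[where w = "\<lambda>_. 1"])
      show "AE D in \<kappa>. (\<lambda>k. cutoff k J (\<lambda>p. of_rat (r p)) D * cutoff k K (\<lambda>p. of_rat (t p)) D)
          \<longlonglongrightarrow> indicator a D * indicator b D"
        unfolding a(1) b(1) using a(2) b(2) by (intro AE_I2 tendsto_mult cutoff_LIMSEQ) (auto simp: sp)
      show "AE D in \<kappa>. norm (cutoff k J (\<lambda>p. of_rat (r p)) D * cutoff k K (\<lambda>p. of_rat (t p)) D) \<le> 1" for k
        by (intro AE_I2) (simp add: abs_mult cutoff_bounds mult_le_one)
    qed (use ab in \<open>auto intro!: borel_measurable_times cutoff_measurable[OF s]\<close>)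
    have l2: "(\<lambda>k. \<integral>D. cutoff k J (\<lambda>p. of_rat (r p)) D * cutoff k K (\<lambda>p. of_rat (t p)) D \<partial>\<kappa>)
      \<longlonglongrightarrow> measure \<kappa> a * measure \<kappa> b"
      unfolding chi_closure_integral_disjoint[OF \<kappa> AB a(3) b(3)] a(1) b(1)
      by (intro tendsto_mult integral_cutoff_LIMSEQ prob_space_axioms s a b)
    have "(\<integral>D. indicator a D * indicator b D \<partial>\<kappa>) = prob (a \<inter> b)"
      using ab by (simp add: indicator_inter_arith[symmetric] sets.Int Int_absorb2 sets.sets_into_space)
    with LIMSEQ_unique[OF l1 l2] show "prob (a \<inter> b) = prob a * prob b" by simp
  qed
  from indep_set_sigma_sets[OF this Int_stable_boxes Int_stable_boxes]
  have "indep_set (sets (ent (A \<times> A))) (sets (ent (B \<times> B)))" by (simp add: sets_ent sp)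
  then show ?thesis using E F by (rule indep_setD)
qed

text \<open>The excess over the triangle inequality is a bounded continuous function of the matrix.
  Its integral is zero on \<open>tau_chi\<close>, hence on the closure, and being nonnegative it
  vanishes almost surely.\<close>

lemma chi_closure_triangle:
  assumes \<kappa>: "\<kappa> \<in> chi_closure"
  shows "AE D in \<kappa>. D i k \<le> D i j + D j k"
proof -
  interpret prob_space \<kappa> by (rule chi_closure_prob[OF \<kappa>])
  have s: "sets \<kappa> = sets M_inf_borel" by (rule chi_closure_prob[OF \<kappa>])
  let ?f = "\<lambda>D :: nat \<Rightarrow> nat \<Rightarrow> real. max 0 (D i k - D i j - D j k)"
  have c: "continuous_on M_inf ?f" by (intro continuous_intros continuous_on_entry)
  have b: "0 \<le> ?f D \<and> ?f D \<le> 1" if "D \<in> M_inf" for D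
  proof -
    have "D i k \<le> 1" "0 \<le> D i j" "0 \<le> D j k" using that by (auto simp: M_inf_def)
    then show ?thesis by auto
  qed
  have m: "?f \<in> borel_measurable M_inf_borel" by (rule borel_measurable_continuous_on_restrict[OF c])
  have "(\<integral>D. ?f D \<partial>\<kappa>) = 0"
  proof (rule closure_of_continuous_eq_0[OF assms(1)[unfolded chi_closure_def]])
    show "continuous_map (weak_topology M_inf) euclideanreal (\<lambda>\<kappa>. \<integral>D. ?f D \<partial>\<kappa>)"
      by (intro continuous_map_weak_integral c bounded_unit_interval_image b)
    show "(\<integral>D. ?f D \<partial>\<mu>) = 0" if "\<mu> \<in> tau_chi" for \<mu>
    proof -
      obtain M :: "real measure" and d where mm: "mm_space M d" and \<mu>: "\<mu> = mm_tau M d"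
        using \<open>\<mu> \<in> tau_chi\<close> by (rule tau_chiE)
      interpret Metric_space "space M" d using mm by (simp add: mm_space_def)
      have "(\<integral>D. ?f D \<partial>\<mu>) = (\<integral>x. max 0 (d (x i) (x k) - d (x i) (x j) - d (x j) (x k)) \<partial>PiM UNIV (\<lambda>_::nat. M))"
        unfolding \<mu> by (rule integral_mm_tau[OF mm m])
      also have "\<dots> = (\<integral>x. 0 \<partial>PiM UNIV (\<lambda>_::nat. M))"
      proof (rule Bochner_Integration.integral_cong[OF refl])
        fix x assume "x \<in> space (PiM UNIV (\<lambda>_::nat. M))"
        then have "x i \<in> space M" "x j \<in> space M" "x k \<in> space M" by (auto simp: space_PiM PiE_iff)
        then have "d (x i) (x k) \<le> d (x i) (x j) + d (x j) (x k)" by (rule triangle)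
        then show "max 0 (d (x i) (x k) - d (x i) (x j) - d (x j) (x k)) = 0" by simp
      qed
      finally show ?thesis by simp
    qed
  qed (rule tau_chi_topspace)
  moreover have "integrable \<kappa> ?f"
    by (rule integrable_of_bound[where B = 1]) (use m b in \<open>auto simp: measurable_cong_sets[OF s refl] chi_closure_prob[OF \<kappa>]\<close>)
  ultimately have "AE D in \<kappa>. ?f D = 0"
    by (subst (asm) integral_nonneg_eq_0_iff_AE) auto
  then show ?thesis by eventually_elim (simp add: max_def split: if_splits)
qed

section \<open>The shell\<close>

text \<open>Each digit answers one comparison of one coordinate with one rational number; all
  answers together determine the sequence.\<close>

definition bit_of :: "(nat \<Rightarrow> real) \<Rightarrow> nat \<Rightarrow> real" where
  "bit_of y n = (case prod_decode n of (m, k) \<Rightarrow> of_bool (y m \<le> of_rat (from_nat k)))"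

text \<open>A sequence of reals is recorded by the base 4 digits in \<open>{0, 1}\<close> of one real number; base 4
  keeps the tail of the expansion below one unit of the preceding digit.\<close>

definition code_trunc :: "nat \<Rightarrow> (nat \<Rightarrow> real) \<Rightarrow> real" where
  "code_trunc k y = (\<Sum>n<k. bit_of y n / 4 ^ Suc n)"

definition code :: "(nat \<Rightarrow> real) \<Rightarrow> real" where
  "code y = (\<Sum>n. bit_of y n / 4 ^ Suc n)"

lemma bit_of_cases: "bit_of y n = 0 \<or> bit_of y n = 1"
  by (auto simp: bit_of_def split: prod.splits)

lemma bit_of_bounds: "0 \<le> bit_of y n" "bit_of y n \<le> 1"
  using bit_of_cases[of y n] by auto

lemma summable_quarter: "summable (\<lambda>n. 1 / 4 ^ Suc n :: real)" and suminf_quarter: "(\<Sum>n. 1 / 4 ^ Suc n :: real) = 1 / 3"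
proof -
  have "(\<lambda>n. (1 / 4) * (1 / 4 :: real) ^ n) sums ((1 / 4) * (1 / (1 - 1 / 4)))"
    by (intro sums_mult geometric_sums) auto
  then have "(\<lambda>n. 1 / 4 ^ Suc n :: real) sums (1 / 3)"
    by (simp add: power_divide field_simps)
  then show "summable (\<lambda>n. 1 / 4 ^ Suc n :: real)" "(\<Sum>n. 1 / 4 ^ Suc n :: real) = 1 / 3"
    by (auto simp: sums_iff)
qed

lemma summable_bits: "summable (\<lambda>n. bit_of y (n + k) / 4 ^ Suc n)"
  by (rule summable_comparison_test'[OF summable_quarter, of 0])
    (auto simp: divide_right_mono bit_of_bounds)

lemma bits_tail: "0 \<le> (\<Sum>n. bit_of y (n + k) / 4 ^ Suc n)" "(\<Sum>n. bit_of y (n + k) / 4 ^ Suc n) \<le> 1 / 3"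
proof -
  show "0 \<le> (\<Sum>n. bit_of y (n + k) / 4 ^ Suc n)"
    by (rule suminf_nonneg[OF summable_bits]) (simp add: bit_of_bounds)
  have "(\<Sum>n. bit_of y (n + k) / 4 ^ Suc n) \<le> (\<Sum>n. 1 / 4 ^ Suc n)"
    by (rule suminf_le[OF _ summable_bits summable_quarter]) (simp add: divide_right_mono bit_of_bounds)
  then show "(\<Sum>n. bit_of y (n + k) / 4 ^ Suc n) \<le> 1 / 3" by (simp only: suminf_quarter)
qed

lemma code_bounds: "0 \<le> code y \<and> code y \<le> 1"
  using bits_tail[of y 0] by (auto simp: code_def)

lemma code_trunc_LIMSEQ: "(\<lambda>k. code_trunc k y) \<longlonglongrightarrow> code y"
  unfolding code_trunc_def code_def using summable_LIMSEQ[OF summable_bits[of y 0]] by simp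

lemma code_trunc_mono: "code_trunc k y \<le> code_trunc (Suc k) y"
  unfolding code_trunc_def by (simp add: bit_of_bounds)

text \<open>The truncations increase to the code. This is why the indicator of \<open>{..r}\<close>,
  although discontinuous, passes to the limit along the truncations.\<close>

lemma code_trunc_le_iff: "code y \<le> r \<longleftrightarrow> (\<forall>k. code_trunc k y \<le> r)"
proof
  assume "code y \<le> r"
  moreover have "code_trunc k y \<le> code y" for k
    by (rule incseq_le[OF _ code_trunc_LIMSEQ]) (rule incseq_SucI, rule code_trunc_mono)
  ultimately show "\<forall>k. code_trunc k y \<le> r" by (auto intro: order_trans)
next
  assume "\<forall>k. code_trunc k y \<le> r"
  then show "code y \<le> r" by (intro LIMSEQ_le_const2[OF code_trunc_LIMSEQ]) auto
qed

text \<open>\<open>prod_encode (m, l)\<close> is at least \<open>m\<close>, so the digits below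
  \<open>k\<close> refer only to coordinates below \<open>k\<close>.\<close>

lemma code_trunc_cong:
  assumes "\<And>m. m < k \<Longrightarrow> y m = y' m"
  shows "code_trunc k y = code_trunc k y'"
  unfolding code_trunc_def
proof (rule sum.cong[OF refl])
  fix n assume n: "n \<in> {..<k}"
  obtain m l where ml: "prod_decode n = (m, l)" by (cases "prod_decode n")
  have "m \<le> prod_encode (m, l)" by (rule le_prod_encode_1)
  then have "m < k" using n ml by (metis lessThan_iff order_le_less_trans prod_decode_inverse)
  then show "bit_of y n / 4 ^ Suc n = bit_of y' n / 4 ^ Suc n" using assms by (simp add: bit_of_def ml)
qed

text \<open>Multiplying by \<open>4 ^ n\<close> moves the earlier digits into the integer part and
  leaves the fractional part \<open>(b n + t) / 4\<close> with \<open>t\<close> between 0 and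
  \<open>1 / 3\<close>. For digit 0 this is at most \<open>1 / 12\<close>, for digit 1 at least
  \<open>1 / 4\<close> and still below 1.\<close>

lemma bit_of_code: "bit_of y n = 1 \<longleftrightarrow> 1 / 4 \<le> frac (4 ^ n * code y)"
proof -
  define b where "b = bit_of y"
  define t where "t = (\<Sum>m. b (m + Suc n) / 4 ^ Suc m)"
  have "code y = (\<Sum>m. b (m + Suc n) / 4 ^ Suc (m + Suc n)) + (\<Sum>m<Suc n. b m / 4 ^ Suc m)"
    unfolding code_def b_def[symmetric]
    using suminf_split_initial_segment[OF summable_bits[of y 0], of "Suc n"] by (simp add: b_def)
  also have "(\<Sum>m. b (m + Suc n) / 4 ^ Suc (m + Suc n)) = (\<Sum>m. (1 / 4 ^ Suc n) * (b (m + Suc n) / 4 ^ Suc m))"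
    by (intro suminf_cong) (simp add: power_add field_simps)
  also have "\<dots> = t / 4 ^ Suc n"
    unfolding t_def b_def by (subst suminf_mult[OF summable_bits]) simp
  finally have c: "4 ^ n * code y = (\<Sum>m<n. b m * 4 ^ (n - Suc m)) + (b n + t) / 4"
  proof -
    assume e: "code y = t / 4 ^ Suc n + (\<Sum>m<Suc n. b m / 4 ^ Suc m)"
    have "4 ^ n * (\<Sum>m<n. b m / 4 ^ Suc m) = (\<Sum>m<n. b m * 4 ^ (n - Suc m))"
      unfolding sum_distrib_left
    proof (rule sum.cong[OF refl])
      fix m assume "m \<in> {..<n}"
      then have "(4 :: real) ^ n = 4 ^ (n - Suc m) * 4 ^ Suc m" by (simp add: power_add[symmetric] del: power_Suc)
      then show "4 ^ n * (b m / 4 ^ Suc m) = b m * 4 ^ (n - Suc m)" by simp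
    qed
    then show ?thesis unfolding e by (simp add: field_simps)
  qed
  have "b m * 4 ^ (n - Suc m) \<in> \<int>" for m
    using bit_of_cases[of y m] by (auto simp: b_def)
  then have "(\<Sum>m<n. b m * 4 ^ (n - Suc m)) \<in> \<int>" by (intro Ints_sum)
  moreover have t: "0 \<le> t" "t \<le> 1 / 3" unfolding t_def b_def by (rule bits_tail)+
  moreover have "0 \<le> b n" "b n \<le> 1" by (simp_all add: b_def bit_of_bounds)
  ultimately have "frac (4 ^ n * code y) = (b n + t) / 4"
    unfolding c by (subst frac_unique_iff) auto
  then show ?thesis using t bit_of_cases[of y n] by (auto simp: b_def)
qed

lemma code_measurable:
  assumes "\<And>m. (\<lambda>x. y x m) \<in> borel_measurable N"
  shows "(\<lambda>x. code (y x)) \<in> borel_measurable N"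
    and "(\<lambda>x. code_trunc k (y x)) \<in> borel_measurable N"
proof -
  have [measurable]: "(\<lambda>x. bit_of (y x) n) \<in> borel_measurable N" for n
  proof -
    obtain m l where ml: "prod_decode n = (m, l)" by (cases "prod_decode n")
    note [measurable] = assms
    show ?thesis unfolding bit_of_def ml by simp
  qed
  show "(\<lambda>x. code (y x)) \<in> borel_measurable N" unfolding code_def by measurable
  show "(\<lambda>x. code_trunc k (y x)) \<in> borel_measurable N" unfolding code_trunc_def by measurable
qed

text \<open>The digits are measurable functions of the code, and they decide all rational
  comparisons. Hence code and sequence generate the same sigma-algebra.\<close>

lemma decode_measurable:
  assumes [measurable]: "(\<lambda>x. code (y x)) \<in> borel_measurable N"
  shows "(\<lambda>x. y x m) \<in> borel_measurable N"
  unfolding borel_measurable_iff_le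
proof
  fix a :: real
  have bit: "y x m \<le> of_rat q \<longleftrightarrow> 1 / 4 \<le> frac (4 ^ prod_encode (m, to_nat q) * code (y x))" for x q
    unfolding bit_of_code[symmetric] by (simp add: bit_of_def)
  have "{x \<in> space N. y x m \<le> a} =
      (\<Inter>q\<in>{q. a < of_rat q}. {x \<in> space N. 1 / 4 \<le> frac (4 ^ prod_encode (m, to_nat q) * code (y x))})"
    unfolding bit[symmetric]
  proof (intro equalityI subsetI)
    fix x assume x: "x \<in> (\<Inter>q\<in>{q. a < of_rat q}. {x \<in> space N. y x m \<le> of_rat q})"
    obtain q\<^sub>0 where "a < of_rat q\<^sub>0" using of_rat_dense[of a "a + 1"] by auto
    then have "x \<in> space N" using x by blast
    have "y x m \<le> a"
    proof (rule ccontr)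
      assume "\<not> y x m \<le> a"
      then obtain q where "a < of_rat q" "of_rat q < y x m" using of_rat_dense[of a "y x m"] by auto
      then show False using x by fastforce
    qed
    then show "x \<in> {x \<in> space N. y x m \<le> a}" using \<open>x \<in> space N\<close> by simp
  next
    fix x assume "x \<in> {x \<in> space N. y x m \<le> a}"
    then show "x \<in> (\<Inter>q\<in>{q. a < of_rat q}. {x \<in> space N. y x m \<le> of_rat q})" by fastforce
  qed
  also have "\<dots> \<in> sets N"
  proof (rule sets.countable_INT')
    obtain q where "a < of_rat q" using of_rat_dense[of a "a + 1"] by auto
    then show "{q. a < real_of_rat q} \<noteq> {}" by auto
    show "(\<lambda>q. {x \<in> space N. 1 / 4 \<le> frac (4 ^ prod_encode (m, to_nat q) * code (y x))}) ` {q. a < of_rat q} \<subseteq> sets N"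
    proof (rule image_subsetI)
      show "{x \<in> space N. 1 / 4 \<le> frac (4 ^ prod_encode (m, to_nat q) * code (y x))} \<in> sets N" for q :: rat
        unfolding frac_def by measurable
    qed
  qed simp
  finally show "{x \<in> space N. y x m \<le> a} \<in> sets N" .
qed

text \<open>Odd indices form the shell, even indices are the sampled points.\<close>

definition shell :: "(nat \<Rightarrow> nat \<Rightarrow> real) \<Rightarrow> real" where
  "shell D = code (\<lambda>n. D (2 * fst (prod_decode n) + 1) (2 * snd (prod_decode n) + 1))"

definition shell_row :: "nat \<Rightarrow> (nat \<Rightarrow> nat \<Rightarrow> real) \<Rightarrow> real" where
  "shell_row i D = code (\<lambda>a. D (2 * i) (2 * a + 1))"

lemma shell_measurable_iff:
  "shell \<in> borel_measurable N \<longleftrightarrow> (\<forall>a b. (\<lambda>D. D (2 * a + 1) (2 * b + 1)) \<in> borel_measurable N)"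
proof
  assume "shell \<in> borel_measurable N"
  then have "(\<lambda>D. code (\<lambda>n. D (2 * fst (prod_decode n) + 1) (2 * snd (prod_decode n) + 1))) \<in> borel_measurable N"
    by (simp add: shell_def[abs_def])
  note m = decode_measurable[OF this]
  show "\<forall>a b. (\<lambda>D. D (2 * a + 1) (2 * b + 1)) \<in> borel_measurable N"
  proof (intro allI)
    fix a b
    show "(\<lambda>D. D (2 * a + 1) (2 * b + 1)) \<in> borel_measurable N"
      using m[of "prod_encode (a, b)"] by simp
  qed
next
  assume "\<forall>a b. (\<lambda>D. D (2 * a + 1) (2 * b + 1)) \<in> borel_measurable N"
  then show "shell \<in> borel_measurable N"
    unfolding shell_def[abs_def] by (intro code_measurable(1)) simp
qed

lemma shell_row_measurable_iff:
  "shell_row i \<in> borel_measurable N \<longleftrightarrow> (\<forall>a. (\<lambda>D. D (2 * i) (2 * a + 1)) \<in> borel_measurable N)"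
proof
  assume "shell_row i \<in> borel_measurable N"
  then have "(\<lambda>D. code (\<lambda>a. D (2 * i) (2 * a + 1))) \<in> borel_measurable N"
    by (simp add: shell_row_def[abs_def])
  from decode_measurable[OF this]
  show "\<forall>a. (\<lambda>D. D (2 * i) (2 * a + 1)) \<in> borel_measurable N" by blast
next
  assume "\<forall>a. (\<lambda>D. D (2 * i) (2 * a + 1)) \<in> borel_measurable N"
  then show "shell_row i \<in> borel_measurable N"
    unfolding shell_row_def[abs_def] by (intro code_measurable(1)) simp
qed

lemma shell_row_bounds: "0 \<le> shell_row i D \<and> shell_row i D \<le> 1"
  unfolding shell_row_def by (rule code_bounds)

text \<open>Measurability of the identity expresses that \<open>N\<close> is coarser than the
  sigma-algebra pulled back along \<open>f\<close>, whose members are preimages by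
  construction.\<close>

lemma vimage_algebra_measurableD:
  assumes "(\<lambda>x. x) \<in> vimage_algebra X f S \<rightarrow>\<^sub>M N" "f \<in> X \<rightarrow> space S" "space N = X" "A \<in> sets N"
  obtains E where "E \<in> sets S" "A = {x \<in> X. f x \<in> E}"
proof -
  have "(\<lambda>x. x) -` A \<inter> space (vimage_algebra X f S) \<in> sets (vimage_algebra X f S)"
    by (rule measurable_sets[OF assms(1,4)])
  then have "A \<inter> X \<in> sets (vimage_algebra X f S)" by simp
  then obtain E where "E \<in> sets S" "A \<inter> X = f -` E \<inter> X"
    by (auto simp: sets_vimage_algebra2[OF assms(2)])
  moreover have "A \<subseteq> X" using sets.sets_into_space[OF assms(4)] assms(3) by simp
  ultimately show thesis by (intro that[of E]) auto
qed

lemma entry_swap: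
  assumes "space N = M_inf" "(\<lambda>D. D j i) \<in> borel_measurable N"
  shows "(\<lambda>D. D i j) \<in> borel_measurable N"
proof -
  have "D i j = D j i" if "D \<in> space N" for D using that by (auto simp: assms(1) M_inf_def)
  then have "(\<lambda>D. D i j) \<in> borel_measurable N \<longleftrightarrow> (\<lambda>D. D j i) \<in> borel_measurable N"
    by (intro measurable_cong)
  then show ?thesis using assms(2) by simp
qed

lemma entry_diag:
  assumes "space N = M_inf"
  shows "(\<lambda>D. D i i) \<in> borel_measurable N"
proof -
  have "D i i = 0" if "D \<in> space N" for D using that by (auto simp: assms(1) M_inf_def)
  then have "(\<lambda>D. D i i) \<in> borel_measurable N \<longleftrightarrow> (\<lambda>D. 0 :: real) \<in> borel_measurable N"
    by (intro measurable_cong)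
  then show ?thesis by simp
qed

section \<open>Relabelling of the points, and index sets around a point or a pair\<close>

definition relabel_points :: "(nat \<Rightarrow> nat) \<Rightarrow> nat \<Rightarrow> nat" where
  "relabel_points \<pi> n = (if even n then 2 * \<pi> (n div 2) else n)"

lemma inj_relabel_points: "inj \<pi> \<Longrightarrow> inj (relabel_points \<pi>)"
proof (rule injI)
  fix a b assume \<pi>: "inj \<pi>" and e: "relabel_points \<pi> a = relabel_points \<pi> b"
  have ev: "even (relabel_points \<pi> n) \<longleftrightarrow> even n" for n by (simp add: relabel_points_def)
  show "a = b"
  proof (cases "even a")
    case True
    then have "even b" using e ev by metis
    with True e have "\<pi> (a div 2) = \<pi> (b div 2)" by (simp add: relabel_points_def)
    then have "a div 2 = b div 2" using \<pi> by (simp add: inj_eq)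
    then show ?thesis using True \<open>even b\<close> by (metis even_two_times_div_two)
  next
    case False
    then have "odd b" using e ev by metis
    then show ?thesis using False e by (simp add: relabel_points_def)
  qed
qed

lemma relabel_points_simps:
  "shell (relabel (relabel_points \<pi>) D) = shell D"
  "shell_row i (relabel (relabel_points \<pi>) D) = shell_row (\<pi> i) D"
  "relabel (relabel_points \<pi>) D (2 * i) (2 * j) = D (2 * \<pi> i) (2 * \<pi> j)"
  by (simp_all add: shell_def shell_row_def relabel_def relabel_points_def)

lemma ex_inj_two_values:
  assumes "i \<noteq> j"
  obtains \<pi> :: "nat \<Rightarrow> nat" where "inj \<pi>" "\<pi> 0 = i" "\<pi> 1 = j"
proof
  show "inj (\<lambda>n. if n = 0 then i else if n = 1 then j else n + i + j)"
    using assms by (auto simp: inj_on_def)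
qed auto

definition pair_obs :: "nat \<Rightarrow> nat \<Rightarrow> (nat \<Rightarrow> nat \<Rightarrow> real) \<Rightarrow> (real \<times> real) \<times> real" where
  "pair_obs i j D = ((shell D, shell_row i D), shell_row j D)"

abbreviation pair_alg :: "((real \<times> real) \<times> real) measure" where
  "pair_alg \<equiv> (borel \<Otimes>\<^sub>M borel) \<Otimes>\<^sub>M borel"

text \<open>Unordered pairs are compared so that both copies of the symmetric entry are left
  out.\<close>

definition off_pair :: "nat \<Rightarrow> nat \<Rightarrow> (nat \<times> nat) set" where
  "off_pair i j = {(a, b). {a, b} \<noteq> {2 * i, 2 * j}}"

text \<open>Entries among the shell and the two points, except their mutual distance: up to symmetry
  and the diagonal, exactly what \<open>pair_obs i j\<close> encodes.\<close>

definition around_pair :: "nat \<Rightarrow> nat \<Rightarrow> (nat \<times> nat) set" where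
  "around_pair i j = {(a, b). (odd a \<or> a = 2 * i \<or> a = 2 * j) \<and> (odd b \<or> b = 2 * i \<or> b = 2 * j)} \<inter> off_pair i j"

definition off_point :: "nat \<Rightarrow> (nat \<times> nat) set" where
  "off_point i = {(a, b). a \<noteq> 2 * i \<and> b \<noteq> 2 * i}"

definition odd_pairs :: "(nat \<times> nat) set" where
  "odd_pairs = {(a, b). odd a \<and> odd b}"

lemma shell_measurable_ent: "odd_pairs \<subseteq> P \<Longrightarrow> shell \<in> borel_measurable (ent P)"
  unfolding shell_measurable_iff by (intro allI entry_measurable) (auto simp: odd_pairs_def)

lemma shell_row_measurable_ent: "(\<And>a. (2 * i, 2 * a + 1) \<in> P) \<Longrightarrow> shell_row i \<in> borel_measurable (ent P)"
  unfolding shell_row_measurable_iff by (intro allI entry_measurable)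

lemma odd_pairs_subset: "odd_pairs \<subseteq> around_pair i j" "odd_pairs \<subseteq> off_pair i j" "odd_pairs \<subseteq> off_point i"
  by (auto simp: odd_pairs_def around_pair_def off_pair_def off_point_def doubleton_eq_iff)

lemma shell_row_off_pair: "shell_row k \<in> borel_measurable (ent (off_pair i j))"
  by (rule shell_row_measurable_ent)
    (auto simp: off_pair_def doubleton_eq_iff Suc_double_not_eq_double)

lemma pair_obs_around_pair: "pair_obs i j \<in> ent (around_pair i j) \<rightarrow>\<^sub>M pair_alg"
proof -
  note [measurable] = shell_measurable_ent[OF odd_pairs_subset(1)]
  have [measurable]: "shell_row i \<in> borel_measurable (ent (around_pair i j))"
    "shell_row j \<in> borel_measurable (ent (around_pair i j))"
    by (auto intro!: shell_row_measurable_ent simp: around_pair_def off_pair_def doubleton_eq_iff Suc_double_not_eq_double)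
  show ?thesis unfolding pair_obs_def[abs_def] by measurable
qed

text \<open>Conditioning takes place on a sigma-algebra of entries, while the kernels are functions
  of \<open>pair_obs\<close>. Decoding, together with symmetry and the diagonal, shows that the
  observation loses nothing.\<close>

lemma around_pair_setsE:
  assumes "A \<in> sets (ent (around_pair i j))"
  obtains E where "E \<in> sets pair_alg" "A = {D \<in> M_inf. pair_obs i j D \<in> E}"
proof (rule vimage_algebra_measurableD[OF _ _ space_ent assms])
  let ?N = "vimage_algebra M_inf (pair_obs i j) pair_alg"
  have sN: "space ?N = M_inf" by simp
  have "pair_obs i j \<in> ?N \<rightarrow>\<^sub>M pair_alg" by (rule measurable_vimage_algebra1) (simp add: space_pair_measure)
  note p = measurable_compose[OF this measurable_fst] and rj = measurable_compose[OF this measurable_snd]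
  note sh = measurable_compose[OF p measurable_fst] and ri = measurable_compose[OF p measurable_snd]
  have o: "(\<lambda>D. D a b) \<in> borel_measurable ?N" if "odd a" "odd b" for a b
    using sh that by (auto simp: pair_obs_def shell_measurable_iff elim!: oddE)
  have i: "(\<lambda>D. D (2 * i) b) \<in> borel_measurable ?N" if "odd b" for b
    using ri that by (auto simp: pair_obs_def shell_row_measurable_iff elim!: oddE)
  have j: "(\<lambda>D. D (2 * j) b) \<in> borel_measurable ?N" if "odd b" for b
    using rj that by (auto simp: pair_obs_def shell_row_measurable_iff elim!: oddE)
  note sw = entry_swap[OF sN]
  show "(\<lambda>x. x) \<in> ?N \<rightarrow>\<^sub>M ent (around_pair i j)"
  proof (rule measurable_entI)
    fix a b assume ab: "(a, b) \<in> around_pair i j"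
    then consider "odd a" "odd b" | "odd b" "a = 2 * i" | "odd b" "a = 2 * j" | "odd a" "b = 2 * i"
      | "odd a" "b = 2 * j" | "a = b"
      by (auto simp: around_pair_def off_pair_def doubleton_eq_iff)
    then show "(\<lambda>x. x a b) \<in> borel_measurable ?N"
      by cases (auto intro: o i j sw[OF i] sw[OF j] entry_diag[OF sN])
  qed simp
qed (auto simp: space_pair_measure)

lemma odd_pairs_setsE:
  assumes "A \<in> sets (ent odd_pairs)"
  obtains E where "E \<in> sets borel" "A = {D \<in> M_inf. shell D \<in> E}"
proof (rule vimage_algebra_measurableD[OF _ _ space_ent assms])
  have "shell \<in> borel_measurable (vimage_algebra M_inf shell borel)" by (rule measurable_vimage_algebra1) simp
  then have "(\<lambda>D. D a b) \<in> borel_measurable (vimage_algebra M_inf shell borel)" if "odd a" "odd b" for a b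
    using that by (auto simp: shell_measurable_iff elim!: oddE)
  then show "(\<lambda>x. x) \<in> vimage_algebra M_inf shell borel \<rightarrow>\<^sub>M ent odd_pairs"
    by (intro measurable_entI) (auto simp: odd_pairs_def)
qed auto

section \<open>Conditioning on the shell\<close>

locale closure_array =
  fixes \<kappa> :: "(nat \<Rightarrow> nat \<Rightarrow> real) measure"
  assumes in_closure: "\<kappa> \<in> chi_closure"

sublocale closure_array \<subseteq> prob_space \<kappa>
  by (rule chi_closure_prob(1)[OF in_closure])

context closure_array
begin

lemma sets_eq: "sets \<kappa> = sets M_inf_borel"
  by (rule chi_closure_prob[OF in_closure])

lemma space_eq: "space \<kappa> = M_inf"
  by (rule chi_closure_prob[OF in_closure])

lemma subalgebra_ent: "subalgebra \<kappa> (ent P)"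
  using ent_subset_M_inf_borel[of P] by (simp add: subalgebra_def space_eq sets_eq)

lemma subalgebra_ent_ent: "P \<subseteq> Q \<Longrightarrow> subalgebra (ent Q) (ent P)"
  using ent_mono[of P Q] by (simp add: subalgebra_def)

lemma measurable_ent: "f \<in> ent P \<rightarrow>\<^sub>M N \<Longrightarrow> f \<in> \<kappa> \<rightarrow>\<^sub>M N"
  by (rule measurable_from_subalg[OF subalgebra_ent])

lemma shell_measurable: "shell \<in> borel_measurable \<kappa>"
  by (rule measurable_ent[OF shell_measurable_ent[of UNIV]]) simp

lemma shell_row_measurable: "shell_row i \<in> borel_measurable \<kappa>"
  by (rule measurable_ent[OF shell_row_measurable_ent[of _ UNIV]]) simp

lemma pair_obs_measurable: "pair_obs i j \<in> \<kappa> \<rightarrow>\<^sub>M pair_alg"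
  by (rule measurable_ent[OF pair_obs_around_pair])

lemma entry_measurable_kappa: "(\<lambda>D. D i j) \<in> borel_measurable \<kappa>"
  by (rule measurable_ent[OF entry_measurable[of _ _ UNIV]]) simp

lemma relabel_measurable_kappa: "relabel \<sigma> \<in> \<kappa> \<rightarrow>\<^sub>M \<kappa>"
  using relabel_measurable by (simp add: measurable_cong_sets[OF sets_eq sets_eq])

lemma distr_relabel: "inj \<sigma> \<Longrightarrow> distr \<kappa> \<kappa> (relabel \<sigma>) = \<kappa>"
  by (rule chi_closure_distr_relabel[OF in_closure])

lemma integral_relabel:
  fixes f :: "_ \<Rightarrow> real"
  assumes "inj \<sigma>" "f \<in> borel_measurable \<kappa>"
  shows "(\<integral>D. f (relabel \<sigma> D) \<partial>\<kappa>) = (\<integral>D. f D \<partial>\<kappa>)"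
  using integral_distr[OF relabel_measurable_kappa[of \<sigma>] assms(2)]
  unfolding distr_relabel[OF assms(1)] by (rule sym)

text \<open>One \<open>\<psi>\<close> has to serve all pairs. It is built for the points 0 and 1,
  that is, for the entry at 0 and 2; relabelling the points keeps the shell and the law, and carries
  the identity to any \<open>i \<noteq> j\<close>.\<close>

lemma pair_kernel:
  obtains \<psi> :: "(real \<times> real) \<times> real \<Rightarrow> real \<Rightarrow> real"
  where "(\<lambda>(s, u). \<psi> s u) \<in> borel_measurable (pair_alg \<Otimes>\<^sub>M borel)"
    and "\<And>s u. 0 \<le> \<psi> s u \<and> \<psi> s u \<le> 1"
    and "\<And>i j A r. i \<noteq> j \<Longrightarrow> A \<in> sets pair_alg \<Longrightarrow>
      (\<integral>D. indicator {..r} (D (2 * i) (2 * j)) * indicator A (pair_obs i j D) \<partial>\<kappa>) =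
      (\<integral>D. measure unif {u. \<psi> (pair_obs i j D) u \<in> {..r}} * indicator A (pair_obs i j D) \<partial>\<kappa>)"
proof (rule noise_outsourcing[where X = "pair_obs 0 1" and Y = "\<lambda>D. D 0 2", OF pair_obs_measurable entry_measurable_kappa])
  show "0 \<le> D 0 2 \<and> D 0 2 \<le> 1" if "D \<in> space \<kappa>" for D
    using that by (auto simp: space_eq M_inf_def)
  fix \<psi> assume m: "(\<lambda>(s, u). \<psi> s u) \<in> borel_measurable (pair_alg \<Otimes>\<^sub>M borel)"
    and b: "\<And>s u. 0 \<le> \<psi> s u \<and> \<psi> s u \<le> 1"
    and *: "\<And>A B. A \<in> sets pair_alg \<Longrightarrow> B \<in> sets borel \<Longrightarrow>
      (\<integral>D. indicator B (D 0 2) * indicator A (pair_obs 0 1 D) \<partial>\<kappa>) =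
      (\<integral>D. measure unif {u. \<psi> (pair_obs 0 1 D) u \<in> B} * indicator A (pair_obs 0 1 D) \<partial>\<kappa>)"
  show thesis
  proof (rule that[OF m b])
    fix i j :: nat and A and r :: real assume "i \<noteq> j" and A [measurable]: "A \<in> sets pair_alg"
    obtain \<pi> :: "nat \<Rightarrow> nat" where \<pi>: "inj \<pi>" "\<pi> 0 = i" "\<pi> 1 = j"
      using ex_inj_two_values[OF \<open>i \<noteq> j\<close>] by blast
    note inj = inj_relabel_points[OF \<pi>(1)]
    have B: "{..r} \<in> sets borel" by simp
    have rl: "pair_obs 0 1 (relabel (relabel_points \<pi>) D) = pair_obs i j D" for D
      unfolding pair_obs_def relabel_points_simps \<pi> ..
    have rl': "relabel (relabel_points \<pi>) D 0 2 = D (2 * i) (2 * j)" for D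
      using relabel_points_simps(3)[of \<pi> D 0 1] \<pi> by simp
    have m1: "(\<lambda>D. indicator {..r} (D 0 2) * indicat_real A (pair_obs 0 1 D)) \<in> borel_measurable \<kappa>"
      by (intro borel_measurable_times measurable_compose[OF entry_measurable_kappa[of 0 2] borel_measurable_indicator[OF B]]
          measurable_compose[OF pair_obs_measurable borel_measurable_indicator[OF A]])
    have m2: "(\<lambda>D. measure unif {u. \<psi> (pair_obs 0 1 D) u \<in> {..r}} * indicator A (pair_obs 0 1 D)) \<in> borel_measurable \<kappa>"
      by (intro borel_measurable_times measurable_compose[OF pair_obs_measurable borel_measurable_unif_kernel[OF m B]]
          measurable_compose[OF pair_obs_measurable borel_measurable_indicator[OF A]])
    have "(\<integral>D. indicator {..r} (D (2 * i) (2 * j)) * indicator A (pair_obs i j D) \<partial>\<kappa>) =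
        (\<integral>D. indicator {..r} (D 0 2) * indicat_real A (pair_obs 0 1 D) \<partial>\<kappa>)"
      using integral_relabel[OF inj m1] by (simp only: rl rl')
    also have "\<dots> = (\<integral>D. measure unif {u. \<psi> (pair_obs 0 1 D) u \<in> {..r}} * indicator A (pair_obs 0 1 D) \<partial>\<kappa>)"
      by (rule *[OF A B])
    also have "\<dots> = (\<integral>D. measure unif {u. \<psi> (pair_obs i j D) u \<in> {..r}} * indicator A (pair_obs i j D) \<partial>\<kappa>)"
      using integral_relabel[OF inj m2] by (simp only: rl rl')
    finally show "(\<integral>D. indicator {..r} (D (2 * i) (2 * j)) * indicator A (pair_obs i j D) \<partial>\<kappa>) =
      (\<integral>D. measure unif {u. \<psi> (pair_obs i j D) u \<in> {..r}} * indicator A (pair_obs i j D) \<partial>\<kappa>)" .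
  qed
qed

lemma shell_kernel:
  obtains \<phi> :: "real \<Rightarrow> real \<Rightarrow> real"
  where "(\<lambda>(s, u). \<phi> s u) \<in> borel_measurable (borel \<Otimes>\<^sub>M borel)"
    and "\<And>s u. 0 \<le> \<phi> s u \<and> \<phi> s u \<le> 1"
    and "\<And>i A r. A \<in> sets borel \<Longrightarrow>
      (\<integral>D. indicator {..r} (shell_row i D) * indicator A (shell D) \<partial>\<kappa>) =
      (\<integral>D. measure unif {u. \<phi> (shell D) u \<in> {..r}} * indicator A (shell D) \<partial>\<kappa>)"
proof (rule noise_outsourcing[OF shell_measurable shell_row_measurable[of 0] shell_row_bounds])
  fix \<phi> assume m: "(\<lambda>(s, u). \<phi> s u) \<in> borel_measurable (borel \<Otimes>\<^sub>M borel)"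
    and b: "\<And>s u. 0 \<le> \<phi> s u \<and> \<phi> s u \<le> 1"
    and *: "\<And>A B. A \<in> sets borel \<Longrightarrow> B \<in> sets borel \<Longrightarrow>
      (\<integral>D. indicator B (shell_row 0 D) * indicator A (shell D) \<partial>\<kappa>) =
      (\<integral>D. measure unif {u. \<phi> (shell D) u \<in> B} * indicator A (shell D) \<partial>\<kappa>)"
  show thesis
  proof (rule that[OF m b])
    fix i :: nat and A :: "real set" and r :: real assume A [measurable]: "A \<in> sets borel"
    \<comment> \<open>An injection that takes 0 to \<open>i\<close> is all that the transfer from
      row 0 to row \<open>i\<close> needs.\<close>
    define \<pi> where "\<pi> n = n + i" for n
    then have \<pi>: "inj \<pi>" "\<pi> 0 = i" by (auto simp: inj_def)
    note inj = inj_relabel_points[OF \<pi>(1)]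
    note [measurable] = shell_measurable shell_row_measurable
    have B: "{..r} \<in> sets borel" by simp
    have m1: "(\<lambda>D. indicator {..r} (shell_row 0 D) * indicat_real A (shell D)) \<in> borel_measurable \<kappa>"
      by measurable
    have "(\<integral>D. indicator {..r} (shell_row i D) * indicator A (shell D) \<partial>\<kappa>) =
        (\<integral>D. indicator {..r} (shell_row 0 D) * indicat_real A (shell D) \<partial>\<kappa>)"
      using integral_relabel[OF inj m1] by (simp only: relabel_points_simps \<pi>)
    also have "\<dots> = (\<integral>D. measure unif {u. \<phi> (shell D) u \<in> {..r}} * indicator A (shell D) \<partial>\<kappa>)"
      by (rule *[OF A B])
    finally show "(\<integral>D. indicator {..r} (shell_row i D) * indicator A (shell D) \<partial>\<kappa>) =
      (\<integral>D. measure unif {u. \<phi> (shell D) u \<in> {..r}} * indicator A (shell D) \<partial>\<kappa>)" .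
  qed
qed

text \<open>\<open>kernel\<close> only allows tests that depend on \<open>pair_obs i j\<close>. The
  invariance argument admits every \<open>G\<close> that avoids the distance in question: given the
  shell and the two rows, no other entry carries information about it.\<close>

lemma pair_step:
  assumes \<psi>: "(\<lambda>(s, u). \<psi> s u) \<in> borel_measurable (pair_alg \<Otimes>\<^sub>M borel)"
    and kernel: "\<And>A. A \<in> sets pair_alg \<Longrightarrow>
      (\<integral>D. indicator {..r} (D (2 * i) (2 * j)) * indicator A (pair_obs i j D) \<partial>\<kappa>) =
      (\<integral>D. measure unif {u. \<psi> (pair_obs i j D) u \<in> {..r}} * indicator A (pair_obs i j D) \<partial>\<kappa>)"
    and G: "G \<in> borel_measurable (ent (off_pair i j))" "\<And>D. D \<in> M_inf \<Longrightarrow> \<bar>G D\<bar> \<le> C"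
  shows "(\<integral>D. indicator {..r} (D (2 * i) (2 * j)) * G D \<partial>\<kappa>) =
    (\<integral>D. measure unif {u. \<psi> (pair_obs i j D) u \<in> {..r}} * G D \<partial>\<kappa>)"
proof -
  interpret U: prob_space unif by (rule prob_space_unif)
  \<comment> \<open>Fixes the two points and sends all other indices, those of the shell included,
    to odd ones. The distance of the pair stays in place, while all other entries are pulled back to
    entries in \<open>around_pair i j\<close>.\<close>
  define \<sigma> where "\<sigma> n = (if n = 2 * i \<or> n = 2 * j then n else 2 * n + 1)" for n
  have ev: "even (\<sigma> n) \<Longrightarrow> \<sigma> n = n \<and> (n = 2 * i \<or> n = 2 * j)" for n by (auto simp: \<sigma>_def split: if_splits)
  have inj: "inj \<sigma>"
  proof (rule injI)
    fix a b assume ab: "\<sigma> a = \<sigma> b"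
    show "a = b"
    proof (cases "even (\<sigma> a)")
      case True
      then have "even (\<sigma> b)" using ab by simp
      have "a = \<sigma> a" by (rule conjunct1[OF ev[OF True], symmetric])
      also have "\<sigma> a = b" unfolding ab by (rule conjunct1[OF ev[OF \<open>even (\<sigma> b)\<close>]])
      finally show ?thesis .
    next
      case False
      have od: "odd (\<sigma> n) \<Longrightarrow> \<sigma> n = 2 * n + 1" for n by (auto simp: \<sigma>_def split: if_splits)
      have "odd (\<sigma> b)" using False ab by simp
      have "2 * a + 1 = 2 * b + 1" using od[OF False] od[OF \<open>odd (\<sigma> b)\<close>] ab by linarith
      then show ?thesis by simp
    qed
  qed
  have T: "relabel \<sigma> \<in> ent (around_pair i j) \<rightarrow>\<^sub>M ent (off_pair i j)"
  proof (rule relabel_measurable_ent)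
    fix a b assume "(a, b) \<in> off_pair i j"
    moreover have "odd (\<sigma> n) \<or> \<sigma> n = 2 * i \<or> \<sigma> n = 2 * j" for n
      by (auto simp: \<sigma>_def)
    moreover have "{a, b} = {2 * i, 2 * j}" if "{\<sigma> a, \<sigma> b} = {2 * i, 2 * j}"
    proof -
      have e: "even (\<sigma> a)" "even (\<sigma> b)" using that by (auto simp: doubleton_eq_iff)
      have "\<sigma> a = a" "\<sigma> b = b" by (rule conjunct1[OF ev[OF e(1)]], rule conjunct1[OF ev[OF e(2)]])
      then show ?thesis using that by simp
    qed
    ultimately show "(\<sigma> a, \<sigma> b) \<in> around_pair i j" by (auto simp: around_pair_def off_pair_def)
  qed
  have B: "{..r} \<in> sets borel" by simp
  show ?thesis
  proof (rule integral_invariant_eq[where F' = "ent (off_pair i j)" and F = "ent (around_pair i j)"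
        and T = "\<lambda>_. relabel \<sigma>" and f = "\<lambda>_ D. indicator {..r} (D (2 * i) (2 * j))" and B = 1 and D = 1])
    show "(\<lambda>D. indicat_real {..r} (D (2 * i) (2 * j))) \<in> borel_measurable \<kappa>"
      by (rule measurable_compose[OF entry_measurable_kappa[of "2 * i" "2 * j"] borel_measurable_indicator[OF B]])
    show "indicat_real {..r} (relabel \<sigma> D (2 * i) (2 * j)) = indicator {..r} (D (2 * i) (2 * j))" for D
      by (simp add: relabel_def \<sigma>_def)
    show "(\<lambda>D. measure unif {u. \<psi> (pair_obs i j D) u \<in> {..r}}) \<in> borel_measurable (ent (around_pair i j))"
      by (rule measurable_compose[OF pair_obs_around_pair borel_measurable_unif_kernel[OF \<psi> B]])
    show "(\<integral>D. indicat_real {..r} (D (2 * i) (2 * j)) * indicator A D \<partial>\<kappa>) =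
        (\<integral>D. measure unif {u. \<psi> (pair_obs i j D) u \<in> {..r}} * indicator A D \<partial>\<kappa>)"
      if A: "A \<in> sets (ent (around_pair i j))" for A
    proof -
      obtain E where E: "E \<in> sets pair_alg" "A = {D \<in> M_inf. pair_obs i j D \<in> E}"
        using around_pair_setsE[OF A] by blast
      then have e: "indicat_real A D = indicator E (pair_obs i j D)" if "D \<in> space \<kappa>" for D
        using that by (simp add: space_eq indicator_def)
      show ?thesis using kernel[OF E(1)] by (simp add: e cong: Bochner_Integration.integral_cong)
    qed
  qed (use T G in \<open>auto simp: subalgebra_ent subalgebra_ent_ent around_pair_def relabel_measurable_kappa
      distr_relabel[OF inj] space_eq\<close>)
qed

text \<open>Given the shell alone, the row of a point is independent of everything that does not
  involve this point.\<close>

lemma shell_step: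
  assumes \<phi>: "(\<lambda>(s, u). \<phi> s u) \<in> borel_measurable (borel \<Otimes>\<^sub>M borel)"
    and kernel: "\<And>A. A \<in> sets borel \<Longrightarrow>
      (\<integral>D. indicator {..r} (shell_row i D) * indicator A (shell D) \<partial>\<kappa>) =
      (\<integral>D. measure unif {u. \<phi> (shell D) u \<in> {..r}} * indicator A (shell D) \<partial>\<kappa>)"
    and G: "G \<in> borel_measurable (ent (off_point i))" "\<And>D. D \<in> M_inf \<Longrightarrow> \<bar>G D\<bar> \<le> C"
  shows "(\<integral>D. indicator {..r} (shell_row i D) * G D \<partial>\<kappa>) =
    (\<integral>D. measure unif {u. \<phi> (shell D) u \<in> {..r}} * G D \<partial>\<kappa>)"
proof -
  interpret U: prob_space unif by (rule prob_space_unif)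
  \<comment> \<open>Keeps the point and the first \<open>k\<close> shell indices, hence the
    truncated code of the row, and sends all other indices to odd ones above \<open>2 * k\<close>.
    The row itself is recovered as \<open>k\<close> grows.\<close>
  define \<sigma> where "\<sigma> k n = (if n = 2 * i \<or> odd n \<and> n < 2 * k then n else 2 * (n + k) + 1)" for k n
  have inj: "inj (\<sigma> k)" for k
  proof (rule injI)
    fix a b assume "\<sigma> k a = \<sigma> k b"
    then show "a = b" by (simp add: \<sigma>_def split: if_splits) presburger+
  qed
  have T: "relabel (\<sigma> k) \<in> ent odd_pairs \<rightarrow>\<^sub>M ent (off_point i)" for k
    by (rule relabel_measurable_ent) (auto simp: odd_pairs_def off_point_def \<sigma>_def)
  have B: "{..r} \<in> sets borel" by simp
  let ?c = "\<lambda>k D. code_trunc k (\<lambda>a. D (2 * i) (2 * a + 1))"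
  show ?thesis
  proof (rule integral_invariant_eq[where F' = "ent (off_point i)" and F = "ent odd_pairs"
        and T = "\<lambda>k. relabel (\<sigma> k)" and f = "\<lambda>k D. indicator {..r} (?c k D)" and B = 1 and D = 1])
    have [measurable]: "?c k \<in> borel_measurable \<kappa>" for k
      by (rule code_measurable(2)[OF entry_measurable_kappa])
    show "(\<lambda>D. indicat_real {..r} (?c k D)) \<in> borel_measurable \<kappa>" for k by measurable
    show "indicat_real {..r} (?c k (relabel (\<sigma> k) D)) = indicator {..r} (?c k D)" for k D
    proof -
      have "?c k (relabel (\<sigma> k) D) = ?c k D"
        by (rule code_trunc_cong) (simp add: relabel_def \<sigma>_def)
      then show ?thesis by simp
    qed
    \<comment> \<open>The truncations increase: either all of them stay at most \<open>r\<close>, or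
      from some index on all exceed it.\<close>
    show "(\<lambda>k. indicat_real {..r} (?c k D)) \<longlonglongrightarrow> indicator {..r} (shell_row i D)" for D
    proof (cases "shell_row i D \<le> r")
      case True
      then have "?c k D \<le> r" for k unfolding shell_row_def code_trunc_le_iff by blast
      then show ?thesis using True by simp
    next
      case False
      then obtain k\<^sub>0 where k0: "r < ?c k\<^sub>0 D" unfolding shell_row_def code_trunc_le_iff not_all not_le by (rule exE)
      have "eventually (\<lambda>k. indicat_real {..r} (?c k D) = 0) sequentially"
        using eventually_ge_at_top[of k\<^sub>0]
      proof eventually_elim
        case (elim k)
        have "?c k\<^sub>0 D \<le> ?c k D" by (rule lift_Suc_mono_le[where f = "\<lambda>k. ?c k D", OF code_trunc_mono elim])
        then show ?case using k0 by simp
      qed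
      then show ?thesis using False by (simp add: tendsto_eventually)
    qed
    show "(\<lambda>D. measure unif {u. \<phi> (shell D) u \<in> {..r}}) \<in> borel_measurable (ent odd_pairs)"
      by (rule measurable_compose[OF shell_measurable_ent[OF order_refl] borel_measurable_unif_kernel[OF \<phi> B]])
    show "(\<integral>D. indicat_real {..r} (shell_row i D) * indicator A D \<partial>\<kappa>) =
        (\<integral>D. measure unif {u. \<phi> (shell D) u \<in> {..r}} * indicator A D \<partial>\<kappa>)"
      if A: "A \<in> sets (ent odd_pairs)" for A
    proof -
      obtain E where E: "E \<in> sets borel" "A = {D \<in> M_inf. shell D \<in> E}"
        using odd_pairs_setsE[OF A] by blast
      then have e: "indicat_real A D = indicator E (shell D)" if "D \<in> space \<kappa>" for D
        using that by (simp add: space_eq indicator_def)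
      show ?thesis using kernel[OF E(1)] by (simp add: e cong: Bochner_Integration.integral_cong)
    qed
  qed (use T G in \<open>auto simp: subalgebra_ent subalgebra_ent_ent odd_pairs_subset relabel_measurable_kappa
      distr_relabel[OF inj] space_eq\<close>)
qed

end

lemma measure_eqI_seq_boxes:
  fixes N N' :: "(nat \<Rightarrow> real) measure"
  assumes "finite_measure N" and N: "sets N = sets (PiM UNIV (\<lambda>_. borel))" "sets N' = sets (PiM UNIV (\<lambda>_. borel))"
    and eq: "\<And>K r. finite K \<Longrightarrow> emeasure N {x. \<forall>i\<in>K. x i \<le> r i} = emeasure N' {x. \<forall>i\<in>K. x i \<le> r i}"
  shows "N = N'"
proof -
  define \<E> where "\<E> = {{x. \<forall>i\<in>K. x i \<le> (r i :: real)} | K r. finite (K :: nat set)}"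
  have PU: "UNIV \<in> \<E>" unfolding \<E>_def by (intro CollectI exI[of _ "{}"] exI[of _ "\<lambda>_. 0"]) auto
  have stable: "Int_stable \<E>"
  proof (rule Int_stableI)
    fix a b assume "a \<in> \<E>" "b \<in> \<E>"
    then obtain J r K s where a: "a = {x. \<forall>i\<in>J. x i \<le> r i}" "finite J"
      and b: "b = {x. \<forall>i\<in>K. x i \<le> s i}" "finite K" by (auto simp: \<E>_def)
    define t where "t i = (if i \<in> J then if i \<in> K then min (r i) (s i) else r i else s i)" for i
    have "a \<inter> b = {x. \<forall>i\<in>J \<union> K. x i \<le> t i}" by (auto simp: a b t_def)
    then show "a \<inter> b \<in> \<E>" using a b unfolding \<E>_def by blast
  qed
  have "sets (PiM UNIV (\<lambda>_::nat. borel :: real measure)) = sigma_sets UNIV \<E>"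
  proof (rule antisym)
    have "(\<lambda>x. x) \<in> sigma UNIV \<E> \<rightarrow>\<^sub>M PiM UNIV (\<lambda>_::nat. borel :: real measure)"
    proof (rule measurable_PiM_single')
      show "(\<lambda>x. x i) \<in> sigma UNIV \<E> \<rightarrow>\<^sub>M borel" for i
        unfolding borel_measurable_iff_le
      proof
        fix a :: real
        have "{x :: nat \<Rightarrow> real. x i \<le> a} \<in> \<E>"
          unfolding \<E>_def by (intro CollectI exI[of _ "{i}"] exI[of _ "\<lambda>_. a"]) auto
        then show "{x \<in> space (sigma UNIV \<E>). x i \<le> a} \<in> sets (sigma UNIV \<E>)" by simp
      qed
    qed auto
    from measurable_sets[OF this]
    show "sets (PiM UNIV (\<lambda>_::nat. borel :: real measure)) \<subseteq> sigma_sets UNIV \<E>" by (auto simp: space_PiM)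
    have "X \<in> sets (PiM UNIV (\<lambda>_::nat. borel :: real measure))" if X: "X \<in> \<E>" for X
    proof -
      obtain K r where X: "X = {x. \<forall>i\<in>K. x i \<le> r i}" "finite K" using X by (auto simp: \<E>_def)
      have "X = {x \<in> space (PiM UNIV (\<lambda>_::nat. borel :: real measure)). \<forall>i\<in>K. x i \<le> r i}"
        by (simp add: X space_PiM)
      also have "\<dots> \<in> sets (PiM UNIV (\<lambda>_::nat. borel :: real measure))"
        using X(2) by measurable
      finally show ?thesis .
    qed
    then show "sigma_sets UNIV \<E> \<subseteq> sets (PiM UNIV (\<lambda>_::nat. borel :: real measure))"
      using sets.sigma_sets_subset[of \<E> "PiM UNIV (\<lambda>_::nat. borel :: real measure)"] by (auto simp: space_PiM)
  qed
  note s = this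
  show ?thesis
  proof (rule measure_eqI_generator_eq[OF stable, where A = "\<lambda>_. UNIV"])
    show "emeasure N X = emeasure N' X" if "X \<in> \<E>" for X using that eq by (auto simp: \<E>_def)
    show "emeasure N UNIV \<noteq> \<infinity>" using finite_measure.emeasure_finite[OF assms(1)] by auto
  qed (use N s PU in auto)
qed

text \<open>The laws of a qmm-space must be symmetric in the two points, while \<open>\<psi>\<close>
  need not be. Evaluating it with the smaller row code first makes it so.\<close>

definition sort_obs :: "(real \<times> real) \<times> real \<Rightarrow> (real \<times> real) \<times> real" where
  "sort_obs t = ((fst (fst t), min (snd (fst t)) (snd t)), max (snd (fst t)) (snd t))"

lemma sort_obs_measurable: "sort_obs \<in> pair_alg \<rightarrow>\<^sub>M pair_alg"
  unfolding sort_obs_def[abs_def] by measurable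

lemma sort_obs_swap: "sort_obs ((s, x), y) = sort_obs ((s, y), x)"
  by (simp add: sort_obs_def min.commute max.commute)

section \<open>Conditional independence of rows given the shell, and of distances given shell and
  rows\<close>

locale kernel_array = closure_array +
  fixes \<phi> :: "real \<Rightarrow> real \<Rightarrow> real" and \<psi> :: "(real \<times> real) \<times> real \<Rightarrow> real \<Rightarrow> real"
  assumes \<phi>: "(\<lambda>(s, u). \<phi> s u) \<in> borel_measurable (borel \<Otimes>\<^sub>M borel)"
    and \<phi>_kernel: "\<And>i A r. A \<in> sets borel \<Longrightarrow>
      (\<integral>D. indicator {..r} (shell_row i D) * indicator A (shell D) \<partial>\<kappa>) =
      (\<integral>D. measure unif {u. \<phi> (shell D) u \<in> {..r}} * indicator A (shell D) \<partial>\<kappa>)"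
    and \<psi>: "(\<lambda>(s, u). \<psi> s u) \<in> borel_measurable (pair_alg \<Otimes>\<^sub>M borel)"
    and \<psi>_kernel: "\<And>i j A r. i \<noteq> j \<Longrightarrow> A \<in> sets pair_alg \<Longrightarrow>
      (\<integral>D. indicator {..r} (D (2 * i) (2 * j)) * indicator A (pair_obs i j D) \<partial>\<kappa>) =
      (\<integral>D. measure unif {u. \<psi> (pair_obs i j D) u \<in> {..r}} * indicator A (pair_obs i j D) \<partial>\<kappa>)"
begin

definition row_cdf :: "real \<Rightarrow> real \<Rightarrow> real" where
  "row_cdf r s = measure unif {u. \<phi> s u \<in> {..r}}"

definition pair_cdf :: "real \<Rightarrow> (real \<times> real) \<times> real \<Rightarrow> real" where
  "pair_cdf r t = measure unif {u. \<psi> t u \<in> {..r}}"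

lemma row_cdf_measurable: "row_cdf r \<in> borel_measurable borel"
  unfolding row_cdf_def[abs_def] by (rule borel_measurable_unif_kernel[OF \<phi>]) simp

lemma pair_cdf_measurable: "pair_cdf r \<in> borel_measurable pair_alg"
  unfolding pair_cdf_def[abs_def] by (rule borel_measurable_unif_kernel[OF \<psi>]) simp

lemma row_cdf_bounds: "0 \<le> row_cdf r s" "row_cdf r s \<le> 1"
  unfolding row_cdf_def using prob_space.prob_le_1[OF prob_space_unif] by auto

lemma pair_cdf_bounds: "0 \<le> pair_cdf r t" "pair_cdf r t \<le> 1"
  unfolding pair_cdf_def using prob_space.prob_le_1[OF prob_space_unif] by auto

lemma abs_mult_le: "0 \<le> a \<Longrightarrow> a \<le> 1 \<Longrightarrow> \<bar>b\<bar> \<le> C \<Longrightarrow> \<bar>a * b\<bar> \<le> (C :: real)"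
  using mult_mono[of a 1 "\<bar>b\<bar>" C] by (simp add: abs_mult)

text \<open>Rows are integrated out one at a time. The other rows and the shell do not involve the
  point \<open>i\<close>, so \<open>shell_step\<close> applies; the factor that arises depends on
  the shell only and is absorbed into the weight, which is why \<open>g\<close> is
  arbitrary.\<close>

lemma integral_rows:
  assumes "finite K" "g \<in> borel_measurable borel" "\<And>s. \<bar>g s\<bar> \<le> C"
  shows "(\<integral>D. (\<Prod>i\<in>K. indicator {..r i} (shell_row i D)) * g (shell D) \<partial>\<kappa>) =
    (\<integral>D. (\<Prod>i\<in>K. row_cdf (r i) (shell D)) * g (shell D) \<partial>\<kappa>)"
  using assms
proof (induction K arbitrary: g rule: finite_induct)
  case (insert i K)
  let ?G = "\<lambda>D. (\<Prod>k\<in>K. indicat_real {..r k} (shell_row k D)) * g (shell D)"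
  have G: "?G \<in> borel_measurable (ent (off_point i))"
  proof (intro borel_measurable_times borel_measurable_prod)
    fix k assume "k \<in> K"
    then have "k \<noteq> i" using insert by auto
    then have "shell_row k \<in> borel_measurable (ent (off_point i))"
      by (intro shell_row_measurable_ent) (auto simp: off_point_def Suc_double_not_eq_double)
    then show "(\<lambda>D. indicat_real {..r k} (shell_row k D)) \<in> borel_measurable (ent (off_point i))"
      by (rule measurable_compose) simp
  next
    show "(\<lambda>D. g (shell D)) \<in> borel_measurable (ent (off_point i))"
      by (rule measurable_compose[OF shell_measurable_ent[OF odd_pairs_subset(3)] insert.prems(1)])
  qed
  have Gb: "\<bar>?G D\<bar> \<le> C" for D
    by (intro abs_mult_le insert.prems prod_nonneg prod_le_1) (auto simp: indicator_def)
  have "(\<integral>D. (\<Prod>k\<in>insert i K. indicator {..r k} (shell_row k D)) * g (shell D) \<partial>\<kappa>) =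
      (\<integral>D. indicator {..r i} (shell_row i D) * ?G D \<partial>\<kappa>)"
    using insert.hyps by (simp add: mult.assoc)
  also have "\<dots> = (\<integral>D. row_cdf (r i) (shell D) * ?G D \<partial>\<kappa>)"
    unfolding row_cdf_def by (rule shell_step[OF \<phi> \<phi>_kernel G Gb])
  also have "\<dots> = (\<integral>D. (\<Prod>k\<in>K. indicator {..r k} (shell_row k D)) * (row_cdf (r i) (shell D) * g (shell D)) \<partial>\<kappa>)"
    by (simp add: mult_ac)
  also have "\<dots> = (\<integral>D. (\<Prod>k\<in>K. row_cdf (r k) (shell D)) * (row_cdf (r i) (shell D) * g (shell D)) \<partial>\<kappa>)"
    by (rule insert.IH) (auto intro!: borel_measurable_times row_cdf_measurable insert.prems abs_mult_le row_cdf_bounds)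
  finally show ?case using insert.hyps by (simp add: mult_ac)
qed simp

lemma pair_step_sorted:
  assumes ij: "i \<noteq> j" and G: "G \<in> borel_measurable (ent (off_pair i j))" "\<And>D. D \<in> M_inf \<Longrightarrow> \<bar>G D\<bar> \<le> C"
  shows "(\<integral>D. indicator {..r} (D (2 * i) (2 * j)) * G D \<partial>\<kappa>) =
    (\<integral>D. pair_cdf r (sort_obs (pair_obs i j D)) * G D \<partial>\<kappa>)"
proof -
  \<comment> \<open>\<open>a\<close> tells which row is smaller. It does not involve the distance of
    the pair, so it may join the weight, and \<open>pair_step\<close> is applied on each part with
    the points in the order of their rows; symmetry of \<open>D\<close> identifies the two
    distances.\<close>
  define a where "a D = (if shell_row i D \<le> shell_row j D then 1 else 0 :: real)" for D
  have rows: "shell_row k \<in> borel_measurable (ent (off_pair i j))" for k by (rule shell_row_off_pair)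
  have am: "a \<in> borel_measurable (ent (off_pair i j))"
    unfolding a_def[abs_def] by (intro measurable_If borel_measurable_le rows) simp_all
  have ab: "0 \<le> a D" "a D \<le> 1" for D by (auto simp: a_def)
  have sym: "off_pair j i = off_pair i j" by (auto simp: off_pair_def)
  have Gm: "(\<lambda>D. a D * G D) \<in> borel_measurable (ent (off_pair i j))"
    "(\<lambda>D. (1 - a D) * G D) \<in> borel_measurable (ent (off_pair i j))"
    using am G(1) by (auto intro!: borel_measurable_times borel_measurable_diff)
  have Gb: "\<bar>a D * G D\<bar> \<le> C" "\<bar>(1 - a D) * G D\<bar> \<le> C" if "D \<in> M_inf" for D
    by (rule abs_mult_le; use ab[of D] G(2)[OF that] in simp)+
  have e1: "(\<integral>D. indicator {..r} (D (2 * i) (2 * j)) * (a D * G D) \<partial>\<kappa>) =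
      (\<integral>D. pair_cdf r (pair_obs i j D) * (a D * G D) \<partial>\<kappa>)"
    unfolding pair_cdf_def by (rule pair_step[OF \<psi> \<psi>_kernel[OF ij] Gm(1) Gb(1)])
  have e2: "(\<integral>D. indicator {..r} (D (2 * i) (2 * j)) * ((1 - a D) * G D) \<partial>\<kappa>) =
      (\<integral>D. pair_cdf r (pair_obs j i D) * ((1 - a D) * G D) \<partial>\<kappa>)"
  proof -
    have "(\<integral>D. indicator {..r} (D (2 * i) (2 * j)) * ((1 - a D) * G D) \<partial>\<kappa>) =
        (\<integral>D. indicator {..r} (D (2 * j) (2 * i)) * ((1 - a D) * G D) \<partial>\<kappa>)"
    proof (rule Bochner_Integration.integral_cong[OF refl])
      fix D assume "D \<in> space \<kappa>"
      then have "D (2 * i) (2 * j) = D (2 * j) (2 * i)" by (auto simp: space_eq M_inf_def)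
      then show "indicat_real {..r} (D (2 * i) (2 * j)) * ((1 - a D) * G D) =
          indicator {..r} (D (2 * j) (2 * i)) * ((1 - a D) * G D)" by simp
    qed
    also have "\<dots> = (\<integral>D. pair_cdf r (pair_obs j i D) * ((1 - a D) * G D) \<partial>\<kappa>)"
      unfolding pair_cdf_def
      by (rule pair_step[OF \<psi> \<psi>_kernel[OF ij[symmetric]] Gm(2)[folded sym] Gb(2)])
    finally show ?thesis .
  qed
  have int: "integrable \<kappa> (\<lambda>D. f D * H D)"
    if "f \<in> borel_measurable \<kappa>" "\<And>D. 0 \<le> f D \<and> f D \<le> 1"
      "H \<in> borel_measurable (ent (off_pair i j))" "\<And>D. D \<in> M_inf \<Longrightarrow> \<bar>H D\<bar> \<le> C" for f H :: "_ \<Rightarrow> real"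
  proof (rule integrable_of_bound[where B = C])
    show "(\<lambda>D. f D * H D) \<in> borel_measurable \<kappa>"
      by (rule borel_measurable_times[OF that(1) measurable_ent[OF that(3)]])
    show "\<bar>f D * H D\<bar> \<le> C" if "D \<in> space \<kappa>" for D
      using that \<open>\<And>D. 0 \<le> f D \<and> f D \<le> 1\<close>[of D] \<open>\<And>D. D \<in> M_inf \<Longrightarrow> \<bar>H D\<bar> \<le> C\<close>[of D]
      by (intro abs_mult_le) (auto simp: space_eq)
  qed
  have dm: "(\<lambda>D. indicat_real {..r} (D (2 * i) (2 * j))) \<in> borel_measurable \<kappa>"
    by (rule measurable_compose[OF entry_measurable_kappa[of "2 * i" "2 * j"]]) simp
  have pm: "(\<lambda>D. pair_cdf r (pair_obs k l D)) \<in> borel_measurable \<kappa>" for k l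
    by (rule measurable_compose[OF pair_obs_measurable pair_cdf_measurable])
  have "(\<integral>D. indicator {..r} (D (2 * i) (2 * j)) * G D \<partial>\<kappa>) =
      (\<integral>D. indicator {..r} (D (2 * i) (2 * j)) * (a D * G D) + indicator {..r} (D (2 * i) (2 * j)) * ((1 - a D) * G D) \<partial>\<kappa>)"
    by (intro Bochner_Integration.integral_cong) (auto simp: algebra_simps)
  also have "\<dots> = (\<integral>D. indicator {..r} (D (2 * i) (2 * j)) * (a D * G D) \<partial>\<kappa>) +
      (\<integral>D. indicator {..r} (D (2 * i) (2 * j)) * ((1 - a D) * G D) \<partial>\<kappa>)"
    by (intro Bochner_Integration.integral_add int dm Gm Gb) (simp_all add: indicator_def)
  also have "\<dots> = (\<integral>D. pair_cdf r (pair_obs i j D) * (a D * G D) \<partial>\<kappa>) +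
      (\<integral>D. pair_cdf r (pair_obs j i D) * ((1 - a D) * G D) \<partial>\<kappa>)"
    unfolding e1 e2 ..
  also have "\<dots> = (\<integral>D. pair_cdf r (pair_obs i j D) * (a D * G D) + pair_cdf r (pair_obs j i D) * ((1 - a D) * G D) \<partial>\<kappa>)"
    by (intro Bochner_Integration.integral_add[symmetric] int pm Gm Gb) (simp_all add: pair_cdf_bounds)
  also have "\<dots> = (\<integral>D. pair_cdf r (sort_obs (pair_obs i j D)) * G D \<partial>\<kappa>)"
    by (intro Bochner_Integration.integral_cong) (auto simp: a_def sort_obs_def pair_obs_def)
  finally show ?thesis .
qed

definition obs_cdf :: "nat \<Rightarrow> nat \<Rightarrow> real \<Rightarrow> (nat \<Rightarrow> nat \<Rightarrow> real) \<Rightarrow> real" where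
  "obs_cdf i j r D = pair_cdf r (sort_obs (pair_obs i j D))"

lemma obs_cdf_measurable_ent: "obs_cdf k l r \<in> borel_measurable (ent (off_pair i j))"
proof -
  have [measurable]: "shell_row k \<in> borel_measurable (ent (off_pair i j))" for k by (rule shell_row_off_pair)
  note [measurable] = shell_measurable_ent[OF odd_pairs_subset(2), of i j]
  have p: "pair_obs k l \<in> ent (off_pair i j) \<rightarrow>\<^sub>M pair_alg" unfolding pair_obs_def[abs_def] by measurable
  show ?thesis unfolding obs_cdf_def[abs_def]
    by (rule measurable_compose[OF measurable_compose[OF p sort_obs_measurable] pair_cdf_measurable])
qed

text \<open>Distances are replaced one at a time. The others belong to different pairs, and
  \<open>obs_cdf\<close> depends on shell and rows only, so the rest of the integrand is always an
  admissible weight for \<open>pair_step_sorted\<close>.\<close>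

lemma integral_pairs:
  assumes "finite J" "J \<subseteq> {(i, j). i < j}"
    and "\<And>p. p \<in> J \<Longrightarrow> G \<in> borel_measurable (ent (off_pair (fst p) (snd p)))" "G \<in> borel_measurable \<kappa>"
    and "\<And>D. D \<in> M_inf \<Longrightarrow> \<bar>G D\<bar> \<le> C"
  shows "(\<integral>D. (\<Prod>p\<in>J. indicator {..r p} (D (2 * fst p) (2 * snd p))) * G D \<partial>\<kappa>) =
    (\<integral>D. (\<Prod>p\<in>J. obs_cdf (fst p) (snd p) (r p) D) * G D \<partial>\<kappa>)"
  using assms
proof (induction J arbitrary: G rule: finite_induct)
  case (insert p J)
  obtain i j where p: "p = (i, j)" by (cases p)
  have ij: "i < j" using insert.prems(1) by (auto simp: p)
  let ?G = "\<lambda>D. (\<Prod>q\<in>J. indicat_real {..r q} (D (2 * fst q) (2 * snd q))) * G D"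
  have Gm: "?G \<in> borel_measurable (ent (off_pair i j))"
  proof (intro borel_measurable_times borel_measurable_prod)
    fix q assume "q \<in> J"
    then have "q \<noteq> p" "fst q < snd q" using insert by auto
    then have "(2 * fst q, 2 * snd q) \<in> off_pair i j"
      using ij by (cases q) (auto simp: off_pair_def doubleton_eq_iff p)
    from entry_measurable[OF this]
    show "(\<lambda>D. indicat_real {..r q} (D (2 * fst q) (2 * snd q))) \<in> borel_measurable (ent (off_pair i j))"
      by (rule measurable_compose) simp
  next
    show "G \<in> borel_measurable (ent (off_pair i j))" using insert.prems(2)[of p] by (simp add: p)
  qed
  have Gb: "\<bar>?G D\<bar> \<le> C" if "D \<in> M_inf" for D
    by (intro abs_mult_le insert.prems that prod_nonneg prod_le_1) (auto simp: indicator_def)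
  have "(\<integral>D. (\<Prod>q\<in>insert p J. indicator {..r q} (D (2 * fst q) (2 * snd q))) * G D \<partial>\<kappa>) =
      (\<integral>D. indicator {..r p} (D (2 * i) (2 * j)) * ?G D \<partial>\<kappa>)"
    using insert.hyps by (simp add: mult.assoc p)
  also have "\<dots> = (\<integral>D. obs_cdf i j (r p) D * ?G D \<partial>\<kappa>)"
    unfolding obs_cdf_def using ij by (intro pair_step_sorted[OF _ Gm Gb]) auto
  also have "\<dots> = (\<integral>D. (\<Prod>q\<in>J. indicator {..r q} (D (2 * fst q) (2 * snd q))) * (obs_cdf i j (r p) D * G D) \<partial>\<kappa>)"
    by (simp add: mult_ac)
  also have "\<dots> = (\<integral>D. (\<Prod>q\<in>J. obs_cdf (fst q) (snd q) (r q) D) * (obs_cdf i j (r p) D * G D) \<partial>\<kappa>)"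
  proof (rule insert.IH)
    show "(\<lambda>D. obs_cdf i j (r p) D * G D) \<in> borel_measurable (ent (off_pair (fst q) (snd q)))" if "q \<in> J" for q
      using that by (intro borel_measurable_times obs_cdf_measurable_ent insert.prems) auto
    show "(\<lambda>D. obs_cdf i j (r p) D * G D) \<in> borel_measurable \<kappa>"
      by (intro borel_measurable_times measurable_ent[OF obs_cdf_measurable_ent[of _ _ _ 0 1]] insert.prems)
    show "\<bar>obs_cdf i j (r p) D * G D\<bar> \<le> C" if "D \<in> M_inf" for D
      using that by (intro abs_mult_le insert.prems) (auto simp: obs_cdf_def pair_cdf_bounds)
  qed (use insert.prems(1) in auto)
  finally show ?case using insert.hyps by (simp add: mult_ac p)
qed simp

end

section \<open>Fixing a typical shell\<close>

lemma ball_case_nat: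
  "(\<forall>i\<in>K. case_nat a f i \<le> (r i :: real)) \<longleftrightarrow> a \<in> (if 0 \<in> K then {..r 0} else UNIV) \<and> (\<forall>i\<in>{i. Suc i \<in> K}. f i \<le> r (Suc i))"
  by (auto split: nat.splits)

abbreviation unif_seq :: "(nat \<Rightarrow> real) measure" where
  "unif_seq \<equiv> PiM UNIV (\<lambda>_. unif)"

abbreviation seq_borel :: "(nat \<Rightarrow> real) measure" where
  "seq_borel \<equiv> PiM UNIV (\<lambda>_. borel)"

lemma prob_space_unif_seq: "prob_space unif_seq"
  by (rule prob_space_PiM) (rule prob_space_unif)

lemma space_unif_seq: "space unif_seq = UNIV"
  by (simp add: space_PiM)

lemma component_unif_seq: "(\<lambda>x. x i) \<in> borel_measurable unif_seq"
proof -
  have "(\<lambda>x. x i) \<in> unif_seq \<rightarrow>\<^sub>M unif" by (rule measurable_component_singleton) simp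
  then show ?thesis by (simp add: measurable_cong_sets[OF refl sets_unif])
qed

lemma emeasure_PiM_unif_box:
  assumes K: "finite K" "K \<subseteq> I" and A: "\<And>i. i \<in> K \<Longrightarrow> A i \<in> sets borel"
  shows "emeasure (PiM I (\<lambda>_. unif)) {x \<in> space (PiM I (\<lambda>_. unif)). \<forall>i\<in>K. x i \<in> A i} =
    ennreal (\<Prod>i\<in>K. measure unif (A i))"
proof -
  interpret U: prob_space unif by (rule prob_space_unif)
  have "{x \<in> space (PiM I (\<lambda>_. unif)). \<forall>i\<in>K. x i \<in> A i} = prod_emb I (\<lambda>_. unif) K (Pi\<^sub>E K A)"
    by (auto simp: prod_emb_def space_PiM restrict_PiE_iff)
  also have "emeasure (PiM I (\<lambda>_. unif)) \<dots> = (\<Prod>i\<in>K. emeasure unif (A i))"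
    using K A by (intro emeasure_PiM_emb prob_space_unif) auto
  also have "\<dots> = ennreal (\<Prod>i\<in>K. measure unif (A i))"
    by (simp add: U.emeasure_eq_measure prod_ennreal)
  finally show ?thesis .
qed

context kernel_array
begin

definition shell_rows :: "(nat \<Rightarrow> nat \<Rightarrow> real) \<Rightarrow> nat \<Rightarrow> real" where
  "shell_rows D = case_nat (shell D) (\<lambda>i. shell_row i D)"

definition model_rows :: "real \<Rightarrow> (nat \<Rightarrow> real) \<Rightarrow> nat \<Rightarrow> real" where
  "model_rows s x = case_nat s (\<lambda>i. \<phi> s (x i))"

lemma \<phi>_section: "\<phi> s \<in> borel_measurable borel"
  using measurable_Pair2[OF \<phi>, of s] by simp

lemma shell_rows_measurable: "shell_rows \<in> \<kappa> \<rightarrow>\<^sub>M seq_borel"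
proof (rule measurable_PiM_single')
  show "(\<lambda>D. shell_rows D i) \<in> borel_measurable \<kappa>" for i
    by (cases i) (simp_all add: shell_rows_def shell_measurable shell_row_measurable)
qed auto

lemma \<phi>_compose:
  assumes "f \<in> borel_measurable N" "g \<in> borel_measurable N"
  shows "(\<lambda>x. \<phi> (f x) (g x)) \<in> borel_measurable N"
  using measurable_compose[OF measurable_Pair[OF assms] \<phi>] by simp

lemma model_rows_measurable:
  assumes f: "f \<in> borel_measurable N"
  shows "(\<lambda>z. model_rows (f (fst z)) (snd z)) \<in> N \<Otimes>\<^sub>M unif_seq \<rightarrow>\<^sub>M seq_borel"
proof (rule measurable_PiM_single')
  have f': "(\<lambda>z. f (fst z)) \<in> borel_measurable (N \<Otimes>\<^sub>M unif_seq)"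
    by (rule measurable_compose[OF measurable_fst f])
  show "(\<lambda>z. model_rows (f (fst z)) (snd z) i) \<in> borel_measurable (N \<Otimes>\<^sub>M unif_seq)" for i
  proof (cases i)
    case (Suc k)
    have "(\<lambda>z. snd z k) \<in> borel_measurable (N \<Otimes>\<^sub>M unif_seq)"
      by (rule measurable_compose[OF measurable_snd component_unif_seq])
    then show ?thesis using \<phi>_compose[OF f'] by (simp add: model_rows_def Suc)
  qed (simp add: model_rows_def f')
qed auto

text \<open>On a box, \<open>integral_rows\<close> turns the left side into an integral over the
  shell of a product of values of \<open>row_cdf\<close>. On the right, integrating out the
  independent noise first gives the same product.\<close>

lemma distr_shell_rows:
  "distr \<kappa> seq_borel shell_rows = distr (\<kappa> \<Otimes>\<^sub>M unif_seq) seq_borel (\<lambda>z. model_rows (shell (fst z)) (snd z))"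
proof (rule measure_eqI_seq_boxes)
  interpret PU: prob_space unif_seq by (rule prob_space_unif_seq)
  interpret L: prob_space "distr \<kappa> seq_borel shell_rows" by (rule prob_space_distr[OF shell_rows_measurable])
  show "finite_measure (distr \<kappa> seq_borel shell_rows)" by (rule L.finite_measure_axioms)
  fix K :: "nat set" and r :: "nat \<Rightarrow> real" assume K: "finite K"
  define K' where "K' = {i. Suc i \<in> K}"
  \<comment> \<open>Position 0 of the sequence holds the shell, so its constraint is separated from
    those on the rows.\<close>
  define e where "e = (if 0 \<in> K then {..r 0} else UNIV)"
  have K': "finite K'" unfolding K'_def using finite_vimageI[OF K, of Suc] by (simp add: vimage_def)
  have e: "e \<in> sets borel" by (simp add: e_def)
  have B: "{x. \<forall>i\<in>K. x i \<le> r i} \<in> sets seq_borel"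
  proof -
    have "{x \<in> space seq_borel. \<forall>i\<in>K. x i \<le> r i} \<in> sets seq_borel" using K by measurable
    then show ?thesis by (simp add: space_PiM)
  qed
  let ?f = "\<lambda>D. (\<Prod>i\<in>K'. row_cdf (r (Suc i)) (shell D)) * indicat_real e (shell D)"
  have "emeasure (distr \<kappa> seq_borel shell_rows) {x. \<forall>i\<in>K. x i \<le> r i} =
      emeasure \<kappa> (shell_rows -` {x. \<forall>i\<in>K. x i \<le> r i} \<inter> space \<kappa>)"
    by (rule emeasure_distr[OF shell_rows_measurable B])
  also have "\<dots> = ennreal (\<integral>D. indicator (shell_rows -` {x. \<forall>i\<in>K. x i \<le> r i} \<inter> space \<kappa>) D \<partial>\<kappa>)"
    using measurable_sets[OF shell_rows_measurable B] by (simp add: emeasure_eq_measure)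
  also have "(\<integral>D. indicat_real (shell_rows -` {x. \<forall>i\<in>K. x i \<le> r i} \<inter> space \<kappa>) D \<partial>\<kappa>) =
      (\<integral>D. (\<Prod>i\<in>K'. indicator {..r (Suc i)} (shell_row i D)) * indicator e (shell D) \<partial>\<kappa>)"
  proof (rule Bochner_Integration.integral_cong[OF refl])
    fix D assume D: "D \<in> space \<kappa>"
    have "D \<in> shell_rows -` {x. \<forall>i\<in>K. x i \<le> r i} \<inter> space \<kappa> \<longleftrightarrow>
        shell D \<in> e \<and> (\<forall>i\<in>K'. shell_row i D \<le> r (Suc i))"
      using D unfolding shell_rows_def e_def K'_def by (simp add: ball_case_nat)
    then show "indicat_real (shell_rows -` {x. \<forall>i\<in>K. x i \<le> r i} \<inter> space \<kappa>) D =
        (\<Prod>i\<in>K'. indicator {..r (Suc i)} (shell_row i D)) * indicator e (shell D)"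
      using K' by (auto simp: indicator_def prod_zero_iff)
  qed
  also have "\<dots> = (\<integral>D. ?f D \<partial>\<kappa>)"
    using e by (intro integral_rows[OF K', of _ 1]) (auto simp: indicator_def)
  also have "ennreal (\<integral>D. ?f D \<partial>\<kappa>) = (\<integral>\<^sup>+D. ennreal (?f D) \<partial>\<kappa>)"
  proof (rule nn_integral_eq_integral[symmetric])
    show "integrable \<kappa> ?f"
    proof (rule integrable_of_bound[where B = 1])
      show "?f \<in> borel_measurable \<kappa>"
        by (intro borel_measurable_times borel_measurable_prod measurable_compose[OF shell_measurable row_cdf_measurable]
            measurable_compose[OF shell_measurable borel_measurable_indicator[OF e]])
      show "\<bar>?f D\<bar> \<le> 1" for D
        by (intro abs_mult_le prod_nonneg prod_le_1) (auto simp: row_cdf_bounds indicator_def)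
    qed
  qed (simp add: prod_nonneg row_cdf_bounds)
  also have "\<dots> = (\<integral>\<^sup>+D. emeasure unif_seq (Pair D -` ((\<lambda>z. model_rows (shell (fst z)) (snd z)) -`
      {x. \<forall>i\<in>K. x i \<le> r i} \<inter> space (\<kappa> \<Otimes>\<^sub>M unif_seq))) \<partial>\<kappa>)"
  proof (rule nn_integral_cong)
    fix D assume D: "D \<in> space \<kappa>"
    have eq: "Pair D -` ((\<lambda>z. model_rows (shell (fst z)) (snd z)) -` {x. \<forall>i\<in>K. x i \<le> r i} \<inter> space (\<kappa> \<Otimes>\<^sub>M unif_seq)) =
        (if shell D \<in> e then {x. \<forall>i\<in>K'. x i \<in> {u. \<phi> (shell D) u \<in> {..r (Suc i)}}} else {})"
      using D unfolding model_rows_def e_def K'_def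
      by (auto simp: space_pair_measure space_unif_seq ball_case_nat)
    have "{u \<in> space borel. \<phi> (shell D) u \<in> {..r (Suc i)}} \<in> sets borel" for i
      using \<phi>_section[of "shell D"] by measurable
    then have "emeasure unif_seq {x. \<forall>i\<in>K'. x i \<in> {u. \<phi> (shell D) u \<in> {..r (Suc i)}}} =
        ennreal (\<Prod>i\<in>K'. row_cdf (r (Suc i)) (shell D))"
      using emeasure_PiM_unif_box[OF K' subset_UNIV, of "\<lambda>i. {u. \<phi> (shell D) u \<in> {..r (Suc i)}}"]
      by (simp add: row_cdf_def space_unif_seq)
    then show "ennreal (?f D) = emeasure unif_seq (Pair D -` ((\<lambda>z. model_rows (shell (fst z)) (snd z)) -`
        {x. \<forall>i\<in>K. x i \<le> r i} \<inter> space (\<kappa> \<Otimes>\<^sub>M unif_seq)))"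
      unfolding eq by (cases "shell D \<in> e") simp_all
  qed
  also have "\<dots> = emeasure (\<kappa> \<Otimes>\<^sub>M unif_seq) ((\<lambda>z. model_rows (shell (fst z)) (snd z)) -`
      {x. \<forall>i\<in>K. x i \<le> r i} \<inter> space (\<kappa> \<Otimes>\<^sub>M unif_seq))"
    by (rule PU.emeasure_pair_measure_alt[symmetric])
      (rule measurable_sets[OF model_rows_measurable[OF shell_measurable] B])
  also have "\<dots> = emeasure (distr (\<kappa> \<Otimes>\<^sub>M unif_seq) seq_borel (\<lambda>z. model_rows (shell (fst z)) (snd z))) {x. \<forall>i\<in>K. x i \<le> r i}"
    by (rule emeasure_distr[OF model_rows_measurable[OF shell_measurable] B, symmetric])
  finally show "emeasure (distr \<kappa> seq_borel shell_rows) {x. \<forall>i\<in>K. x i \<le> r i} =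
    emeasure (distr (\<kappa> \<Otimes>\<^sub>M unif_seq) seq_borel (\<lambda>z. model_rows (shell (fst z)) (snd z))) {x. \<forall>i\<in>K. x i \<le> r i}" .
qed simp_all

definition model_cdf :: "real \<Rightarrow> nat \<times> nat \<Rightarrow> real \<Rightarrow> (nat \<Rightarrow> real) \<Rightarrow> real" where
  "model_cdf r p s x = pair_cdf r (sort_obs ((s, \<phi> s (x (fst p))), \<phi> s (x (snd p))))"

text \<open>Probability of a box in the model whose shell is frozen at \<open>s\<close>: the points
  are drawn independently, and given them the entries are independent, whence the product.\<close>

definition quenched :: "(nat \<times> nat) set \<Rightarrow> (nat \<times> nat \<Rightarrow> real) \<Rightarrow> real \<Rightarrow> real" where
  "quenched J r s = (\<integral>x. (\<Prod>p\<in>J. model_cdf (r p) p s x) \<partial>unif_seq)"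

lemma model_cdf_bounds: "0 \<le> model_cdf r p s x" "model_cdf r p s x \<le> 1"
  by (simp_all add: model_cdf_def pair_cdf_bounds)

lemma model_cdf_measurable:
  assumes f: "f \<in> borel_measurable N"
  shows "(\<lambda>z. model_cdf r p (f (fst z)) (snd z)) \<in> borel_measurable (N \<Otimes>\<^sub>M unif_seq)"
proof -
  have f': "(\<lambda>z. f (fst z)) \<in> borel_measurable (N \<Otimes>\<^sub>M unif_seq)"
    by (rule measurable_compose[OF measurable_fst f])
  have x: "(\<lambda>z. snd z k) \<in> borel_measurable (N \<Otimes>\<^sub>M unif_seq)" for k
    by (rule measurable_compose[OF measurable_snd component_unif_seq])
  show ?thesis
    unfolding model_cdf_def
    by (intro measurable_compose[OF _ pair_cdf_measurable] measurable_compose[OF _ sort_obs_measurable]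
        measurable_Pair f' \<phi>_compose x)
qed

lemma quenched_measurable: "quenched J r \<in> borel_measurable borel"
proof -
  interpret PU: prob_space unif_seq by (rule prob_space_unif_seq)
  have "(\<lambda>(s, x). \<Prod>p\<in>J. model_cdf (r p) p s x) \<in> borel_measurable (borel \<Otimes>\<^sub>M unif_seq)"
    using borel_measurable_prod[of J "\<lambda>p z. model_cdf (r p) p (fst z) (snd z)" "borel \<Otimes>\<^sub>M unif_seq"]
      model_cdf_measurable[of "\<lambda>s. s" borel] by (simp add: split_beta')
  then show ?thesis unfolding quenched_def[abs_def] by (rule PU.borel_measurable_lebesgue_integral)
qed

lemma model_cdf_section: "model_cdf r p s \<in> borel_measurable unif_seq"
proof -
  have "(\<lambda>z. model_cdf r p (fst z) (snd z)) \<in> borel_measurable (borel \<Otimes>\<^sub>M unif_seq)"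
    by (rule model_cdf_measurable) simp
  from measurable_Pair2[OF this, of s] show ?thesis by simp
qed

lemma quenched_bounds: "0 \<le> quenched J r s" "quenched J r s \<le> 1"
proof -
  interpret PU: prob_space unif_seq by (rule prob_space_unif_seq)
  show "0 \<le> quenched J r s" unfolding quenched_def
    by (intro integral_nonneg_AE AE_I2 prod_nonneg) (simp add: model_cdf_bounds)
  have "(\<lambda>x. \<Prod>p\<in>J. model_cdf (r p) p s x) \<in> borel_measurable unif_seq"
    by (intro borel_measurable_prod model_cdf_section)
  moreover have b: "0 \<le> (\<Prod>p\<in>J. model_cdf (r p) p s x)" "(\<Prod>p\<in>J. model_cdf (r p) p s x) \<le> 1" for x
    by (intro prod_nonneg prod_le_1; simp add: model_cdf_bounds)+
  ultimately have "integrable unif_seq (\<lambda>x. \<Prod>p\<in>J. model_cdf (r p) p s x)"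
    by (intro PU.integrable_of_bound[where B = 1]) (auto simp: abs_of_nonneg)
  then show "quenched J r s \<le> 1" unfolding quenched_def by (rule PU.integral_le_const) (simp add: b)
qed

text \<open>The distances between points form the array over the even indices, which has the law of
  the whole array by relabelling \<open>n\<close> to \<open>2 * n\<close>. The shell lives on the
  odd indices and is therefore independent of it.\<close>

lemma integral_dissociated:
  assumes J: "finite J" and A: "A \<in> sets borel"
  shows "(\<integral>D. (\<Prod>p\<in>J. indicator {..r p} (D (2 * fst p) (2 * snd p))) * indicator A (shell D) \<partial>\<kappa>) =
    measure \<kappa> (mbox J r) * (\<integral>D. indicator A (shell D) \<partial>\<kappa>)"
proof -
  define E where "E = relabel (\<lambda>n. 2 * n) -` mbox J r \<inter> space \<kappa>"
  define F where "F = shell -` A \<inter> space \<kappa>"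
  have E_eq: "E = mbox ((\<lambda>p. (2 * fst p, 2 * snd p)) ` J) (\<lambda>q. r (fst q div 2, snd q div 2))"
    by (auto simp: E_def mbox_def relabel_def space_eq M_inf_def split: prod.splits)
  have "E \<in> sets (ent (Collect even \<times> Collect even))"
    unfolding E_eq using J by (intro mbox_measurable) (auto intro!: entry_measurable)
  moreover have "F \<in> sets (ent (Collect odd \<times> Collect odd))"
  proof -
    have "shell \<in> borel_measurable (ent (Collect odd \<times> Collect odd))"
      by (rule shell_measurable_ent) (auto simp: odd_pairs_def)
    from measurable_sets[OF this A] show ?thesis by (simp add: F_def space_eq)
  qed
  ultimately have EF: "measure \<kappa> (E \<inter> F) = measure \<kappa> E * measure \<kappa> F"
    by (intro chi_closure_dissociated[OF in_closure]) auto
  have mb: "mbox J r \<in> sets \<kappa>"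
    using J by (intro mbox_measurable space_eq) (auto intro: entry_measurable_kappa)
  have "measure \<kappa> E = measure (distr \<kappa> \<kappa> (relabel (\<lambda>n. 2 * n))) (mbox J r)"
    unfolding E_def by (rule measure_distr[OF relabel_measurable_kappa mb, symmetric])
  also have "\<dots> = measure \<kappa> (mbox J r)" by (subst distr_relabel) (auto simp: inj_def)
  finally have E: "measure \<kappa> E = measure \<kappa> (mbox J r)" .
  have Es: "E \<in> sets \<kappa>" unfolding E_def by (rule measurable_sets[OF relabel_measurable_kappa mb])
  have Fs: "F \<in> sets \<kappa>" unfolding F_def by (rule measurable_sets[OF shell_measurable A])
  have "(\<integral>D. (\<Prod>p\<in>J. indicator {..r p} (D (2 * fst p) (2 * snd p))) * indicator A (shell D) \<partial>\<kappa>) =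
      (\<integral>D. indicat_real (E \<inter> F) D \<partial>\<kappa>)"
  proof (rule Bochner_Integration.integral_cong[OF refl])
    fix D assume D: "D \<in> space \<kappa>"
    have "D \<in> E \<longleftrightarrow> (\<forall>p\<in>J. D (2 * fst p) (2 * snd p) \<le> r p)"
    proof -
      have "relabel (\<lambda>n. 2 * n) D \<in> M_inf" using D by (intro relabel_M_inf) (simp add: space_eq)
      moreover have "relabel (\<lambda>n. 2 * n) D i j = D (2 * i) (2 * j)" for i j by (simp add: relabel_def)
      ultimately show ?thesis using D by (auto simp: E_def mbox_def)
    qed
    then show "(\<Prod>p\<in>J. indicator {..r p} (D (2 * fst p) (2 * snd p))) * indicator A (shell D) = indicat_real (E \<inter> F) D"
      using D J by (auto simp: F_def indicator_def prod_zero_iff)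
  qed
  also have "\<dots> = measure \<kappa> E * measure \<kappa> F"
    using Es Fs sets.sets_into_space[OF Es] by (simp add: EF[symmetric] Int_absorb2 le_infI1)
  also have "measure \<kappa> F = (\<integral>D. indicat_real F D \<partial>\<kappa>)" using Fs sets.sets_into_space[OF Fs] by (simp add: Int_absorb2)
  also have "\<dots> = (\<integral>D. indicator A (shell D) \<partial>\<kappa>)"
    by (rule Bochner_Integration.integral_cong) (auto simp: F_def indicator_def)
  finally show ?thesis unfolding E .
qed

text \<open>Rows made from noise are exchanged for the true rows by \<open>distr_shell_rows\<close>,
  conditional probabilities for the true distances by \<open>integral_pairs\<close>; dissociation
  then separates these from the shell.\<close>

lemma integral_quenched:
  assumes J: "finite J" "J \<subseteq> {(i, j). i < j}" and A: "A \<in> sets borel"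
  shows "(\<integral>D. quenched J r (shell D) * indicator A (shell D) \<partial>\<kappa>) =
    measure \<kappa> (mbox J r) * (\<integral>D. indicator A (shell D) \<partial>\<kappa>)"
proof -
  interpret PU: prob_space unif_seq by (rule prob_space_unif_seq)
  interpret P: pair_prob_space \<kappa> unif_seq ..
  \<comment> \<open>Depends on the sequence of shell and rows alone, so its integral can be carried
    from one side of \<open>distr_shell_rows\<close> to the other.\<close>
  define H where "H z = (\<Prod>p\<in>J. pair_cdf (r p) (sort_obs ((z 0, z (Suc (fst p))), z (Suc (snd p))))) * indicat_real A (z 0)"
    for z :: "nat \<Rightarrow> real"
  have c: "(\<lambda>z. z k) \<in> borel_measurable seq_borel" for k :: nat by (rule measurable_component_singleton) simp
  have Hm: "H \<in> borel_measurable seq_borel"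
    unfolding H_def[abs_def]
    by (intro borel_measurable_times borel_measurable_prod measurable_compose[OF _ pair_cdf_measurable]
        measurable_compose[OF _ sort_obs_measurable] measurable_Pair c
        measurable_compose[OF c borel_measurable_indicator[OF A]])
  let ?f = "\<lambda>z. (\<Prod>p\<in>J. model_cdf (r p) p (shell (fst z)) (snd z)) * indicat_real A (shell (fst z))"
  have fm: "?f \<in> borel_measurable (\<kappa> \<Otimes>\<^sub>M unif_seq)"
    by (intro borel_measurable_times borel_measurable_prod model_cdf_measurable shell_measurable
        measurable_compose[OF measurable_compose[OF measurable_fst shell_measurable] borel_measurable_indicator[OF A]])
  have fi: "integrable (\<kappa> \<Otimes>\<^sub>M unif_seq) ?f"
    by (rule P.integrable_of_bound[OF fm, where B = 1])
      (intro abs_mult_le prod_nonneg prod_le_1, auto simp: model_cdf_bounds indicator_def)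
  have "(\<integral>D. quenched J r (shell D) * indicator A (shell D) \<partial>\<kappa>) = (\<integral>D. (\<integral>x. ?f (D, x) \<partial>unif_seq) \<partial>\<kappa>)"
    by (simp add: quenched_def)
  also have "\<dots> = (\<integral>z. ?f z \<partial>(\<kappa> \<Otimes>\<^sub>M unif_seq))" by (rule P.integral_fst'[OF fi])
  also have "\<dots> = (\<integral>z. H (model_rows (shell (fst z)) (snd z)) \<partial>(\<kappa> \<Otimes>\<^sub>M unif_seq))"
    by (simp add: H_def model_rows_def model_cdf_def)
  also have "\<dots> = (\<integral>z. H z \<partial>distr (\<kappa> \<Otimes>\<^sub>M unif_seq) seq_borel (\<lambda>z. model_rows (shell (fst z)) (snd z)))"
    by (rule integral_distr[OF model_rows_measurable[OF shell_measurable] Hm, symmetric])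
  also have "\<dots> = (\<integral>z. H z \<partial>distr \<kappa> seq_borel shell_rows)" unfolding distr_shell_rows ..
  also have "\<dots> = (\<integral>D. H (shell_rows D) \<partial>\<kappa>)" by (rule integral_distr[OF shell_rows_measurable Hm])
  also have "\<dots> = (\<integral>D. (\<Prod>p\<in>J. obs_cdf (fst p) (snd p) (r p) D) * indicator A (shell D) \<partial>\<kappa>)"
    by (simp add: H_def shell_rows_def obs_cdf_def pair_obs_def)
  also have "\<dots> = (\<integral>D. (\<Prod>p\<in>J. indicator {..r p} (D (2 * fst p) (2 * snd p))) * indicator A (shell D) \<partial>\<kappa>)"
  proof (rule integral_pairs[OF J, symmetric])
    show "(\<lambda>D. indicat_real A (shell D)) \<in> borel_measurable (ent (off_pair (fst p) (snd p)))" for p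
      by (rule measurable_compose[OF shell_measurable_ent[OF odd_pairs_subset(2)] borel_measurable_indicator[OF A]])
    show "(\<lambda>D. indicat_real A (shell D)) \<in> borel_measurable \<kappa>"
      by (rule measurable_compose[OF shell_measurable borel_measurable_indicator[OF A]])
    show "\<bar>indicat_real A (shell D)\<bar> \<le> 1" for D by (simp add: indicator_def)
  qed
  also have "\<dots> = measure \<kappa> (mbox J r) * (\<integral>D. indicator A (shell D) \<partial>\<kappa>)"
    by (rule integral_dissociated[OF J(1) A])
  finally show ?thesis .
qed

lemma AE_quenched:
  assumes J: "finite J" "J \<subseteq> {(i, j). i < j}"
  shows "AE s in distr \<kappa> borel shell. quenched J r s = measure \<kappa> (mbox J r)"
proof -
  interpret S: prob_space "distr \<kappa> borel shell" by (rule prob_space_distr[OF shell_measurable])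
  show ?thesis
  proof (rule density_unique_real)
    show "integrable (distr \<kappa> borel shell) (quenched J r)"
      by (rule S.integrable_of_bound[where B = 1]) (auto simp: quenched_measurable abs_of_nonneg quenched_bounds)
    show "integrable (distr \<kappa> borel shell) (\<lambda>_. measure \<kappa> (mbox J r))" by simp
    fix A assume "A \<in> sets (distr \<kappa> borel shell)"
    then have A: "A \<in> sets borel" by simp
    have "(\<integral>s\<in>A. quenched J r s \<partial>distr \<kappa> borel shell) = (\<integral>D. indicator A (shell D) * quenched J r (shell D) \<partial>\<kappa>)"
      unfolding set_lebesgue_integral_def real_scaleR_def
      by (rule integral_distr[OF shell_measurable]) (intro borel_measurable_times borel_measurable_indicator A quenched_measurable)
    also have "\<dots> = measure \<kappa> (mbox J r) * (\<integral>D. indicator A (shell D) \<partial>\<kappa>)"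
      using integral_quenched[OF J A, of r] by (simp add: mult.commute)
    also have "\<dots> = (\<integral>D. indicator A (shell D) * measure \<kappa> (mbox J r) \<partial>\<kappa>)" by simp
    also have "\<dots> = (\<integral>s\<in>A. measure \<kappa> (mbox J r) \<partial>distr \<kappa> borel shell)"
      unfolding set_lebesgue_integral_def real_scaleR_def
      by (rule integral_distr[OF shell_measurable, symmetric]) (intro borel_measurable_times borel_measurable_indicator A borel_measurable_const)
    finally show "(\<integral>s\<in>A. quenched J r s \<partial>distr \<kappa> borel shell) = (\<integral>s\<in>A. measure \<kappa> (mbox J r) \<partial>distr \<kappa> borel shell)" .
  qed
qed

text \<open>With rational bounds there are countably many conditions, each valid for almost every
  shell; together they still hold almost surely, hence for some value.\<close>

lemma exists_good_shell:
  "\<exists>s. \<forall>J r. finite J \<longrightarrow> J \<subseteq> {(i, j). i < j} \<longrightarrow>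
    quenched J (\<lambda>p. of_rat (r p)) s = measure \<kappa> (mbox J (\<lambda>p. of_rat (r p)))"
proof -
  interpret S: prob_space "distr \<kappa> borel shell" by (rule prob_space_distr[OF shell_measurable])
  \<comment> \<open>Lists of indices with bounds encode all finite families in a countable type.
    Intersecting with the upper triangle makes every list admissible, so that the quantifier runs
    over the whole type.\<close>
  define J where "J l = fst ` set l \<inter> {(i, j). i < j}" for l :: "((nat \<times> nat) \<times> rat) list"
  define r where "r l p = real_of_rat (the (map_of l p))" for l :: "((nat \<times> nat) \<times> rat) list" and p
  have "AE s in distr \<kappa> borel shell. \<forall>l. quenched (J l) (r l) s = measure \<kappa> (mbox (J l) (r l))"
    unfolding AE_all_countable by (intro allI AE_quenched) (auto simp: J_def)
  then have "\<exists>s. \<forall>l. quenched (J l) (r l) s = measure \<kappa> (mbox (J l) (r l))"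
  proof -
    assume ae: "AE s in distr \<kappa> borel shell. \<forall>l. quenched (J l) (r l) s = measure \<kappa> (mbox (J l) (r l))"
    show ?thesis
    proof (rule ccontr)
      assume no: "\<nexists>s. \<forall>l. quenched (J l) (r l) s = measure \<kappa> (mbox (J l) (r l))"
      have "AE s in distr \<kappa> borel shell. False" by (rule eventually_mono[OF ae]) (use no in blast)
      then show False by (simp only: S.AE_False)
    qed
  qed
  then obtain s where s: "\<And>l. quenched (J l) (r l) s = measure \<kappa> (mbox (J l) (r l))" by blast
  show ?thesis
  proof (intro exI[of _ s] allI impI)
    fix K :: "(nat \<times> nat) set" and q :: "nat \<times> nat \<Rightarrow> rat"
    assume K: "finite K" "K \<subseteq> {(i, j). i < j}"
    obtain xs where xs: "set xs = K" using finite_list[OF K(1)] by blast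
    define l where "l = map (\<lambda>p. (p, q p)) xs"
    have J: "J l = K" using K(2) xs by (force simp: J_def l_def image_image)
    have rq: "r l p = of_rat (q p)" if "p \<in> K" for p
      using that xs by (simp add: r_def l_def map_of_map_restrict)
    have "quenched K (r l) s = quenched K (\<lambda>p. of_rat (q p)) s"
      unfolding quenched_def using rq by (simp cong: prod.cong)
    moreover have "mbox K (r l) = mbox K (\<lambda>p. of_rat (q p))"
      using rq by (auto simp: mbox_def)
    ultimately show "quenched K (\<lambda>p. of_rat (q p)) s = measure \<kappa> (mbox K (\<lambda>p. of_rat (q p)))"
      using s[of l] by (simp add: J)
  qed
qed

end

section \<open>The qmm-space of a family of random lengths\<close>

lemma PiM_distr:
  assumes M: "\<And>i. i \<in> I \<Longrightarrow> prob_space (M i)" and f: "\<And>i. i \<in> I \<Longrightarrow> f i \<in> M i \<rightarrow>\<^sub>M N i"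
  shows "distr (PiM I M) (PiM I N) (\<lambda>\<omega>. \<lambda>i\<in>I. f i (\<omega> i)) = PiM I (\<lambda>i. distr (M i) (N i) (f i))"
proof (rule measure_eqI_PiM_infinite[where M = N])
  have fm: "(\<lambda>\<omega>. \<lambda>i\<in>I. f i (\<omega> i)) \<in> PiM I M \<rightarrow>\<^sub>M PiM I N"
    by (intro measurable_restrict) (rule measurable_compose[OF measurable_component_singleton[of _ I M] f])
  interpret P: prob_space "PiM I M" by (intro prob_space_PiM M)
  interpret D: prob_space "distr (PiM I M) (PiM I N) (\<lambda>\<omega>. \<lambda>i\<in>I. f i (\<omega> i))" by (rule P.prob_space_distr[OF fm])
  show "finite_measure (distr (PiM I M) (PiM I N) (\<lambda>\<omega>. \<lambda>i\<in>I. f i (\<omega> i)))" by (rule D.finite_measure_axioms)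
  show "sets (PiM I (\<lambda>i. distr (M i) (N i) (f i))) = sets (PiM I N)" by (intro sets_PiM_cong) auto
  fix A J assume J: "finite J" "J \<subseteq> I" and A: "\<And>i. i \<in> J \<Longrightarrow> A i \<in> sets (N i)"
  have "emeasure (distr (PiM I M) (PiM I N) (\<lambda>\<omega>. \<lambda>i\<in>I. f i (\<omega> i))) (prod_emb I N J (Pi\<^sub>E J A)) =
      emeasure (PiM I M) ((\<lambda>\<omega>. \<lambda>i\<in>I. f i (\<omega> i)) -` prod_emb I N J (Pi\<^sub>E J A) \<inter> space (PiM I M))"
    using J A by (intro emeasure_distr[OF fm] sets_PiM_I) auto
  also have "(\<lambda>\<omega>. \<lambda>i\<in>I. f i (\<omega> i)) -` prod_emb I N J (Pi\<^sub>E J A) \<inter> space (PiM I M) =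
      prod_emb I M J (Pi\<^sub>E J (\<lambda>i. f i -` A i \<inter> space (M i)))"
    using J measurable_space[OF f] by (auto simp: prod_emb_def space_PiM PiE_iff subset_iff)
  also have "emeasure (PiM I M) \<dots> = (\<Prod>i\<in>J. emeasure (M i) (f i -` A i \<inter> space (M i)))"
    using J A f by (intro emeasure_PiM_emb M measurable_sets[of "f _"]) auto
  also have "\<dots> = (\<Prod>i\<in>J. emeasure (distr (M i) (N i) (f i)) (A i))"
    using J A f by (intro prod.cong refl emeasure_distr[symmetric]) auto
  also have "\<dots> = emeasure (PiM I (\<lambda>i. distr (M i) (N i) (f i))) (prod_emb I (\<lambda>i. distr (M i) (N i) (f i)) J (Pi\<^sub>E J A))"
    using J A M f by (intro emeasure_PiM_emb[symmetric] prob_space.prob_space_distr) auto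
  also have "prod_emb I (\<lambda>i. distr (M i) (N i) (f i)) J (Pi\<^sub>E J A) = prod_emb I N J (Pi\<^sub>E J A)"
    by (simp add: prod_emb_def)
  finally show "emeasure (distr (PiM I M) (PiM I N) (\<lambda>\<omega>. \<lambda>i\<in>I. f i (\<omega> i))) (prod_emb I N J (Pi\<^sub>E J A)) =
    emeasure (PiM I (\<lambda>i. distr (M i) (N i) (f i))) (prod_emb I N J (Pi\<^sub>E J A))" .
qed simp

text \<open>Splits off one coordinate while \<open>q\<close> reads the others, so that it can be
  iterated: a component as \<open>q\<close> gives the law of a pair, a pair as \<open>q\<close> that
  of a triple.\<close>

lemma distr_PiM_component_pair:
  assumes M: "\<And>i. i \<in> I \<Longrightarrow> prob_space (M i)" and i: "i \<in> I"
    and q: "q \<in> PiM (I - {i}) M \<rightarrow>\<^sub>M N"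
  shows "distr (PiM I M) (M i \<Otimes>\<^sub>M N) (\<lambda>\<omega>. (\<omega> i, q (restrict \<omega> (I - {i})))) = M i \<Otimes>\<^sub>M distr (PiM (I - {i}) M) N q"
proof -
  let ?I = "I - {i}"
  have I: "insert i ?I = I" using i by auto
  interpret P: prob_space "PiM ?I M" by (intro prob_space_PiM M) auto
  interpret D: prob_space "distr (PiM ?I M) N q" by (rule P.prob_space_distr[OF q])
  have PI: "PiM I M = distr (M i \<Otimes>\<^sub>M PiM ?I M) (PiM I M) (\<lambda>(x, X). X(i := x))"
  proof -
    have "distr (M i \<Otimes>\<^sub>M PiM ?I M) (PiM (insert i ?I) M) (\<lambda>(x, X). X(i := x)) = PiM (insert i ?I) M"
      by (rule distr_pair_PiM_eq_PiM) (use M i in auto)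
    then show ?thesis unfolding I by (rule sym)
  qed
  have m1: "(\<lambda>(x, X). X(i := x)) \<in> M i \<Otimes>\<^sub>M PiM ?I M \<rightarrow>\<^sub>M PiM I M"
    using measurable_compose[OF measurable_Pair[OF measurable_snd measurable_fst] measurable_add_dim[of i ?I M]]
    unfolding I by (simp add: split_beta')
  have m2: "(\<lambda>\<omega>. (\<omega> i, q (restrict \<omega> ?I))) \<in> PiM I M \<rightarrow>\<^sub>M M i \<Otimes>\<^sub>M N"
    by (intro measurable_Pair measurable_component_singleton i measurable_compose[OF measurable_restrict_subset q]) auto
  have "distr (PiM I M) (M i \<Otimes>\<^sub>M N) (\<lambda>\<omega>. (\<omega> i, q (restrict \<omega> ?I))) =
      distr (M i \<Otimes>\<^sub>M PiM ?I M) (M i \<Otimes>\<^sub>M N) ((\<lambda>\<omega>. (\<omega> i, q (restrict \<omega> ?I))) \<circ> (\<lambda>(x, X). X(i := x)))"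
    by (subst PI) (rule distr_distr[OF m2 m1])
  also have "\<dots> = distr (M i \<Otimes>\<^sub>M PiM ?I M) (M i \<Otimes>\<^sub>M N) (\<lambda>(x, X). (x, q X))"
  proof (intro distr_cong refl)
    fix z assume "z \<in> space (M i \<Otimes>\<^sub>M PiM ?I M)"
    then obtain x X where z: "z = (x, X)" "X \<in> extensional ?I" by (auto simp: space_pair_measure space_PiM PiE_def)
    have "restrict (X(i := x)) ?I = X"
      using z(2) by (auto simp: restrict_def extensional_def fun_eq_iff)
    then show "((\<lambda>\<omega>. (\<omega> i, q (restrict \<omega> ?I))) \<circ> (\<lambda>(x, X). X(i := x))) z = (case z of (x, X) \<Rightarrow> (x, q X))"
      by (simp add: z)
  qed
  also have "\<dots> = distr (M i) (M i) (\<lambda>x. x) \<Otimes>\<^sub>M distr (PiM ?I M) N q"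
    by (rule pair_measure_distr[symmetric, OF measurable_ident_sets[OF refl] q D.sigma_finite_measure_axioms])
  finally show ?thesis by (simp add: distr_id2)
qed

lemma distr_PiM_pair:
  assumes M: "\<And>i. i \<in> I \<Longrightarrow> prob_space (M i)" and ij: "i \<in> I" "j \<in> I" "i \<noteq> j"
  shows "distr (PiM I M) (M i \<Otimes>\<^sub>M M j) (\<lambda>\<omega>. (\<omega> i, \<omega> j)) = M i \<Otimes>\<^sub>M M j"
proof -
  have q: "(\<lambda>\<omega>. \<omega> j) \<in> PiM (I - {i}) M \<rightarrow>\<^sub>M M j" using ij by (intro measurable_component_singleton) auto
  have "distr (PiM (I - {i}) M) (M j) (\<lambda>\<omega>. \<omega> j) = M j" using ij by (intro distr_PiM_component M) auto
  then show ?thesis using distr_PiM_component_pair[OF M ij(1) q] ij by simp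
qed

lemma distr_PiM_triple:
  assumes M: "\<And>i. i \<in> I \<Longrightarrow> prob_space (M i)" and ijk: "i \<in> I" "j \<in> I" "k \<in> I" "i \<noteq> j" "i \<noteq> k" "j \<noteq> k"
  shows "distr (PiM I M) (M i \<Otimes>\<^sub>M M j \<Otimes>\<^sub>M M k) (\<lambda>\<omega>. (\<omega> i, \<omega> j, \<omega> k)) = M i \<Otimes>\<^sub>M M j \<Otimes>\<^sub>M M k"
proof -
  have q: "(\<lambda>\<omega>. (\<omega> j, \<omega> k)) \<in> PiM (I - {i}) M \<rightarrow>\<^sub>M M j \<Otimes>\<^sub>M M k"
    using ijk by (intro measurable_Pair measurable_component_singleton) auto
  have "distr (PiM (I - {i}) M) (M j \<Otimes>\<^sub>M M k) (\<lambda>\<omega>. (\<omega> j, \<omega> k)) = M j \<Otimes>\<^sub>M M k"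
    using ijk by (intro distr_PiM_pair M) auto
  then show ?thesis using distr_PiM_component_pair[OF M ijk(1) q] ijk by simp
qed

lemma AE_unif_neq: "AE u in unif. u \<noteq> c"
  unfolding unif_def by (rule AE_uniform_measureI) (auto intro: eventually_mono[OF AE_lborel_singleton])

text \<open>Sampled points almost surely never coincide, so prescribing lengths on the diagonal does
  not change the law of the sampled matrix.\<close>

lemma AE_unif_seq_distinct: "AE x in unif_seq. \<forall>i j. i \<noteq> j \<longrightarrow> x i \<noteq> x j"
proof -
  interpret U: prob_space unif by (rule prob_space_unif)
  interpret UU: pair_prob_space unif unif ..
  have S: "{z \<in> space (unif \<Otimes>\<^sub>M unif). fst z \<noteq> snd z} \<in> sets (unif \<Otimes>\<^sub>M unif)" by measurable
  have ne: "AE z in unif \<Otimes>\<^sub>M unif. fst z \<noteq> snd z"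
    by (rule UU.AE_pair_measure[OF S]) (auto intro!: AE_I2 eventually_mono[OF AE_unif_neq])
  have "AE x in unif_seq. i \<noteq> j \<longrightarrow> x i \<noteq> x j" for i j :: nat
  proof (cases "i = j")
    case False
    have m: "(\<lambda>x. (x i, x j)) \<in> unif_seq \<rightarrow>\<^sub>M unif \<Otimes>\<^sub>M unif"
      by (intro measurable_Pair measurable_component_singleton) auto
    have d: "distr unif_seq (unif \<Otimes>\<^sub>M unif) (\<lambda>x. (x i, x j)) = unif \<Otimes>\<^sub>M unif"
      by (rule distr_PiM_pair) (use False prob_space_unif in auto)
    have "AE z in distr unif_seq (unif \<Otimes>\<^sub>M unif) (\<lambda>x. (x i, x j)). fst z \<noteq> snd z"
      unfolding d by (rule ne)
    then show ?thesis unfolding AE_distr_iff[OF m S] by simp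
  qed simp
  then show ?thesis by (simp add: AE_all_countable)
qed

lemma standard_borel_unif: "standard_borel unif"
  unfolding standard_borel_def
proof (intro exI[of _ "euclidean :: real topology"] conjI)
  show "completely_metrizable_space (euclidean :: real topology)" by (rule completely_metrizable_space_euclidean)
  show "separable (euclidean :: real topology)"
    unfolding separable_def by (intro exI[of _ "\<rat>"]) (simp add: countable_rat Rats_closure_real)
  show "sets unif = sets (borel_of (euclidean :: real topology))" by (simp add: borel_of_def borel_def)
qed simp

section \<open>Spaces whose lengths are functions of two uniform points and uniform noise\<close>

abbreviation unit_borel :: "real measure" where
  "unit_borel \<equiv> restrict_space borel {0..1}"

lemma id_unit_borel: "(\<lambda>t. t) \<in> borel_measurable unit_borel"
  by (rule measurable_restrict_space1) simp

lemma measurable_unit_borelI: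
  "f \<in> borel_measurable N \<Longrightarrow> (\<And>x. x \<in> space N \<Longrightarrow> 0 \<le> f x \<and> f x \<le> 1) \<Longrightarrow> f \<in> N \<rightarrow>\<^sub>M unit_borel"
  by (rule measurable_restrict_space2) auto

locale length_model =
  fixes g :: "real \<Rightarrow> real \<Rightarrow> real \<Rightarrow> real"
  assumes g_measurable: "(\<lambda>z. g (fst (fst z)) (snd (fst z)) (snd z)) \<in> borel_measurable ((borel \<Otimes>\<^sub>M borel) \<Otimes>\<^sub>M borel)"
    and g_bounds: "0 \<le> g u v w \<and> g u v w \<le> 1"
    and g_sym: "g u v w = g v u w"
    and g_diag: "g u u w = 0"
begin

definition dist_law :: "real \<Rightarrow> real \<Rightarrow> real measure" where
  "dist_law u v = distr unif unit_borel (g u v)"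

lemma g_compose:
  assumes "a \<in> borel_measurable N" "b \<in> borel_measurable N" "c \<in> borel_measurable N"
  shows "(\<lambda>x. g (a x) (b x) (c x)) \<in> borel_measurable N"
  using measurable_compose[OF measurable_Pair[OF measurable_Pair[OF assms(1,2)] assms(3)] g_measurable] by simp

lemma g_section: "g u v \<in> borel_measurable borel"
  using g_compose[OF measurable_const[of u borel] measurable_const[of v borel] measurable_ident_sets[OF refl]] by simp

lemma g_unit: "g u v \<in> unif \<rightarrow>\<^sub>M unit_borel"
proof (rule measurable_unit_borelI[OF _ g_bounds])
  show "g u v \<in> borel_measurable unif"
    unfolding measurable_cong_sets[OF sets_unif refl] by (rule g_section)
qed

lemma prob_dist_law: "prob_space (dist_law u v)"
  unfolding dist_law_def by (rule prob_space.prob_space_distr[OF prob_space_unif g_unit])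

text \<open>Integrals of a continuous function against \<open>dist_law u v\<close> are integrals
  over the noise, measurable in the pair of points as parameter integrals;
  \<open>measurable_weak_topology\<close> asks for no more.\<close>

lemma dist_law_measurable: "(\<lambda>(u, v). dist_law u v) \<in> unif \<Otimes>\<^sub>M unif \<rightarrow>\<^sub>M borel_of (weak_topology {0..1})"
proof (rule measurable_weak_topology)
  interpret U: prob_space unif by (rule prob_space_unif)
  show "(case z of (u, v) \<Rightarrow> dist_law u v) \<in> prob_measures {0..1}" for z
    by (cases z) (simp add: prob_measures_def prob_dist_law, simp add: dist_law_def)
  fix f :: "real \<Rightarrow> real" assume f: "continuous_on {0..1} f"
  have fm: "f \<in> borel_measurable unit_borel" by (rule borel_measurable_continuous_on_restrict[OF f])
  have *: "(\<integral>t. f t \<partial>(case z of (u, v) \<Rightarrow> dist_law u v)) = (\<integral>w. f (g (fst z) (snd z) w) \<partial>unif)" for z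
    by (cases z) (simp add: dist_law_def integral_distr[OF g_unit fm])
  have "(\<lambda>z. g (fst (fst z)) (snd (fst z)) (snd z)) \<in> (unif \<Otimes>\<^sub>M unif) \<Otimes>\<^sub>M unif \<rightarrow>\<^sub>M unit_borel"
  proof (rule measurable_unit_borelI[OF g_compose g_bounds])
    show "(\<lambda>z. fst (fst z)) \<in> borel_measurable ((unif \<Otimes>\<^sub>M unif) \<Otimes>\<^sub>M unif)" by measurable
    show "(\<lambda>z. snd (fst z)) \<in> borel_measurable ((unif \<Otimes>\<^sub>M unif) \<Otimes>\<^sub>M unif)" by measurable
    show "snd \<in> borel_measurable ((unif \<Otimes>\<^sub>M unif) \<Otimes>\<^sub>M unif)" by measurable
  qed
  from measurable_compose[OF this fm]
  have "(\<lambda>(z, w). f (g (fst z) (snd z) w)) \<in> borel_measurable ((unif \<Otimes>\<^sub>M unif) \<Otimes>\<^sub>M unif)"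
    by (simp add: split_beta')
  then show "(\<lambda>z. \<integral>t. f t \<partial>(case z of (u, v) \<Rightarrow> dist_law u v)) \<in> borel_measurable (unif \<Otimes>\<^sub>M unif)"
    unfolding * by (rule U.borel_measurable_lebesgue_integral)
qed

abbreviation upper :: "(nat \<times> nat) set" where
  "upper \<equiv> {(i, j). i < j}"

abbreviation noise :: "(nat \<times> nat \<Rightarrow> real) measure" where
  "noise \<equiv> PiM upper (\<lambda>_. unif)"

definition model_matrix :: "(nat \<Rightarrow> real) \<Rightarrow> (nat \<times> nat \<Rightarrow> real) \<Rightarrow> nat \<Rightarrow> nat \<Rightarrow> real" where
  "model_matrix x \<omega> = matrix_of_upper (\<lambda>p\<in>upper. g (x (fst p)) (x (snd p)) (\<omega> p))"

lemma prob_space_noise: "prob_space noise"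
  by (rule prob_space_PiM) (rule prob_space_unif)

lemma component_noise: "p \<in> upper \<Longrightarrow> (\<lambda>\<omega>. \<omega> p) \<in> borel_measurable noise"
  using measurable_component_singleton[of p upper "\<lambda>_. unif"] by (simp add: measurable_cong_sets[OF refl sets_unif])

lemma matrix_of_upper_measurable: "matrix_of_upper \<in> PiM upper (\<lambda>_. unit_borel) \<rightarrow>\<^sub>M M_inf_borel"
proof (rule measurable_M_inf_borelI)
  show "matrix_of_upper l \<in> M_inf" if "l \<in> space (PiM upper (\<lambda>_. unit_borel))" for l
    using that by (auto simp: M_inf_def matrix_of_upper_def space_PiM PiE_iff space_restrict_space)
  have c: "(\<lambda>l. l p) \<in> borel_measurable (PiM upper (\<lambda>_. unit_borel))" if "p \<in> upper" for p
    by (rule measurable_compose[OF measurable_component_singleton[OF that] id_unit_borel])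
  show "(\<lambda>l. matrix_of_upper l i j) \<in> borel_measurable (PiM upper (\<lambda>_. unit_borel))" for i j
    by (cases i j rule: linorder_cases) (simp_all add: matrix_of_upper_def c)
qed

text \<open>A product of image measures is the image of the product. The kernel thus becomes the law
  of a matrix computed from the points and one noise variable per entry, whose joint measurability
  is easy to see.\<close>

lemma qmm_kernel_eq: "qmm_kernel dist_law x = distr noise M_inf_borel (model_matrix x)"
proof -
  have "PiM upper (\<lambda>(i, j). dist_law (x i) (x j)) = PiM upper (\<lambda>p. distr unif unit_borel (g (x (fst p)) (x (snd p))))"
    by (intro PiM_cong) (auto simp: dist_law_def)
  also have "\<dots> = distr noise (PiM upper (\<lambda>_. unit_borel)) (\<lambda>\<omega>. \<lambda>p\<in>upper. g (x (fst p)) (x (snd p)) (\<omega> p))"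
    by (intro PiM_distr[symmetric] prob_space_unif g_unit)
  finally have P: "PiM upper (\<lambda>(i, j). dist_law (x i) (x j)) =
    distr noise (PiM upper (\<lambda>_. unit_borel)) (\<lambda>\<omega>. \<lambda>p\<in>upper. g (x (fst p)) (x (snd p)) (\<omega> p))" .
  have m: "(\<lambda>\<omega>. \<lambda>p\<in>upper. g (x (fst p)) (x (snd p)) (\<omega> p)) \<in> noise \<rightarrow>\<^sub>M PiM upper (\<lambda>_. unit_borel)"
    by (intro measurable_restrict) (rule measurable_compose[OF measurable_component_singleton[of _ upper "\<lambda>_. unif"] g_unit])
  show ?thesis
    unfolding qmm_kernel_def P distr_distr[OF matrix_of_upper_measurable m]
    by (simp add: comp_def model_matrix_def[abs_def])
qed

lemma model_matrix_entries:
  "i < j \<Longrightarrow> model_matrix x \<omega> i j = g (x i) (x j) (\<omega> (i, j))"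
  "j < i \<Longrightarrow> model_matrix x \<omega> i j = g (x j) (x i) (\<omega> (j, i))"
  "model_matrix x \<omega> i i = 0"
  by (simp_all add: model_matrix_def matrix_of_upper_def)

lemma model_matrix_M_inf: "model_matrix x \<omega> \<in> M_inf"
  by (auto simp: M_inf_def model_matrix_def matrix_of_upper_def g_bounds)

lemma model_matrix_measurable:
  "(\<lambda>z. model_matrix (fst z) (snd z)) \<in> unif_seq \<Otimes>\<^sub>M noise \<rightarrow>\<^sub>M M_inf_borel"
proof (rule measurable_M_inf_borelI[OF model_matrix_M_inf])
  have x: "(\<lambda>z. fst z i) \<in> borel_measurable (unif_seq \<Otimes>\<^sub>M noise)" for i
    by (rule measurable_compose[OF measurable_fst component_unif_seq])
  have \<omega>: "(\<lambda>z. snd z p) \<in> borel_measurable (unif_seq \<Otimes>\<^sub>M noise)" if "p \<in> upper" for p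
    by (rule measurable_compose[OF measurable_snd component_noise[OF that]])
  show "(\<lambda>z. model_matrix (fst z) (snd z) i j) \<in> borel_measurable (unif_seq \<Otimes>\<^sub>M noise)" for i j
    by (cases i j rule: linorder_cases) (simp_all add: model_matrix_entries g_compose x \<omega>)
qed

lemma model_matrix_section: "model_matrix x \<in> noise \<rightarrow>\<^sub>M M_inf_borel"
  using measurable_Pair2[OF model_matrix_measurable, of x] by (simp add: space_unif_seq)

lemma qmm_kernel_measurable: "qmm_kernel dist_law \<in> unif_seq \<rightarrow>\<^sub>M subprob_algebra M_inf_borel"
proof -
  have "noise \<in> space (subprob_algebra noise)"
    using prob_space_noise by (simp add: space_subprob_algebra prob_space_imp_subprob_space)
  then have "(\<lambda>x. distr ((\<lambda>_. noise) x) M_inf_borel (model_matrix x)) \<in> unif_seq \<rightarrow>\<^sub>M subprob_algebra M_inf_borel"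
    using model_matrix_measurable by (intro measurable_distr2 measurable_const) (simp_all add: split_beta')
  then show ?thesis by (simp add: qmm_kernel_eq[abs_def])
qed

definition g_cdf :: "real \<Rightarrow> nat \<times> nat \<Rightarrow> (nat \<Rightarrow> real) \<Rightarrow> real" where
  "g_cdf r p x = measure unif {w. g (x (fst p)) (x (snd p)) w \<in> {..r}}"

lemma g_cdf_bounds: "0 \<le> g_cdf r p x" "g_cdf r p x \<le> 1"
  using prob_space.prob_le_1[OF prob_space_unif] by (simp_all add: g_cdf_def)

lemma g_cdf_measurable: "g_cdf r p \<in> borel_measurable unif_seq"
  unfolding g_cdf_def[abs_def]
proof (rule borel_measurable_unif_kernel)
  have x: "(\<lambda>z. fst z i) \<in> borel_measurable (unif_seq \<Otimes>\<^sub>M borel)" for i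
    by (rule measurable_compose[OF measurable_fst component_unif_seq])
  show "(\<lambda>(x, w). g (x (fst p)) (x (snd p)) w) \<in> borel_measurable (unif_seq \<Otimes>\<^sub>M borel)"
    using g_compose[OF x x measurable_snd] by (simp add: split_beta')
qed simp

text \<open>Given the points, the entries above the diagonal use separate noise variables, so a box
  has a product as its probability; this is averaged over the points.\<close>

lemma qmm_tau_mbox:
  assumes J: "finite J" "J \<subseteq> upper"
  shows "emeasure (qmm_tau unif dist_law) (mbox J r) = ennreal (\<integral>x. (\<Prod>p\<in>J. g_cdf (r p) p x) \<partial>unif_seq)"
proof -
  interpret PU: prob_space unif_seq by (rule prob_space_unif_seq)
  have mb: "mbox J r \<in> sets M_inf_borel"
    using J(1) by (intro mbox_measurable space_M_inf_borel) (auto intro: entry_measurable_M_inf_borel)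
  have k: "emeasure (qmm_kernel dist_law x) (mbox J r) = ennreal (\<Prod>p\<in>J. g_cdf (r p) p x)" for x
  proof -
    have s: "{w \<in> space borel. g (x (fst p)) (x (snd p)) w \<in> {..r p}} \<in> sets borel" for p
      using g_section[of "x (fst p)" "x (snd p)"] by measurable
    have "emeasure (qmm_kernel dist_law x) (mbox J r) = emeasure noise (model_matrix x -` mbox J r \<inter> space noise)"
      unfolding qmm_kernel_eq by (rule emeasure_distr[OF model_matrix_section mb])
    also have "model_matrix x -` mbox J r \<inter> space noise =
        {\<omega> \<in> space noise. \<forall>p\<in>J. \<omega> p \<in> {w. g (x (fst p)) (x (snd p)) w \<in> {..r p}}}"
    proof -
      have "(\<forall>(i, j)\<in>J. model_matrix x \<omega> i j \<le> r (i, j)) \<longleftrightarrow> (\<forall>p\<in>J. g (x (fst p)) (x (snd p)) (\<omega> p) \<le> r p)" for \<omega>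
        using J(2) by (intro ball_cong refl) (auto simp: model_matrix_entries)
      then show ?thesis by (auto simp: mbox_def model_matrix_M_inf)
    qed
    also have "emeasure noise \<dots> = ennreal (\<Prod>p\<in>J. g_cdf (r p) p x)"
      unfolding g_cdf_def by (rule emeasure_PiM_unif_box[OF J]) (use s in simp)
    finally show ?thesis .
  qed
  have "emeasure (qmm_tau unif dist_law) (mbox J r) = (\<integral>\<^sup>+x. emeasure (qmm_kernel dist_law x) (mbox J r) \<partial>unif_seq)"
    unfolding qmm_tau_def by (rule emeasure_bind[OF _ qmm_kernel_measurable mb]) (simp add: space_unif_seq)
  also have "\<dots> = (\<integral>\<^sup>+x. ennreal (\<Prod>p\<in>J. g_cdf (r p) p x) \<partial>unif_seq)" by (simp add: k)
  also have "\<dots> = ennreal (\<integral>x. (\<Prod>p\<in>J. g_cdf (r p) p x) \<partial>unif_seq)"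
  proof (rule nn_integral_eq_integral)
    show "integrable unif_seq (\<lambda>x. \<Prod>p\<in>J. g_cdf (r p) p x)"
      by (rule PU.integrable_of_bound[where B = 1])
        (auto intro!: borel_measurable_prod g_cdf_measurable prod_le_1 simp: abs_prod g_cdf_bounds abs_of_nonneg)
  qed (simp add: prod_nonneg g_cdf_bounds)
  finally show ?thesis .
qed

lemma qmm_tau_eqI:
  assumes \<kappa>: "prob_space \<kappa>" "sets \<kappa> = sets M_inf_borel"
    and box: "\<And>J r. finite J \<Longrightarrow> J \<subseteq> upper \<Longrightarrow>
      (\<integral>x. (\<Prod>p\<in>J. g_cdf (of_rat (r p)) p x) \<partial>unif_seq) = measure \<kappa> (mbox J (\<lambda>p. of_rat (r p)))"
  shows "qmm_tau unif dist_law = \<kappa>"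
proof (rule measure_eqI_boxes[symmetric])
  interpret prob_space \<kappa> by fact
  show "finite_measure \<kappa>" by (rule finite_measure_axioms)
  show "sets \<kappa> = sets (ent upper)" by (simp add: \<kappa> sets_ent_upper)
  have "sets (qmm_tau unif dist_law) = sets M_inf_borel"
    unfolding qmm_tau_def by (rule sets_bind[OF sets_kernel[OF qmm_kernel_measurable]]) (simp_all add: space_unif_seq)
  then show "sets (qmm_tau unif dist_law) = sets (ent upper)" by (simp add: sets_ent_upper)
  show "emeasure \<kappa> (mbox J (\<lambda>p. of_rat (r p))) = emeasure (qmm_tau unif dist_law) (mbox J (\<lambda>p. of_rat (r p)))"
    if J: "finite J" "J \<subseteq> upper" for J r
    by (simp add: qmm_tau_mbox[OF J] box[OF J] emeasure_eq_measure)
qed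

definition triangles :: "real \<times> real \<times> real \<Rightarrow> bool" where
  "triangles = (\<lambda>(l, m, n). l \<le> m + n \<and> m \<le> l + n \<and> n \<le> l + m)"

abbreviation unif3 :: "(real \<times> real \<times> real) measure" where
  "unif3 \<equiv> unif \<Otimes>\<^sub>M unif \<Otimes>\<^sub>M unif"

definition lengths :: "(real \<times> real \<times> real) \<Rightarrow> (real \<times> real \<times> real) \<Rightarrow> real \<times> real \<times> real" where
  "lengths = (\<lambda>(a, b, c) (u, v, w). (g a b u, g b c v, g a c w))"

text \<open>The assumption speaks of entries of an infinite random matrix, the conclusion of three
  points and three product laws. Both are images of the six independent uniform variables that
  produce the entries over the indices 0, 1 and 2.\<close>

lemma AE_triangles:
  assumes tri: "AE D in qmm_tau unif dist_law. triangles (D 0 1, D 1 2, D 0 2)"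
  shows "AE (a, b, c) in unif3. AE (l_ab, l_bc, l_ac) in dist_law a b \<Otimes>\<^sub>M dist_law b c \<Otimes>\<^sub>M dist_law a c.
    l_ab \<le> l_bc + l_ac \<and> l_bc \<le> l_ab + l_ac \<and> l_ac \<le> l_ab + l_bc"
proof -
  interpret U: prob_space unif by (rule prob_space_unif)
  interpret UU: pair_prob_space unif unif ..
  interpret U3: pair_prob_space unif "unif \<Otimes>\<^sub>M unif" ..
  interpret U33: pair_prob_space unif3 unif3 ..
  interpret PU: prob_space unif_seq by (rule prob_space_unif_seq)
  interpret N: prob_space noise by (rule prob_space_noise)
  interpret PN: pair_prob_space unif_seq noise ..
  have predT: "Measurable.pred M (\<lambda>z. triangles (f z, h z, k z))"
    if [measurable]: "f \<in> borel_measurable M" "h \<in> borel_measurable M" "k \<in> borel_measurable M"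
    for M :: "'z measure" and f h k
    unfolding triangles_def by simp
  have "AE x in unif_seq. AE D in qmm_kernel dist_law x. triangles (D 0 1, D 1 2, D 0 2)"
    using tri unfolding qmm_tau_def
    by (subst (asm) AE_bind[OF qmm_kernel_measurable]) (auto intro!: predT entry_measurable_M_inf_borel)
  then have "AE x in unif_seq. AE \<omega> in noise. triangles (lengths (x 0, x 1, x 2) (\<omega> (0, 1), \<omega> (1, 2), \<omega> (0, 2)))"
  proof eventually_elim
    case (elim x)
    have "{D \<in> space M_inf_borel. triangles (D 0 1, D 1 2, D 0 2)} \<in> sets M_inf_borel"
      by (rule predE[OF predT]) (rule entry_measurable_M_inf_borel)+
    from elim[unfolded qmm_kernel_eq AE_distr_iff[OF model_matrix_section this]]
    show ?case by (simp add: lengths_def model_matrix_entries)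
  qed
  note ae = this
  have lm: "(\<lambda>z. triangles (lengths (fst z) (snd z))) \<in> measurable (unif3 \<Otimes>\<^sub>M unif3) (count_space UNIV)"
    unfolding lengths_def split_beta' by (intro predT g_compose) measurable
  have t1: "distr unif_seq unif3 (\<lambda>x. (x 0, x 1, x 2)) = unif3"
    using distr_PiM_triple[of "UNIV :: nat set" "\<lambda>_. unif" 0 1 2] prob_space_unif by simp
  have t2: "distr noise unif3 (\<lambda>\<omega>. (\<omega> (0, 1), \<omega> (1, 2), \<omega> (0, 2))) = unif3"
    using distr_PiM_triple[of upper "\<lambda>_. unif" "(0, 1)" "(1, 2)" "(0, 2)"] prob_space_unif by simp
  have m1: "(\<lambda>x. (x 0, x 1, x 2)) \<in> unif_seq \<rightarrow>\<^sub>M unif3"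
    by (intro measurable_Pair measurable_component_singleton) auto
  have m2: "(\<lambda>\<omega>. (\<omega> (0, 1), \<omega> (1, 2), \<omega> (0, 2))) \<in> noise \<rightarrow>\<^sub>M unif3"
    by (intro measurable_Pair measurable_component_singleton) auto
  let ?q = "\<lambda>(x, \<omega>). ((x 0, x 1, x 2), (\<omega> (0, 1), \<omega> (1, 2), \<omega> (0, 2)))"
  have mq: "?q \<in> unif_seq \<Otimes>\<^sub>M noise \<rightarrow>\<^sub>M unif3 \<Otimes>\<^sub>M unif3"
    using measurable_Pair[OF measurable_compose[OF measurable_fst m1] measurable_compose[OF measurable_snd m2]]
    by (simp add: split_beta')
  have d: "distr (unif_seq \<Otimes>\<^sub>M noise) (unif3 \<Otimes>\<^sub>M unif3) ?q = unif3 \<Otimes>\<^sub>M unif3"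
    using pair_measure_distr[OF m1 m2, unfolded t2, OF U3.sigma_finite_measure_axioms]
    unfolding t1 by (rule sym)
  have S: "{z \<in> space (unif3 \<Otimes>\<^sub>M unif3). triangles (lengths (fst z) (snd z))} \<in> sets (unif3 \<Otimes>\<^sub>M unif3)"
    using lm by (rule predE)
  have "AE z in unif_seq \<Otimes>\<^sub>M noise. triangles (lengths (fst (?q z)) (snd (?q z)))"
  proof (rule PN.AE_pair_measure)
    show "{z \<in> space (unif_seq \<Otimes>\<^sub>M noise). triangles (lengths (fst (?q z)) (snd (?q z)))} \<in> sets (unif_seq \<Otimes>\<^sub>M noise)"
      by (rule predE[OF measurable_compose[OF mq lm]])
  qed (use ae in simp)
  then have "AE z in distr (unif_seq \<Otimes>\<^sub>M noise) (unif3 \<Otimes>\<^sub>M unif3) ?q. triangles (lengths (fst z) (snd z))"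
    by (subst AE_distr_iff[OF mq S])
  \<comment> \<open>The statement now lives on six uniform variables; Fubini separates the three
    points from the three noise variables.\<close>
  then have "AE t in unif3. AE w in unif3. triangles (lengths t w)"
    unfolding d by (auto dest: U33.AE_pair)
  then show ?thesis
  proof eventually_elim
    case (elim t)
    obtain a b c where t: "t = (a, b, c)" by (cases t)
    \<comment> \<open>For fixed points, the three lengths use separate noise variables, so their
      joint law is the product required in the definition of a qmm-space.\<close>
    have q: "distr unif3 (unit_borel \<Otimes>\<^sub>M unit_borel \<Otimes>\<^sub>M unit_borel) (lengths (a, b, c)) =
        dist_law a b \<Otimes>\<^sub>M dist_law b c \<Otimes>\<^sub>M dist_law a c"
    proof -
      interpret A: prob_space "dist_law a c" by (rule prob_dist_law)
      interpret B: prob_space "dist_law b c" by (rule prob_dist_law)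
      interpret AB: pair_prob_space "dist_law b c" "dist_law a c" ..
      have 1: "dist_law b c \<Otimes>\<^sub>M dist_law a c =
          distr (unif \<Otimes>\<^sub>M unif) (unit_borel \<Otimes>\<^sub>M unit_borel) (\<lambda>(v, w). (g b c v, g a c w))"
        unfolding dist_law_def
        by (rule pair_measure_distr[OF g_unit g_unit]) (rule A.sigma_finite_measure_axioms[unfolded dist_law_def])
      have gm: "(\<lambda>(v, w). (g b c v, g a c w)) \<in> unif \<Otimes>\<^sub>M unif \<rightarrow>\<^sub>M unit_borel \<Otimes>\<^sub>M unit_borel"
        using measurable_Pair[OF measurable_compose[OF measurable_fst g_unit] measurable_compose[OF measurable_snd g_unit]]
        by (simp add: split_beta')
      have "dist_law a b \<Otimes>\<^sub>M dist_law b c \<Otimes>\<^sub>M dist_law a c =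
          distr unif3 (unit_borel \<Otimes>\<^sub>M unit_borel \<Otimes>\<^sub>M unit_borel) (\<lambda>(u, z). (g a b u, (\<lambda>(v, w). (g b c v, g a c w)) z))"
        unfolding 1 unfolding dist_law_def
        by (rule pair_measure_distr[OF g_unit gm]) (rule AB.sigma_finite_measure_axioms[unfolded 1])
      then show ?thesis by (simp add: lengths_def split_beta')
    qed
    have lm3: "lengths (a, b, c) \<in> unif3 \<rightarrow>\<^sub>M unit_borel \<Otimes>\<^sub>M unit_borel \<Otimes>\<^sub>M unit_borel"
      unfolding lengths_def split_beta'
      by (intro measurable_Pair measurable_compose[OF _ g_unit]) (simp_all, measurable)
    have S3: "{l \<in> space (unit_borel \<Otimes>\<^sub>M unit_borel \<Otimes>\<^sub>M unit_borel). triangles l} \<in> sets (unit_borel \<Otimes>\<^sub>M unit_borel \<Otimes>\<^sub>M unit_borel)"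
    proof -
      have "Measurable.pred (unit_borel \<Otimes>\<^sub>M unit_borel \<Otimes>\<^sub>M unit_borel) (\<lambda>l. triangles (fst l, fst (snd l), snd (snd l)))"
        by (intro predT measurable_compose[OF measurable_fst id_unit_borel]
            measurable_compose[OF measurable_snd measurable_compose[OF measurable_fst id_unit_borel]]
            measurable_compose[OF measurable_snd measurable_compose[OF measurable_snd id_unit_borel]])
      then show ?thesis by (auto dest: predE)
    qed
    have "AE l in dist_law a b \<Otimes>\<^sub>M dist_law b c \<Otimes>\<^sub>M dist_law a c. triangles l"
      unfolding q[symmetric] using elim by (subst AE_distr_iff[OF lm3 S3]) (simp add: t)
    then show ?case unfolding t triangles_def prod.case .
  qed
qed

lemma qmm_space_dist_law:
  assumes "AE D in qmm_tau unif dist_law. triangles (D 0 1, D 1 2, D 0 2)"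
  shows "qmm_space unif dist_law"
proof -
  interpret U: prob_space unif by (rule prob_space_unif)
  have "dist_law u u = return unit_borel 0" for u
  proof -
    have "g u u = (\<lambda>_. 0)" by (rule ext) (rule g_diag)
    then show ?thesis unfolding dist_law_def by (simp add: U.distr_const space_restrict_space)
  qed
  moreover have "dist_law u v = dist_law v u" for u v
  proof -
    have "g u v = g v u" by (rule ext) (rule g_sym)
    then show ?thesis by (simp add: dist_law_def)
  qed
  ultimately show ?thesis
    unfolding qmm_space_def
    using standard_borel_unif U.prob_space_axioms dist_law_measurable AE_triangles[OF assms] by simp
qed

end

section \<open>The representation theorem\<close>

lemma (in closure_array) kernels:
  shows "\<exists>\<phi> \<psi>. kernel_array \<kappa> \<phi> \<psi> \<and> (\<forall>s u. 0 \<le> \<psi> s u \<and> \<psi> s u \<le> 1)"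
proof (rule shell_kernel)
  fix \<phi> assume \<phi>: "(\<lambda>(s, u). \<phi> s u) \<in> borel_measurable (borel \<Otimes>\<^sub>M borel)"
    "\<And>s u. 0 \<le> \<phi> s u \<and> \<phi> s u \<le> 1"
    "\<And>i A r. A \<in> sets borel \<Longrightarrow>
      (\<integral>D. indicator {..r} (shell_row i D) * indicator A (shell D) \<partial>\<kappa>) =
      (\<integral>D. measure unif {u. \<phi> (shell D) u \<in> {..r}} * indicator A (shell D) \<partial>\<kappa>)"
  show ?thesis
  proof (rule pair_kernel)
    fix \<psi> assume \<psi>: "(\<lambda>(s, u). \<psi> s u) \<in> borel_measurable (pair_alg \<Otimes>\<^sub>M borel)"
      "\<And>s u. 0 \<le> \<psi> s u \<and> \<psi> s u \<le> 1"
      "\<And>i j A r. i \<noteq> j \<Longrightarrow> A \<in> sets pair_alg \<Longrightarrow>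
        (\<integral>D. indicator {..r} (D (2 * i) (2 * j)) * indicator A (pair_obs i j D) \<partial>\<kappa>) =
        (\<integral>D. measure unif {u. \<psi> (pair_obs i j D) u \<in> {..r}} * indicator A (pair_obs i j D) \<partial>\<kappa>)"
    have "kernel_array \<kappa> \<phi> \<psi>"
      by unfold_locales (rule \<phi>(1), rule \<phi>(3), assumption, rule \<psi>(1), rule \<psi>(3), assumption+)
    then show ?thesis using \<psi>(2) by (intro exI[of _ \<phi>] exI[of _ \<psi>]) simp
  qed
qed

theorem theorem1:
  fixes \<kappa> :: "(nat \<Rightarrow> nat \<Rightarrow> real) measure"
  assumes "\<kappa> \<in> chi_closure"
  shows "\<exists>(M :: real measure) d. qmm_space M d \<and> qmm_tau M d = \<kappa>"
proof -
  interpret closure_array \<kappa> by unfold_locales (rule assms)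
  obtain \<phi> \<psi> where K: "kernel_array \<kappa> \<phi> \<psi>" and \<psi>: "\<forall>s u. 0 \<le> \<psi> s u \<and> \<psi> s u \<le> 1"
    using kernels by auto
  interpret K: kernel_array \<kappa> \<phi> \<psi> by (rule K)
  have "\<exists>s. \<forall>J r. finite J \<longrightarrow> J \<subseteq> {(i, j). i < j} \<longrightarrow>
      K.quenched J (\<lambda>p. of_rat (r p)) s = measure \<kappa> (mbox J (\<lambda>p. of_rat (r p)))"
    by (rule K.exists_good_shell)
  then obtain s where s: "\<And>J r. finite J \<Longrightarrow> J \<subseteq> {(i, j). i < j} \<Longrightarrow>
      K.quenched J (\<lambda>p. of_rat (r p)) s = measure \<kappa> (mbox J (\<lambda>p. of_rat (r p)))"
    by blast
  \<comment> \<open>Points are uniform numbers whose rows are \<open>\<phi> s u\<close> for the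
    fixed typical shell \<open>s\<close>, and \<open>w\<close> is the noise of the pair. Sorting
    gives symmetry, and the diagonal is set to 0 by force.\<close>
  define g where "g u v w = (if u = v then 0 else \<psi> (sort_obs ((s, \<phi> s u), \<phi> s v)) w)" for u v w
  interpret L: length_model g
  proof
    let ?B = "(borel \<Otimes>\<^sub>M borel) \<Otimes>\<^sub>M borel :: ((real \<times> real) \<times> real) measure"
    have p: "(\<lambda>z. fst (fst z)) \<in> borel_measurable ?B" "(\<lambda>z. snd (fst z)) \<in> borel_measurable ?B"
      by measurable
    have "(\<lambda>z. (sort_obs ((s, \<phi> s (fst (fst z))), \<phi> s (snd (fst z))), snd z)) \<in> ?B \<rightarrow>\<^sub>M pair_alg \<Otimes>\<^sub>M borel"
      by (intro measurable_Pair measurable_compose[OF _ sort_obs_measurable] measurable_const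
          measurable_compose[OF p(1) K.\<phi>_section] measurable_compose[OF p(2) K.\<phi>_section] measurable_snd) simp
    from measurable_compose[OF this K.\<psi>]
    have m: "(\<lambda>z. \<psi> (sort_obs ((s, \<phi> s (fst (fst z))), \<phi> s (snd (fst z)))) (snd z)) \<in> borel_measurable ?B"
      by simp
    show "(\<lambda>z. g (fst (fst z)) (snd (fst z)) (snd z)) \<in> borel_measurable ?B"
      unfolding g_def by (intro measurable_If m borel_measurable_const borel_measurable_eq p)
    show "0 \<le> g u v w \<and> g u v w \<le> 1" for u v w
      using spec[OF spec[OF \<psi>, of "sort_obs ((s, \<phi> s u), \<phi> s v)"], of w] by (cases "u = v") (simp_all add: g_def)
    show "g u v w = g v u w" for u v w 
      unfolding g_def sort_obs_swap[of s "\<phi> s u" "\<phi> s v"] by (simp only: eq_commute[of u v])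
    show "g u u w = 0" for u w by (simp add: g_def)
  qed
  have tau: "qmm_tau unif L.dist_law = \<kappa>"
  proof (rule L.qmm_tau_eqI[OF prob_space_axioms sets_eq])
    fix J :: "(nat \<times> nat) set" and r :: "nat \<times> nat \<Rightarrow> rat"
    assume J: "finite J" "J \<subseteq> {(i, j). i < j}"
    have "(\<integral>x. (\<Prod>p\<in>J. L.g_cdf (of_rat (r p)) p x) \<partial>unif_seq) = K.quenched J (\<lambda>p. of_rat (r p)) s"
      unfolding K.quenched_def
    \<comment> \<open>The two integrands differ only where sampled points coincide, which is a null
      event.\<close>
    proof (rule integral_cong_AE)
      show "AE x in unif_seq. (\<Prod>p\<in>J. L.g_cdf (of_rat (r p)) p x) = (\<Prod>p\<in>J. K.model_cdf (of_rat (r p)) p s x)"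
        using AE_unif_seq_distinct
      proof eventually_elim
        case (elim x)
        show ?case
        proof (rule prod.cong[OF refl])
          fix p assume "p \<in> J"
          then have "fst p \<noteq> snd p" using J(2) by auto
          then have "x (fst p) \<noteq> x (snd p)" using elim by blast
          then show "L.g_cdf (of_rat (r p)) p x = K.model_cdf (of_rat (r p)) p s x"
            by (simp add: L.g_cdf_def K.model_cdf_def K.pair_cdf_def g_def)
        qed
      qed
    qed (intro borel_measurable_prod L.g_cdf_measurable K.model_cdf_section)+
    then show "(\<integral>x. (\<Prod>p\<in>J. L.g_cdf (of_rat (r p)) p x) \<partial>unif_seq) = measure \<kappa> (mbox J (\<lambda>p. of_rat (r p)))"
      using s[OF J] by simp
  qed
  have "AE D in \<kappa>. L.triangles (D 0 1, D 1 2, D 0 2)"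
    using chi_closure_triangle[OF assms, of 0 1 2] chi_closure_triangle[OF assms, of 1 2 0]
      chi_closure_triangle[OF assms, of 0 2 1] AE_space
  proof eventually_elim
    case (elim D)
    have "D 2 1 = D 1 2" "D 1 0 = D 0 1" "D 2 0 = D 0 2" using elim(4) by (auto simp: space_eq M_inf_def)
    with elim show ?case by (simp add: L.triangles_def)
  qed
  then have "qmm_space unif L.dist_law" unfolding tau[symmetric] by (rule L.qmm_space_dist_law)
  with tau show ?thesis by blast
qed

end
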